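(* Let $k$ be an algebraically closed field of characteristic zero, let $G$ be a finite group and $\omega: G\times G\times G\to k^\times$ a normalized 3-cocycle. Consider the conditions: (i) $e(\omega_g)$ divides $[G:g]$, for all $g\in G$; (ii) $\exp D^\omega G$ divides $|G|$. Then (i) implies (ii). If the order of $G$ is odd, then (i) is equivalent to (ii).
   Context: For $g\in G$, $[G:g]$ is the index in $G$ of the subgroup $\langle g\rangle$ generated by $g$, $\omega_g$ is the restriction of $\omega$ to $\langle g\rangle$, and $e(\omega_g)$ is the order of its class in $H^3(\langle g\rangle,k^\times)$ (trivial action). The twisted quantum double $D^\omega G$ (Dijkgraaf–Pasquier–Roche) is the following quasitriangular semisimple quasi-Hopf algebra over $k$, with basis $\{e_g\# x: g,x\in G\}$ (the underlying vector space is $k^G\otimes kG$, $e_g\in k^G$ being the canonical idempotents $e_g(h)=\delta_{g,h}$). Put $$\theta_g(x,y)=\frac{\omega(g,x,y)\,\omega(x,y,(xy)^{-1}g(xy))}{\omega(x,x^{-1}gx,y)},\qquad \gamma_g(x,y)=\frac{\omega(x,y,g)\,\omega(g,g^{-1}xg,g^{-1}yg)}{\omega(x,g,g^{-1}yg)}.$$ Then $(e_g\#x)(e_h\#y)=\delta_{g,xhx^{-1}}\theta_g(x,y)\,e_g\#xy$, unit $\sum_g e_g\#e$, $\Delta(e_g\#x)=\sum_{st=g}\gamma_x(s,t)\,e_s\#x\otimes e_t\#x$, $\epsilon(e_g\#x)=\delta_{g,e}$, antipode $\mathcal S(e_g\#x)=\theta_{g^{-1}}(x,x^{-1})^{-1}\gamma_x(g,g^{-1})^{-1}e_{x^{-1}g^{-1}x}\#x^{-1}$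 with $\alpha=1$, $\beta=\sum_g\omega(g,g^{-1},g)e_g$, associator $\phi=\sum_{a,b,c}\omega(a,b,c)^{-1}e_a\otimes e_b\otimes e_c$ and $R$-matrix $\mathcal R=\sum_g e_g\otimes g$. Here $e_g$ and $g$ also denote $e_g\#e$ and $\sum_h e_h\#g$, respectively. The exponent of a fusion category $\mathcal C$ is the smallest integer $N\ge 1$ such that $(c_{V,U}c_{U,V})^N=\operatorname{id}$ for all objects $U,V$ of the Drinfeld center $\mathcal Z(\mathcal C)$, where $c$ is the canonical braiding of $\mathcal Z(\mathcal C)$. One has $\exp\mathcal C=\exp\mathcal Z(\mathcal C)$. The exponent $\exp H$ of a finite-dimensional semisimple quasi-Hopf algebra $H$ is the exponent of its category of finite-dimensional representations $\operatorname{Rep}H$. Since $\operatorname{Rep}D^\omega G$ is equivalent to $\mathcal Z(\operatorname{Vec}^G_\omega)$ (where $\operatorname{Vec}^G_\omega$ is the category of finite-dimensional $G$-graded vector spaces with associativity given by $\omega$), $\exp D^\omega G$ equals the order of $\mathcal R_{21}\mathcal R$. *)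

theory Defs
  imports
    "HOL-Algebra.Coset"
    "HOL-Algebra.Generated_Groups"
    "HOL-Algebra.Multiplicative_Group"
    "HOL-Computational_Algebra.Polynomial"
    "Jordan_Normal_Form.Matrix"
begin

section \<open>Cohomology in degree three\<close>

definition cocycle3 :: "('g, 'm) monoid_scheme \<Rightarrow> ('g \<Rightarrow> 'g \<Rightarrow> 'g \<Rightarrow> 'k::field) \<Rightarrow> bool" where
  "cocycle3 G \<omega> \<longleftrightarrow>
    (\<forall>a\<in>carrier G. \<forall>b\<in>carrier G. \<forall>c\<in>carrier G. \<omega> a b c \<noteq> 0) \<and>
    (\<forall>a\<in>carrier G. \<forall>b\<in>carrier G. \<forall>c\<in>carrier G. \<forall>d\<in>carrier G.
      \<omega> b c d * \<omega> a (b \<otimes>\<^bsub>G\<^esub> c) d * \<omega> a b c = \<omega> (a \<otimes>\<^bsub>G\<^esub> b) c d * \<omega> a b (c \<otimes>\<^bsub>G\<^esub> d))"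

definition normalized3 :: "('g, 'm) monoid_scheme \<Rightarrow> ('g \<Rightarrow> 'g \<Rightarrow> 'g \<Rightarrow> 'k::field) \<Rightarrow> bool" where
  "normalized3 G \<omega> \<longleftrightarrow>
    (\<forall>a\<in>carrier G. \<forall>b\<in>carrier G.
      \<omega> \<one>\<^bsub>G\<^esub> a b = 1 \<and> \<omega> a \<one>\<^bsub>G\<^esub> b = 1 \<and> \<omega> a b \<one>\<^bsub>G\<^esub> = 1)"

text \<open>
  Cochains are made extensional, so that a cochain is determined by its values on the group
  and the cocycles literally form a group under pointwise multiplication.
\<close>

abbreviation triples :: "('g, 'm) monoid_scheme \<Rightarrow> ('g \<times> 'g \<times> 'g) set" where
  "triples G \<equiv> carrier G \<times> carrier G \<times> carrier G"

definition cochain3 ::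
  "('g, 'm) monoid_scheme \<Rightarrow> ('g \<Rightarrow> 'g \<Rightarrow> 'g \<Rightarrow> 'k) \<Rightarrow> ('g \<times> 'g \<times> 'g \<Rightarrow> 'k)" where
  "cochain3 G \<omega> = restrict (\<lambda>(a, b, c). \<omega> a b c) (triples G)"

definition Z3 :: "('g, 'm) monoid_scheme \<Rightarrow> ('g \<times> 'g \<times> 'g \<Rightarrow> 'k::field) monoid" where
  "Z3 G = \<lparr>carrier = {cochain3 G \<omega> | \<omega>. cocycle3 G \<omega>},
           monoid.mult = (\<lambda>f f'. restrict (\<lambda>t. f t * f' t) (triples G)),
           monoid.one = restrict (\<lambda>t. 1) (triples G)\<rparr>"

definition coboundary2 ::
  "('g, 'm) monoid_scheme \<Rightarrow> ('g \<Rightarrow> 'g \<Rightarrow> 'k::field) \<Rightarrow> 'g \<Rightarrow> 'g \<Rightarrow> 'g \<Rightarrow> 'k" where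
  "coboundary2 G \<mu> a b c =
    (\<mu> b c * \<mu> a (b \<otimes>\<^bsub>G\<^esub> c)) / (\<mu> (a \<otimes>\<^bsub>G\<^esub> b) c * \<mu> a b)"

definition B3 :: "('g, 'm) monoid_scheme \<Rightarrow> ('g \<times> 'g \<times> 'g \<Rightarrow> 'k::field) set" where
  "B3 G = {cochain3 G (coboundary2 G \<mu>) | \<mu>. \<forall>a\<in>carrier G. \<forall>b\<in>carrier G. \<mu> a b \<noteq> 0}"

definition H3 :: "('g, 'm) monoid_scheme \<Rightarrow> ('g \<times> 'g \<times> 'g \<Rightarrow> 'k::field) set monoid" where
  "H3 G = Z3 G Mod B3 G"

definition class_order :: "('g, 'm) monoid_scheme \<Rightarrow> ('g \<Rightarrow> 'g \<Rightarrow> 'g \<Rightarrow> 'k::field) \<Rightarrow> nat" where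
  "class_order G \<omega> = group.ord (H3 G) (B3 G #>\<^bsub>Z3 G\<^esub> cochain3 G \<omega>)"

abbreviation cyclic_sub :: "('g, 'm) monoid_scheme \<Rightarrow> 'g \<Rightarrow> ('g, 'm) monoid_scheme" where
  "cyclic_sub G g \<equiv> G\<lparr>carrier := generate G {g}\<rparr>"

definition cyclic_index :: "('g, 'm) monoid_scheme \<Rightarrow> 'g \<Rightarrow> nat" where
  "cyclic_index G g = card (rcosets\<^bsub>G\<^esub> (generate G {g}))"


section \<open>Quasi-Hopf algebras given by structure constants\<close>

text \<open>
  A quasi-Hopf algebra with a finite basis. An element of its \<open>n\<close>-th tensor power is
  its coefficient function of \<open>n\<close> basis arguments; the structure maps are given on the
  basis, their last arguments being the basis labels whose coefficient is returned. The
  associator \<open>\<phi>\<close> satisfies \<open>(id \<otimes> \<Delta>)(\<Delta> a) \<phi> = \<phi> (\<Delta> \<otimes> id)(\<Delta> a)\<close>.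
\<close>

record ('b, 'k) quasi_hopf =
  qbasis :: "'b set"
  qmult :: "'b \<Rightarrow> 'b \<Rightarrow> 'b \<Rightarrow> 'k"
  qunit :: "'b \<Rightarrow> 'k"
  qcomult :: "'b \<Rightarrow> 'b \<Rightarrow> 'b \<Rightarrow> 'k"
  qcounit :: "'b \<Rightarrow> 'k"
  qassoc :: "'b \<Rightarrow> 'b \<Rightarrow> 'b \<Rightarrow> 'k"
  qantipode :: "'b \<Rightarrow> 'b \<Rightarrow> 'k"
  qalpha :: "'b \<Rightarrow> 'k"
  qbeta :: "'b \<Rightarrow> 'k"

record ('b, 'k) quasitriangular_quasi_hopf = "('b, 'k) quasi_hopf" +
  qRmatrix :: "'b \<Rightarrow> 'b \<Rightarrow> 'k"


section \<open>The monoidal category of finite-dimensional representations\<close>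

text \<open>
  Up to isomorphism a finite-dimensional representation lives on some \<open>k\<^sup>n\<close>, so it is a
  pair of \<open>n\<close> and the matrices by which the basis elements act.
\<close>

type_synonym ('b, 'k) rep = "nat \<times> ('b \<Rightarrow> 'k mat)"

abbreviation rdim :: "('b, 'k) rep \<Rightarrow> nat" where "rdim \<equiv> fst"
abbreviation ract :: "('b, 'k) rep \<Rightarrow> 'b \<Rightarrow> 'k mat" where "ract \<equiv> snd"

text \<open>
  Kronecker product. The standard basis of \<open>k\<^sup>m \<otimes> k\<^sup>n\<close> is numbered lexicographically,
  which identifies \<open>(k\<^sup>l \<otimes> k\<^sup>m) \<otimes> k\<^sup>n\<close> and \<open>k\<^sup>l \<otimes> (k\<^sup>m \<otimes> k\<^sup>n)\<close> as vector spaces with the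
  same \<open>k\<^bsup>l m n\<^esup>\<close>, the canonical map between them becoming the identity matrix.
\<close>

definition kron :: "'k::semiring_0 mat \<Rightarrow> 'k mat \<Rightarrow> 'k mat" where
  "kron A B = mat (dim_row A * dim_row B) (dim_col A * dim_col B)
    (\<lambda>(i, j). A $$ (i div dim_row B, j div dim_col B) * B $$ (i mod dim_row B, j mod dim_col B))"

definition act1 ::
  "('b, 'k::field, 'm) quasi_hopf_scheme \<Rightarrow> ('b, 'k) rep \<Rightarrow> ('b \<Rightarrow> 'k) \<Rightarrow> 'k mat" where
  "act1 H X u = mat (rdim X) (rdim X) (\<lambda>p. \<Sum>b\<in>qbasis H. u b * ract X b $$ p)"

definition act2 ::
  "('b, 'k::field, 'm) quasi_hopf_scheme \<Rightarrow> ('b, 'k) rep \<Rightarrow> ('b, 'k) rep \<Rightarrow>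
    ('b \<Rightarrow> 'b \<Rightarrow> 'k) \<Rightarrow> 'k mat" where
  "act2 H X Y u = mat (rdim X * rdim Y) (rdim X * rdim Y)
    (\<lambda>p. \<Sum>b\<in>qbasis H. \<Sum>c\<in>qbasis H. u b c * kron (ract X b) (ract Y c) $$ p)"

definition act3 ::
  "('b, 'k::field, 'm) quasi_hopf_scheme \<Rightarrow> ('b, 'k) rep \<Rightarrow> ('b, 'k) rep \<Rightarrow> ('b, 'k) rep \<Rightarrow>
    ('b \<Rightarrow> 'b \<Rightarrow> 'b \<Rightarrow> 'k) \<Rightarrow> 'k mat" where
  "act3 H X Y Z u = mat (rdim X * rdim Y * rdim Z) (rdim X * rdim Y * rdim Z)
    (\<lambda>p. \<Sum>b\<in>qbasis H. \<Sum>c\<in>qbasis H. \<Sum>d\<in>qbasis H.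
      u b c d * kron (kron (ract X b) (ract Y c)) (ract Z d) $$ p)"

definition is_rep :: "('b, 'k::field, 'm) quasi_hopf_scheme \<Rightarrow> ('b, 'k) rep \<Rightarrow> bool" where
  "is_rep H X \<longleftrightarrow>
    (\<forall>b\<in>qbasis H. ract X b \<in> carrier_mat (rdim X) (rdim X)) \<and>
    (\<forall>b\<in>qbasis H. \<forall>c\<in>qbasis H. ract X b * ract X c = act1 H X (qmult H b c)) \<and>
    act1 H X (qunit H) = 1\<^sub>m (rdim X)"

definition rep_hom ::
  "('b, 'k::field, 'm) quasi_hopf_scheme \<Rightarrow> ('b, 'k) rep \<Rightarrow> ('b, 'k) rep \<Rightarrow> 'k mat set" where
  "rep_hom H X Y =
    {f \<in> carrier_mat (rdim Y) (rdim X). \<forall>b\<in>qbasis H. f * ract X b = ract Y b * f}"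

definition rep_tensor ::
  "('b, 'k::field, 'm) quasi_hopf_scheme \<Rightarrow> ('b, 'k) rep \<Rightarrow> ('b, 'k) rep \<Rightarrow> ('b, 'k) rep" where
  "rep_tensor H X Y = (rdim X * rdim Y, \<lambda>b. act2 H X Y (qcomult H b))"

text \<open>The associativity constraint \<open>(X \<otimes> Y) \<otimes> Z \<rightarrow> X \<otimes> (Y \<otimes> Z)\<close>.\<close>

definition rep_assoc ::
  "('b, 'k::field, 'm) quasi_hopf_scheme \<Rightarrow> ('b, 'k) rep \<Rightarrow> ('b, 'k) rep \<Rightarrow> ('b, 'k) rep \<Rightarrow>
    'k mat" where
  "rep_assoc H X Y Z = act3 H X Y Z (qassoc H)"


section \<open>Drinfeld center and exponent\<close>

text \<open>
  A half-braiding \<open>e\<^sub>X : V \<otimes> X \<rightarrow> X \<otimes> V\<close>. The last clause is the hexagon, as an equality of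
  maps \<open>(V \<otimes> X) \<otimes> Y \<rightarrow> X \<otimes> (Y \<otimes> V)\<close>. Values of \<open>e\<close> at arguments that are not
  representations are irrelevant.
\<close>

definition half_braiding ::
  "('b, 'k::field, 'm) quasi_hopf_scheme \<Rightarrow> ('b, 'k) rep \<Rightarrow> (('b, 'k) rep \<Rightarrow> 'k mat) \<Rightarrow> bool" where
  "half_braiding H V e \<longleftrightarrow>
    (\<forall>X. is_rep H X \<longrightarrow>
      e X \<in> rep_hom H (rep_tensor H V X) (rep_tensor H X V) \<and> invertible_mat (e X)) \<and>
    (\<forall>X Y. is_rep H X \<longrightarrow> is_rep H Y \<longrightarrow> (\<forall>f\<in>rep_hom H X Y.
      e Y * kron (1\<^sub>m (rdim V)) f = kron f (1\<^sub>m (rdim V)) * e X)) \<and>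
    (\<forall>X Y. is_rep H X \<longrightarrow> is_rep H Y \<longrightarrow>
      rep_assoc H X Y V * e (rep_tensor H X Y) * rep_assoc H V X Y =
      kron (1\<^sub>m (rdim X)) (e Y) * rep_assoc H X V Y * kron (e X) (1\<^sub>m (rdim Y)))"

definition rep_center ::
  "('b, 'k::field, 'm) quasi_hopf_scheme \<Rightarrow>
    (('b, 'k) rep \<times> (('b, 'k) rep \<Rightarrow> 'k mat)) set" where
  "rep_center H = {(V, e). is_rep H V \<and> half_braiding H V e}"

text \<open>The canonical braiding \<open>c\<^bsub>U,V\<^esub> : U \<otimes> V \<rightarrow> V \<otimes> U\<close> of the center.\<close>

definition center_braiding ::
  "('b, 'k) rep \<times> (('b, 'k) rep \<Rightarrow> 'k mat) \<Rightarrow> ('b, 'k) rep \<times> (('b, 'k) rep \<Rightarrow> 'k mat) \<Rightarrow>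
    'k mat" where
  "center_braiding U V = snd U (fst V)"

definition quasi_hopf_exp :: "('b, 'k::field, 'm) quasi_hopf_scheme \<Rightarrow> nat" where
  "quasi_hopf_exp H = (LEAST N. 1 \<le> N \<and>
    (\<forall>U\<in>rep_center H. \<forall>V\<in>rep_center H.
      (center_braiding V U * center_braiding U V) ^\<^sub>m N = 1\<^sub>m (rdim (fst U) * rdim (fst V))))"


section \<open>The twisted quantum double\<close>

definition dpr_theta ::
  "('g, 'm) monoid_scheme \<Rightarrow> ('g \<Rightarrow> 'g \<Rightarrow> 'g \<Rightarrow> 'k::field) \<Rightarrow> 'g \<Rightarrow> 'g \<Rightarrow> 'g \<Rightarrow> 'k" where
  "dpr_theta G \<omega> g x y =
    \<omega> g x y * \<omega> x y (inv\<^bsub>G\<^esub> (x \<otimes>\<^bsub>G\<^esub> y) \<otimes>\<^bsub>G\<^esub> g \<otimes>\<^bsub>G\<^esub> (x \<otimes>\<^bsub>G\<^esub> y))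
      / \<omega> x (inv\<^bsub>G\<^esub> x \<otimes>\<^bsub>G\<^esub> g \<otimes>\<^bsub>G\<^esub> x) y"

definition dpr_gamma ::
  "('g, 'm) monoid_scheme \<Rightarrow> ('g \<Rightarrow> 'g \<Rightarrow> 'g \<Rightarrow> 'k::field) \<Rightarrow> 'g \<Rightarrow> 'g \<Rightarrow> 'g \<Rightarrow> 'k" where
  "dpr_gamma G \<omega> g x y =
    \<omega> x y g * \<omega> g (inv\<^bsub>G\<^esub> g \<otimes>\<^bsub>G\<^esub> x \<otimes>\<^bsub>G\<^esub> g) (inv\<^bsub>G\<^esub> g \<otimes>\<^bsub>G\<^esub> y \<otimes>\<^bsub>G\<^esub> g)
      / \<omega> x g (inv\<^bsub>G\<^esub> g \<otimes>\<^bsub>G\<^esub> y \<otimes>\<^bsub>G\<^esub> g)"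

text \<open>The basis element \<open>e\<^sub>g # x\<close> is the pair \<open>(g, x)\<close>.\<close>

definition twisted_double ::
  "('g, 'm) monoid_scheme \<Rightarrow> ('g \<Rightarrow> 'g \<Rightarrow> 'g \<Rightarrow> 'k::field) \<Rightarrow>
    ('g \<times> 'g, 'k) quasitriangular_quasi_hopf" where
  "twisted_double G \<omega> = \<lparr>
    qbasis = carrier G \<times> carrier G,
    qmult = (\<lambda>(g, x) (h, y) (l, z).
      if g = x \<otimes>\<^bsub>G\<^esub> h \<otimes>\<^bsub>G\<^esub> inv\<^bsub>G\<^esub> x \<and> l = g \<and> z = x \<otimes>\<^bsub>G\<^esub> y then dpr_theta G \<omega> g x y else 0),
    qunit = (\<lambda>(g, x). if x = \<one>\<^bsub>G\<^esub> then 1 else 0),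
    qcomult = (\<lambda>(g, x) (s, y) (t, z).
      if s \<otimes>\<^bsub>G\<^esub> t = g \<and> y = x \<and> z = x then dpr_gamma G \<omega> x s t else 0),
    qcounit = (\<lambda>(g, x). if g = \<one>\<^bsub>G\<^esub> then 1 else 0),
    qassoc = (\<lambda>(a, x) (b, y) (c, z).
      if x = \<one>\<^bsub>G\<^esub> \<and> y = \<one>\<^bsub>G\<^esub> \<and> z = \<one>\<^bsub>G\<^esub> then inverse (\<omega> a b c) else 0),
    qantipode = (\<lambda>(g, x) (h, y).
      if h = inv\<^bsub>G\<^esub> x \<otimes>\<^bsub>G\<^esub> inv\<^bsub>G\<^esub> g \<otimes>\<^bsub>G\<^esub> x \<and> y = inv\<^bsub>G\<^esub> x
      then inverse (dpr_theta G \<omega> (inv\<^bsub>G\<^esub> g) x (inv\<^bsub>G\<^esub> x)) * inverse (dpr_gamma G \<omega> x g (inv\<^bsub>G\<^esub> g))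
      else 0),
    qalpha = (\<lambda>(g, x). if x = \<one>\<^bsub>G\<^esub> then 1 else 0),
    qbeta = (\<lambda>(g, x). if x = \<one>\<^bsub>G\<^esub> then \<omega> g (inv\<^bsub>G\<^esub> g) g else 0),
    qRmatrix = (\<lambda>(g, x) (h, y). if x = \<one>\<^bsub>G\<^esub> \<and> y = g then 1 else 0)\<rparr>"

end

theory Submission
  imports Defs "Jordan_Normal_Form.Determinant"
begin

text \<open>
  Write \<open>N = |G|\<close> and \<open>\<Theta> m g\<close> for the product of \<open>\<omega>(g, g\<^sup>i, g)\<close> over \<open>i < m\<close>. Both conditions of
  the theorem are compared with the condition that \<open>\<Theta> N g = 1\<close> for all \<open>g\<close>.

  On the side of cohomology, \<open>\<Theta> (ord g) g\<close> is a complete invariant of the class of \<open>\<omega>\<close> on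
  \<open>\<langle>g\<rangle>\<close>: the \<open>m\<close>-th power of the class is trivial if and only if \<open>\<Theta> (ord g) g ^ m = 1\<close>
  (\<open>class_order_cyclic_sub_dvd_iff\<close>). As \<open>\<Theta> N g\<close> is the \<open>[G:g]\<close>-th power of \<open>\<Theta> (ord g) g\<close>,
  condition (i) says exactly that \<open>\<Theta> N g = 1\<close> for all \<open>g\<close>.

  On the side of the exponent, two facts are needed. If \<open>g\<^sup>m = 1\<close> and \<open>\<Theta> m g = 1\<close> for all \<open>g\<close>,
  then the \<open>m\<close>-th power of every double braiding in the center of the representation category
  is the identity (\<open>M_pow_eq_one\<close>); this gives (ii) from (i), and also that the exponent exists,
  because \<open>m = N\<^sup>2\<close> always qualifies. Conversely, if the \<open>m\<close>-th power of every double braiding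
  is the identity and \<open>g\<^sup>m = 1\<close>, then \<open>(\<Theta> m g)\<^sup>2 = 1\<close> (\<open>kills_center_\<Theta>\<close>): the half-braiding given by
  the \<open>R\<close>-matrix makes the regular representation an object of the center, and its double
  braiding with itself acts on the tensor square of the part of degree \<open>g\<close> by \<open>g \<otimes> g\<close>. For \<open>N\<close> odd,
  \<open>\<Theta> N g\<close> also has odd order, so its square can be dropped.

  The first fact is the hard one. Conceptually, the representation category \<open>\<C>\<close> is modular, its
  center is \<open>\<C> \<boxtimes> \<C>\<^sup>r\<^sup>e\<^sup>v\<close>, and the double braiding is expressed by the twist \<open>T\<close> through
  \<open>c c = T\<^bsub>V \<otimes> W\<^esub> (T\<^sub>V \<otimes> T\<^sub>W)\<^sup>-\<^sup>1\<close>, where \<open>T\<close> acts on the part of degree \<open>g\<close> of an object of \<open>\<C>\<close> by \<open>g\<close> itself.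
  The proof makes this concrete without constructing any equivalence of categories. A
  half-braiding on \<open>V\<close> is determined by its value at the regular representation, hence by
  operators \<open>E (g, x)\<close> on \<open>V\<close>. Those with \<open>g = 1\<close> are projections and refine the grading of \<open>V\<close> to
  a double grading, in which the part of bidegree \<open>(x, c)\<close> looks like a product \<open>A\<^sub>x \<otimes> B\<^sub>c\<close> with
  \<open>A\<close> from \<open>\<C>\<close> and \<open>B\<close> from \<open>\<C>\<^sup>r\<^sup>e\<^sup>v\<close>. The group acts on the first factor by \<open>P\<close>, from the left, and on
  the second by \<open>Q\<close>, from the right; the two actions commute and are projective with the
  multipliers \<open>\<theta>\<close> and \<open>\<theta>\<^sup>-\<^sup>1\<close> (\<open>P_P\<close>, \<open>Q_Q\<close>, \<open>P_Q\<close>). The twist is the action of \<open>(x, c)\<close> on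
  the part of bidegree \<open>(x, c)\<close>, so its \<open>m\<close>-th power is \<open>\<Theta> m x / \<Theta> m c\<close> times the action of
  \<open>(x\<^sup>m, c\<^sup>m)\<close> (\<open>T_pow\<close>). In suitable coordinates \<open>K\<close> on \<open>V \<otimes> W\<close> the double braiding composed with
  \<open>T \<otimes> T\<close> is the action of the total bidegree \<open>(p, q)\<close> (\<open>M_K_T\<close>), whose \<open>m\<close>-th power is
  \<open>\<Theta> m p / \<Theta> m q\<close> times the action of \<open>(p\<^sup>m, q\<^sup>m)\<close> (\<open>M_pow_K\<close>). Under the hypotheses on \<open>m\<close> both powers
  are trivial, hence so is that of the double braiding.
\<close>

section \<open>Three-cocycles\<close>

abbreviation conj_left :: "('a, 'm) monoid_scheme \<Rightarrow> 'a \<Rightarrow> 'a \<Rightarrow> 'a" (infixr \<open>\<triangleright>\<index>\<close> 74) where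
  "x \<triangleright>\<^bsub>G\<^esub> b \<equiv> x \<otimes>\<^bsub>G\<^esub> b \<otimes>\<^bsub>G\<^esub> inv\<^bsub>G\<^esub> x"

abbreviation conj_right :: "('a, 'm) monoid_scheme \<Rightarrow> 'a \<Rightarrow> 'a \<Rightarrow> 'a" (infixl \<open>\<triangleleft>\<index>\<close> 74) where
  "b \<triangleleft>\<^bsub>G\<^esub> x \<equiv> inv\<^bsub>G\<^esub> x \<otimes>\<^bsub>G\<^esub> b \<otimes>\<^bsub>G\<^esub> x"

lemma both_times: "a = b \<Longrightarrow> c = d \<Longrightarrow> a * c = b * (d :: 'k::field)"
  by simp

text \<open>
  A multiplicative relation among nonzero scalars follows from a product of known relations once
  the two become equal after cross-multiplication. The identities between values of \<open>\<omega>\<close> below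
  are proved like this. Each of them holds for every three-cocycle because a certain
  three-cycle in the bar complex of the free group on the occurring letters is a boundary; the
  instances of \<open>pentagon\<close> in the proof are the four-simplices of a chain with this boundary.
\<close>

lemma balanced: "X = Y \<Longrightarrow> Y \<noteq> 0 \<Longrightarrow> A * X = B * Y \<Longrightarrow> A = (B :: 'k::field)"
  by simp

locale cocycle3_group = group G for G (structure) +
  fixes \<omega> :: "'a \<Rightarrow> 'a \<Rightarrow> 'a \<Rightarrow> 'k::field"
  assumes cocycle: "cocycle3 G \<omega>" and normalized: "normalized3 G \<omega>"
begin

abbreviation \<theta> where "\<theta> \<equiv> dpr_theta G \<omega>"
abbreviation \<gamma> where "\<gamma> \<equiv> dpr_gamma G \<omega>"

lemma \<omega>_nonzero [simp]:
  "a \<in> carrier G \<Longrightarrow> b \<in> carrier G \<Longrightarrow> c \<in> carrier G \<Longrightarrow> \<omega> a b c \<noteq> 0"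
  using cocycle by (auto simp: cocycle3_def)

lemma \<omega>_one [simp]:
  assumes "a \<in> carrier G" "b \<in> carrier G"
  shows "\<omega> \<one> a b = 1" "\<omega> a \<one> b = 1" "\<omega> a b \<one> = 1"
  using normalized assms by (auto simp: normalized3_def)

lemma pentagon:
  assumes "a \<in> carrier G" "b \<in> carrier G" "c \<in> carrier G" "d \<in> carrier G"
  shows "\<omega> b c d * \<omega> a (b \<otimes> c) d * \<omega> a b c = \<omega> (a \<otimes> b) c d * \<omega> a b (c \<otimes> d)"
  using cocycle assms by (auto simp: cocycle3_def)

lemma cancel_left [simp]:
  assumes "a \<in> carrier G" "b \<in> carrier G"
  shows "a \<otimes> (inv a \<otimes> b) = b" "inv a \<otimes> (a \<otimes> b) = b"
  using assms by (simp_all flip: m_assoc)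

text \<open>
  Together with the cancellation rules this rewrites a word in group elements to its reduced form,
  so that arguments of \<open>\<omega>\<close> that are equal as elements of the free group become syntactically equal.
\<close>

lemmas word = m_assoc inv_mult_group

lemma \<theta>_nonzero [simp]:
  "g \<in> carrier G \<Longrightarrow> x \<in> carrier G \<Longrightarrow> y \<in> carrier G \<Longrightarrow> \<theta> g x y \<noteq> 0"
  by (simp add: dpr_theta_def)

lemma \<gamma>_nonzero [simp]:
  "g \<in> carrier G \<Longrightarrow> x \<in> carrier G \<Longrightarrow> y \<in> carrier G \<Longrightarrow> \<gamma> g x y \<noteq> 0"
  by (simp add: dpr_gamma_def)

text \<open>
  On either side the two factors with a repeated argument cancel, which leaves the same value of
  \<open>\<omega>\<close>. This is why an element acting on its own degree commutes with the whole action.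
\<close>

lemma \<theta>_conj:
  assumes "g \<in> carrier G" "x \<in> carrier G"
  shows "\<theta> g g x = \<theta> g x (g \<triangleleft> x)"
  using assms by (simp add: dpr_theta_def word)

text \<open>
  The scalar form of the balancing property of the twist: acting on two factors of degrees \<open>d\<close> and
  \<open>c\<close> each by its own degree and then braiding them twice is the same as acting on the product
  by its degree \<open>d \<otimes> c\<close>.
\<close>

lemma \<theta>_\<gamma>:
  assumes "d \<in> carrier G" "c \<in> carrier G"
  shows "\<theta> d d c * \<theta> c c (d \<triangleleft> c) = \<gamma> (d \<otimes> c) d c"
  using pentagon[of d c "d \<triangleleft> c" "inv c \<otimes> inv d \<otimes> c \<otimes> d \<otimes> c"] assms
  by (simp add: dpr_theta_def dpr_gamma_def word field_simps)

text \<open>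
  Associativity of the twisted quantum double. Geometrically \<open>\<theta>\<close> is the slant product of \<open>\<omega>\<close> with a
  loop \<open>g\<close>, and the four pentagons triangulate the prism over a three-simplex.
\<close>

lemma \<theta>_cocycle:
  assumes "g \<in> carrier G" "x \<in> carrier G" "y \<in> carrier G" "z \<in> carrier G"
  shows "\<theta> g x y * \<theta> g (x \<otimes> y) z = \<theta> (g \<triangleleft> x) y z * \<theta> g x (y \<otimes> z)"
proof -
  let ?u = "g \<triangleleft> x" let ?v = "?u \<triangleleft> y" let ?w = "?v \<triangleleft> z"
  note p = pentagon[of x y ?v z, symmetric] pentagon[of x ?u y z] pentagon[of x y z ?w] pentagon[of g x y z, symmetric]
  from both_times[OF p(1) both_times[OF p(2) both_times[OF p(3) p(4)]]] show ?thesis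
    by (rule balanced) (use assms in \<open>simp_all add: dpr_theta_def word field_simps\<close>)
qed

text \<open>
  Multiplicativity of the comultiplication. The six pentagons are the shuffles of a product of two
  triangles, one spanned by the degrees \<open>s, t\<close> and one by the acting elements \<open>y, z\<close>.
\<close>

lemma \<gamma>_\<theta>:
  assumes "s \<in> carrier G" "t \<in> carrier G" "y \<in> carrier G" "z \<in> carrier G"
  shows "\<gamma> y s t * \<gamma> z (s \<triangleleft> y) (t \<triangleleft> y) * \<theta> s y z * \<theta> t y z
    = \<theta> (s \<otimes> t) y z * \<gamma> (y \<otimes> z) s t"
proof -
  let ?s1 = "s \<triangleleft> y" let ?t1 = "t \<triangleleft> y"
  let ?s2 = "?s1 \<triangleleft> z" let ?t2 = "?t1 \<triangleleft> z"
  note p = pentagon[of y z ?s2 ?t2, symmetric] pentagon[of s t y z, symmetric]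
    pentagon[of y ?s1 z ?t2] pentagon[of y ?s1 ?t1 z, symmetric]
    pentagon[of s y ?t1 z] pentagon[of s y z ?t2, symmetric]
  from both_times[OF p(1) both_times[OF p(2) both_times[OF p(3) both_times[OF p(4) both_times[OF p(5) p(6)]]]]] show ?thesis
    by (rule balanced) (use assms in \<open>simp_all add: dpr_theta_def dpr_gamma_def word field_simps\<close>)
qed

text \<open>
  Moving an object of degree \<open>b\<close> past \<open>A\<^sub>x \<otimes> B\<^sub>c\<close> requires the reassociations
  \<open>(A B) X \<rightarrow> A (B X)\<close>, \<open>A (X B) \<rightarrow> (A X) B\<close> and \<open>(X A) B \<rightarrow> X (A B)\<close>; this is the
  product of the three associators.
\<close>

definition reassoc where
  "reassoc x c b = \<omega> x b (c \<triangleleft> b)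
    / (\<omega> x c b * \<omega> (x \<triangleright> b) x (c \<triangleleft> b))"

text \<open>
  The product of the associators in \<open>(A B) (A' B') \<rightarrow> (A A') (B B')\<close>, where \<open>B\<close> of degree \<open>c\<close> is moved
  past \<open>A'\<close> of degree \<open>x'\<close>.
\<close>

definition shuffle where
  "shuffle x c x' c' = \<omega> c x' c' * \<omega> x x' (c \<triangleleft> x' \<otimes> c')
    / (\<omega> x c (x' \<otimes> c') * \<omega> x' (c \<triangleleft> x') c')"

lemma reassoc_nonzero [simp]:
  "x \<in> carrier G \<Longrightarrow> c \<in> carrier G \<Longrightarrow> b \<in> carrier G \<Longrightarrow> reassoc x c b \<noteq> 0"
  by (simp add: reassoc_def)

lemma shuffle_nonzero [simp]:
  "x \<in> carrier G \<Longrightarrow> c \<in> carrier G \<Longrightarrow> x' \<in> carrier G \<Longrightarrow> c' \<in> carrier G \<Longrightarrow> shuffle x c x' c' \<noteq> 0"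
  by (simp add: shuffle_def)

text \<open>
  The scalar in the hexagon of a half-braiding on a vector of degree \<open>a\<close> that acts on the objects
  it passes by \<open>x\<close>, these objects having degrees \<open>b\<close> and \<open>b'\<close>.
\<close>

definition hex where
  "hex a x b b' =
     \<omega> (x \<triangleright> b) (x \<otimes> inv b \<otimes> inv x \<otimes> a \<otimes> b) b' * \<gamma> x (x \<triangleright> b) (x \<triangleright> b')
     / (\<omega> a b b' * \<omega> (x \<triangleright> b) (x \<triangleright> b') (x \<otimes> inv b' \<otimes> inv b \<otimes> inv x \<otimes> a \<otimes> b \<otimes> b'))"

text \<open>
  After dividing by the reassociation scalars, the hexagon scalar becomes \<open>\<theta>\<^sup>-\<^sup>1\<close>: this is what
  makes \<open>Q\<close> below a projective action with multiplier \<open>\<theta>\<^sup>-\<^sup>1\<close>.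
\<close>

lemma reassoc_hex:
  assumes "x \<in> carrier G" "c \<in> carrier G" "b \<in> carrier G" "b' \<in> carrier G"
  shows "reassoc x c b * reassoc x (c \<triangleleft> b) b'
    = \<theta> c b b' * hex (x \<otimes> c) x b b' * reassoc x c (b \<otimes> b')"
proof -
  let ?B = "x \<triangleright> b" let ?B' = "x \<triangleright> b'"
  let ?c1 = "c \<triangleleft> b" let ?c2 = "?c1 \<triangleleft> b'"
  note p = pentagon[of ?B ?B' x ?c2] pentagon[of x c b b'] pentagon[of x b ?c1 b', symmetric]
    pentagon[of ?B x ?c1 b'] pentagon[of ?B x b' ?c2, symmetric] pentagon[of x b b' ?c2]
  from both_times[OF p(1) both_times[OF p(2) both_times[OF p(3) both_times[OF p(4) both_times[OF p(5) p(6)]]]]] show ?thesis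
    by (rule balanced)
      (use assms in \<open>simp_all add: dpr_theta_def dpr_gamma_def reassoc_def hex_def word field_simps\<close>)
qed

text \<open>
  The scalar behind the exchange of \<open>Q\<close> with the diagonal action of \<open>y\<close> on \<open>A\<^sub>x \<otimes> B\<^sub>c\<close>.
\<close>

lemma reassoc_conj:
  assumes "x \<in> carrier G" "c \<in> carrier G" "b \<in> carrier G" "y \<in> carrier G"
  defines "b' \<equiv> y \<triangleright> b" and "B \<equiv> x \<triangleright> b" and "c1 \<equiv> c \<triangleleft> b"
    and "x' \<equiv> y \<triangleright> x" and "c' \<equiv> y \<triangleright> c"
  shows "\<gamma> y (y \<triangleright> (x \<otimes> c)) b' * \<theta> (y \<triangleright> B) x' y
      * reassoc x' c' b' * \<theta> c' y b * \<gamma> y x' c'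
    = \<gamma> y (y \<triangleright> B) (y \<triangleright> (x \<otimes> c1)) * \<theta> (y \<triangleright> B) y x
      * reassoc x c b * \<theta> c' b' y * \<gamma> y x' (y \<triangleright> c1)"
proof -
  let ?d = "c \<triangleleft> b"
  let ?B = "x \<triangleright> b"
  let ?yB = "y \<triangleright> ?B" let ?yx = "y \<triangleright> x" let ?yb = "y \<triangleright> b"
  let ?yc = "y \<triangleright> c" let ?yd = "y \<triangleright> ?d"
  note p = pentagon[of ?yB y x ?d] pentagon[of y ?B x ?d, symmetric] pentagon[of ?yB ?yx y ?d, symmetric]
    pentagon[of ?yB ?yx ?yd y] pentagon[of ?yx ?yb ?yd y, symmetric] pentagon[of ?yx ?yc ?yb y]
    pentagon[of ?yx ?yb y ?d] pentagon[of ?yx ?yc y b, symmetric] pentagon[of y x c b, symmetric]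
    pentagon[of ?yx y c b] pentagon[of y x b ?d] pentagon[of ?yx y b ?d, symmetric]
  from both_times[OF p(1) both_times[OF p(2) both_times[OF p(3) both_times[OF p(4) both_times[OF p(5) both_times[OF p(6) both_times[OF p(7) both_times[OF p(8) both_times[OF p(9) both_times[OF p(10) both_times[OF p(11) p(12)]]]]]]]]]]] show ?thesis unfolding b'_def B_def c1_def x'_def c'_def
    by (rule balanced)
      (use assms(1-4) in \<open>simp_all add: dpr_theta_def dpr_gamma_def reassoc_def word field_simps\<close>)
qed

text \<open>
  The scalar behind the fact that, after the reordering described by \<open>shuffle\<close>, the braiding of
  \<open>A \<otimes> B\<close> with \<open>A' \<otimes> B'\<close> is the product of the braidings of the two kinds of factors.
\<close>

lemma shuffle_crossing:
  assumes "x \<in> carrier G" "c \<in> carrier G" "x' \<in> carrier G" "c' \<in> carrier G"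
  defines "y \<equiv> x \<triangleright> x'" and "b \<equiv> x' \<otimes> c'"
  shows "shuffle y (x \<triangleright> c') x (c \<triangleleft> b) * \<gamma> x y (x \<triangleright> c') * reassoc x c b * \<theta> c x' c'
    = shuffle x c x' c'"
proof -
  let ?c2 = "(c \<triangleleft> x') \<triangleleft> c'"
  let ?y = "x \<triangleright> x'" let ?z = "x \<triangleright> c'"
  note p = pentagon[of x x' c' ?c2, symmetric] pentagon[of ?y ?z x ?c2, symmetric] pentagon[of ?y x c' ?c2]
  from both_times[OF p(1) both_times[OF p(2) p(3)]] show ?thesis unfolding y_def b_def
    by (rule balanced)
      (use assms(1-4) in \<open>simp_all add: dpr_theta_def dpr_gamma_def reassoc_def shuffle_def word field_simps\<close>)
qed

end

section \<open>The class of a three-cocycle on a cyclic group\<close>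

context group begin

lemma cochain3_eqI:
  assumes "\<And>a b c. a \<in> carrier G \<Longrightarrow> b \<in> carrier G \<Longrightarrow> c \<in> carrier G \<Longrightarrow> w a b c = w' a b c"
  shows "cochain3 G w = cochain3 G w'"
  using assms by (auto simp: cochain3_def restrict_def fun_eq_iff)

lemma cochain3_apply:
  "a \<in> carrier G \<Longrightarrow> b \<in> carrier G \<Longrightarrow> c \<in> carrier G \<Longrightarrow> cochain3 G w (a, b, c) = w a b c"
  by (simp add: cochain3_def)

lemma cocycle3_mult:
  fixes w w' :: "'a \<Rightarrow> 'a \<Rightarrow> 'a \<Rightarrow> 'k::field"
  assumes "cocycle3 G w" "cocycle3 G w'"
  shows "cocycle3 G (\<lambda>a b c. w a b c * w' a b c)"
  unfolding cocycle3_def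
proof (intro conjI ballI)
  fix a b c d assume *: "a \<in> carrier G" "b \<in> carrier G" "c \<in> carrier G" "d \<in> carrier G"
  have 1: "w b c d * w a (b \<otimes> c) d * w a b c = w (a \<otimes> b) c d * w a b (c \<otimes> d)"
    and 2: "w' b c d * w' a (b \<otimes> c) d * w' a b c = w' (a \<otimes> b) c d * w' a b (c \<otimes> d)"
    using assms * by (auto simp: cocycle3_def)
  show "w b c d * w' b c d * (w a (b \<otimes> c) d * w' a (b \<otimes> c) d) * (w a b c * w' a b c)
    = w (a \<otimes> b) c d * w' (a \<otimes> b) c d * (w a b (c \<otimes> d) * w' a b (c \<otimes> d))"
    using both_times[OF 1 2] by (simp add: mult_ac)
qed (use assms in \<open>auto simp: cocycle3_def\<close>)

lemma cocycle3_power: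
  "cocycle3 G w \<Longrightarrow> cocycle3 G (\<lambda>a b c. w a b c ^ m :: 'k::field)"
  by (induction m) (simp_all add: cocycle3_mult, simp add: cocycle3_def)

lemma cocycle3_one: "cocycle3 G (\<lambda>a b c. 1 :: 'k::field)"
  by (simp add: cocycle3_def)

lemma cocycle3_inverse:
  fixes w :: "'a \<Rightarrow> 'a \<Rightarrow> 'a \<Rightarrow> 'k::field"
  assumes "cocycle3 G w"
  shows "cocycle3 G (\<lambda>a b c. inverse (w a b c))"
  using assms unfolding cocycle3_def by (auto simp flip: inverse_mult_distrib)

lemma cocycle3_coboundary2:
  fixes \<mu> :: "'a \<Rightarrow> 'a \<Rightarrow> 'k::field"
  assumes "\<forall>a\<in>carrier G. \<forall>b\<in>carrier G. \<mu> a b \<noteq> 0"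
  shows "cocycle3 G (coboundary2 G \<mu>)"
  using assms unfolding cocycle3_def coboundary2_def by (auto simp: m_assoc field_simps)

lemma Z3_simps:
  "carrier (Z3 G) = {cochain3 G w | w. cocycle3 G (w :: 'a \<Rightarrow> 'a \<Rightarrow> 'a \<Rightarrow> 'k::field)}"
  "cochain3 G w \<otimes>\<^bsub>Z3 G\<^esub> cochain3 G w' = cochain3 G (\<lambda>a b c. w a b c * w' a b c :: 'k)"
  "\<one>\<^bsub>Z3 G\<^esub> = cochain3 G (\<lambda>a b c. 1 :: 'k)"
  by (auto simp: Z3_def cochain3_def restrict_def fun_eq_iff)

lemma comm_group_Z3: "comm_group (Z3 G :: ('a \<times> 'a \<times> 'a \<Rightarrow> 'k::field) monoid)"
proof (rule comm_groupI)
  fix f :: "'a \<times> 'a \<times> 'a \<Rightarrow> 'k" assume "f \<in> carrier (Z3 G)"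
  then obtain w where w: "cocycle3 G w" "f = cochain3 G w" by (auto simp: Z3_simps)
  have "cochain3 G (\<lambda>a b c. inverse (w a b c) * w a b c) = cochain3 G (\<lambda>a b c. 1)"
    using w by (intro cochain3_eqI) (auto simp: cocycle3_def)
  thus "\<exists>g\<in>carrier (Z3 G). g \<otimes>\<^bsub>Z3 G\<^esub> f = \<one>\<^bsub>Z3 G\<^esub>"
    using w cocycle3_inverse by (intro bexI[of _ "cochain3 G (\<lambda>a b c. inverse (w a b c))"])
      (auto simp: Z3_simps)
qed (auto simp: Z3_simps intro: cocycle3_mult cocycle3_one simp: mult_ac)

lemma cochain3_pow:
  fixes w :: "'a \<Rightarrow> 'a \<Rightarrow> 'a \<Rightarrow> 'k::field"
  shows "cochain3 G w [^]\<^bsub>Z3 G\<^esub> (m::nat) = cochain3 G (\<lambda>a b c. w a b c ^ m)"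
proof -
  interpret Z: comm_group "Z3 G :: ('a \<times> 'a \<times> 'a \<Rightarrow> 'k) monoid" by (rule comm_group_Z3)
  show ?thesis by (induction m) (simp_all add: Z3_simps mult.commute)
qed

lemma subgroup_B3: "subgroup (B3 G :: ('a \<times> 'a \<times> 'a \<Rightarrow> 'k::field) set) (Z3 G)"
proof -
  interpret Z: comm_group "Z3 G :: ('a \<times> 'a \<times> 'a \<Rightarrow> 'k) monoid" by (rule comm_group_Z3)
  let ?nz = "\<lambda>\<mu> :: 'a \<Rightarrow> 'a \<Rightarrow> 'k. \<forall>a\<in>carrier G. \<forall>b\<in>carrier G. \<mu> a b \<noteq> 0"
  have in_B3: "cochain3 G w \<in> B3 G" if "?nz \<mu>"
    "\<And>a b c. a \<in> carrier G \<Longrightarrow> b \<in> carrier G \<Longrightarrow> c \<in> carrier G \<Longrightarrow> w a b c = coboundary2 G \<mu> a b c"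
    for w \<mu>
    using that cochain3_eqI[of w "coboundary2 G \<mu>"] by (auto simp: B3_def)
  have mult: "f \<otimes>\<^bsub>Z3 G\<^esub> f' \<in> B3 G" if f: "f \<in> B3 G" "f' \<in> B3 G" for f f' :: "'a \<times> 'a \<times> 'a \<Rightarrow> 'k"
  proof -
    obtain \<mu> \<mu>' where *: "?nz \<mu>" "?nz \<mu>'" "f = cochain3 G (coboundary2 G \<mu>)" "f' = cochain3 G (coboundary2 G \<mu>')"
      using f by (auto simp: B3_def)
    show ?thesis unfolding * Z3_simps
      by (rule in_B3[of "\<lambda>a b. \<mu> a b * \<mu>' a b"]) (use * in \<open>auto simp: coboundary2_def mult_ac\<close>)
  qed
  have inv: "inv\<^bsub>Z3 G\<^esub> f \<in> B3 G" if f: "f \<in> B3 G" for f :: "'a \<times> 'a \<times> 'a \<Rightarrow> 'k"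
  proof -
    obtain \<mu> where *: "?nz \<mu>" "f = cochain3 G (coboundary2 G \<mu>)"
      using f by (auto simp: B3_def)
    let ?g = "cochain3 G (\<lambda>a b c. inverse (coboundary2 G \<mu> a b c))"
    have "?g \<otimes>\<^bsub>Z3 G\<^esub> f = \<one>\<^bsub>Z3 G\<^esub>" unfolding * Z3_simps
      by (rule cochain3_eqI) (use * in \<open>auto simp: coboundary2_def\<close>)
    moreover have "?g \<in> B3 G"
      by (rule in_B3[of "\<lambda>a b. inverse (\<mu> a b)"]) (use * in \<open>auto simp: coboundary2_def field_simps\<close>)
    moreover have "?g \<in> carrier (Z3 G)" "f \<in> carrier (Z3 G)"
      using * cocycle3_inverse cocycle3_coboundary2 by (force simp: Z3_simps)+
    ultimately show ?thesis using Z.inv_equality by metis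
  qed
  show ?thesis
  proof (rule Z.subgroupI)
    show "B3 G \<subseteq> carrier (Z3 G :: ('a \<times> 'a \<times> 'a \<Rightarrow> 'k) monoid)"
      using cocycle3_coboundary2 by (auto simp: B3_def Z3_simps)
    have "cochain3 G (coboundary2 G (\<lambda>a b. 1 :: 'k)) \<in> B3 G" by (rule in_B3[of "\<lambda>a b. 1"]) auto
    thus "B3 G \<noteq> ({} :: ('a \<times> 'a \<times> 'a \<Rightarrow> 'k) set)" by blast
  qed (use mult inv in auto)
qed

lemma class_order_dvd_iff:
  fixes w :: "'a \<Rightarrow> 'a \<Rightarrow> 'a \<Rightarrow> 'k::field"
  assumes "cocycle3 G w"
  shows "class_order G w dvd m \<longleftrightarrow> cochain3 G (\<lambda>a b c. w a b c ^ m) \<in> B3 G"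
proof -
  interpret Z: comm_group "Z3 G :: ('a \<times> 'a \<times> 'a \<Rightarrow> 'k) monoid" by (rule comm_group_Z3)
  interpret B: normal "B3 G" "Z3 G :: ('a \<times> 'a \<times> 'a \<Rightarrow> 'k) monoid"
    using Z.subgroup_imp_normal[OF subgroup_B3] .
  interpret H: group "H3 G :: ('a \<times> 'a \<times> 'a \<Rightarrow> 'k) set monoid"
    unfolding H3_def by (rule B.factorgroup_is_group)
  have w: "cochain3 G w \<in> carrier (Z3 G)" using assms by (auto simp: Z3_simps)
  let ?W = "cochain3 G w [^]\<^bsub>Z3 G\<^esub> m"
  have W: "?W \<in> carrier (Z3 G)" using w by simp
  have cl: "B3 G #>\<^bsub>Z3 G\<^esub> cochain3 G w \<in> carrier (H3 G)"
    using w by (auto simp: H3_def carrier_FactGroup)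
  have "class_order G w dvd m \<longleftrightarrow> (B3 G #>\<^bsub>Z3 G\<^esub> cochain3 G w) [^]\<^bsub>H3 G\<^esub> m = \<one>\<^bsub>H3 G\<^esub>"
    unfolding class_order_def H.pow_eq_id[OF cl] ..
  also have "\<dots> \<longleftrightarrow> B3 G #>\<^bsub>Z3 G\<^esub> ?W = B3 G"
    unfolding H3_def B.FactGroup_pow[OF w] by simp
  also have "\<dots> \<longleftrightarrow> ?W \<in> B3 G"
    using Z.coset_join1[OF _ W subgroup_B3] Z.coset_join2[OF W subgroup_B3] by blast
  finally show ?thesis by (simp add: cochain3_pow)
qed

lemma prod_carrier_right:
  assumes "x \<in> carrier G"
  shows "(\<Prod>c\<in>carrier G. f (c \<otimes> x)) = (\<Prod>c\<in>carrier G. f c)"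
proof (rule prod.reindex_bij_betw)
  show "bij_betw (\<lambda>c. c \<otimes> x) (carrier G) (carrier G)"
    by (rule bij_betwI[of _ _ _ "\<lambda>c. c \<otimes> inv x"]) (use assms in \<open>auto simp: m_assoc\<close>)
qed

lemma prod_carrier_left:
  assumes "x \<in> carrier G"
  shows "(\<Prod>c\<in>carrier G. f (x \<otimes> c)) = (\<Prod>c\<in>carrier G. f c)"
proof (rule prod.reindex_bij_betw)
  show "bij_betw (\<lambda>c. x \<otimes> c) (carrier G) (carrier G)"
    by (rule bij_betwI[of _ _ _ "\<lambda>c. inv x \<otimes> c"]) (use assms in \<open>auto simp flip: m_assoc\<close>)
qed

lemma prod_powers:
  assumes "x \<in> carrier G" "finite (carrier G)" "carrier G = generate G {x}"
  shows "(\<Prod>c\<in>carrier G. f c) = (\<Prod>i<ord x. f (x [^] i))"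
proof (rule prod.reindex_bij_betw[symmetric])
  have "ord x \<noteq> 0" using assms ord_ge_1 by fastforce
  moreover have "ord x = card (carrier G)" using assms generate_pow_card by metis
  moreover have "inj_on (\<lambda>i. x [^] i) {..<ord x}"
    using ord_inj[OF assms(1)] \<open>ord x \<noteq> 0\<close> by (auto simp: inj_on_def atLeast0AtMost)
  ultimately show "bij_betw (\<lambda>i. x [^] i) {..<ord x} (carrier G)"
    unfolding bij_betw_def using assms
    by (metis (mono_tags, lifting) card_image card_lessThan card_subset_eq image_subsetI nat_pow_closed)
qed

end

context cocycle3_group begin

definition translate_prod where "translate_prod g a = (\<Prod>c\<in>carrier G. \<omega> a c g)"

text \<open>
  The product of the cocycle identities for \<open>(a, b, c, g)\<close> over all \<open>c\<close>: the terms
  \<open>\<omega> a b c\<close> and \<open>\<omega> a b (c \<otimes> g)\<close> have the same product and cancel. So \<open>translate_prod g\<close> is a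
  character of the group.
\<close>

lemma translate_prod_mult:
  assumes "a \<in> carrier G" "b \<in> carrier G" "g \<in> carrier G"
  shows "translate_prod g (a \<otimes> b) = translate_prod g a * translate_prod g b"
proof -
  let ?Q = "\<Prod>c\<in>carrier G. \<omega> a b c"
  have "translate_prod g b * (\<Prod>c\<in>carrier G. \<omega> a (b \<otimes> c) g) * ?Q
    = translate_prod g (a \<otimes> b) * (\<Prod>c\<in>carrier G. \<omega> a b (c \<otimes> g))"
    unfolding translate_prod_def prod.distrib[symmetric]
    by (rule prod.cong) (use assms pentagon in auto)
  moreover have "?Q \<noteq> 0" using assms by (cases "finite (carrier G)") auto
  ultimately show ?thesis
    using prod_carrier_right[OF assms(3), of "\<omega> a b"] prod_carrier_left[OF assms(2), of "\<lambda>c. \<omega> a c g"]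
    by (simp add: translate_prod_def mult.commute)
qed

text \<open>
  For a cyclic group the character \<open>translate_prod g\<close> is trivial as soon as its value at the
  generator is. Then \<open>\<mu> a (g\<^sup>j) = \<omega>(a, g\<^sup>0, g) \<dots> \<omega>(a, g\<^bsup>j-1\<^esup>, g)\<close> does not depend on
  the choice of the exponent \<open>j\<close>, and its coboundary agrees with \<open>\<omega>\<close> when the last argument is \<open>1\<close>; the
  cocycle identity with last argument \<open>g\<close> propagates the agreement to all powers of \<open>g\<close>.
\<close>

lemma coboundary_if_translate_prod:
  assumes g: "g \<in> carrier G" and fin: "finite (carrier G)" and gen: "carrier G = generate G {g}"
    and triv: "translate_prod g g = 1"
  shows "cochain3 G \<omega> \<in> B3 G"
proof -
  have pows: "\<exists>j. a = g [^] (j::nat)" if "a \<in> carrier G" for a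
    using generate_pow_on_finite_carrier[OF fin g] that gen by auto
  have F1: "translate_prod g \<one> = 1" by (simp add: translate_prod_def g)
  have F: "translate_prod g a = 1" if "a \<in> carrier G" for a
  proof -
    have "translate_prod g (g [^] (j::nat)) = 1" for j
      by (induction j) (simp_all add: F1 translate_prod_mult g triv)
    thus ?thesis using pows[OF that] by auto
  qed
  have per: "(\<Prod>i<ord g. \<omega> a (g [^] i) g) = 1" if "a \<in> carrier G" for a
    using F[OF that] prod_powers[OF g fin gen, of "\<lambda>c. \<omega> a c g"] by (simp add: translate_prod_def)
  have n: "ord g \<noteq> 0" using ord_ge_1[OF fin g] by simp
  \<comment> \<open>The exponent of an element, taken in \<open>{0..<ord g}\<close>.\<close>
  define lg where "lg b = (SOME j. j < ord g \<and> g [^] j = b)" for b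
  have lg: "lg b < ord g" "g [^] lg b = b" if b: "b \<in> carrier G" for b
  proof -
    obtain j :: nat where j: "b = g [^] j" using pows[OF b] by auto
    have "g [^] (j mod ord g) = b" using j pow_ord_eq_1 g
      by (metis l_one mod_mult_div_eq nat_pow_closed nat_pow_mult nat_pow_one nat_pow_pow r_one mult.commute)
    hence "\<exists>j. j < ord g \<and> g [^] j = b" using n by (intro exI[of _ "j mod ord g"]) auto
    thus "lg b < ord g" "g [^] lg b = b" unfolding lg_def by (metis (mono_tags, lifting) someI_ex)+
  qed
  define \<mu> where "\<mu> a b = (\<Prod>i<lg b. \<omega> a (g [^] i) g)" for a b
  have nz: "\<mu> a b \<noteq> 0" if "a \<in> carrier G" for a b
    using that g by (simp add: \<mu>_def)
  have lg1: "lg \<one> = 0"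
    using lg(1)[OF one_closed] lg(2)[OF one_closed] g pow_eq_id[OF g, of "lg \<one>"] nat_dvd_not_less by blast
  have step: "\<mu> a (b \<otimes> g) = \<mu> a b * \<omega> a b g" if a: "a \<in> carrier G" and b: "b \<in> carrier G" for a b
  proof -
    have bg: "g [^] Suc (lg b) = b \<otimes> g" using lg(2)[OF b] by simp
    have *: "\<mu> a b * \<omega> a b g = (\<Prod>i<Suc (lg b). \<omega> a (g [^] i) g)"
      using lg(2)[OF b] by (simp add: \<mu>_def)
    show ?thesis
    proof (cases "Suc (lg b) = ord g")
      case True
      hence "b \<otimes> g = \<one>" using bg g by (metis pow_ord_eq_1)
      thus ?thesis using True * per[OF a] lg1 by (simp add: \<mu>_def)
    next
      case False
      hence lt: "Suc (lg b) < ord g" using lg(1)[OF b] by simp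
      have "g [^] lg (b \<otimes> g) = g [^] Suc (lg b)" using bg lg(2)[of "b \<otimes> g"] b g by simp
      hence "lg (b \<otimes> g) = Suc (lg b)"
        using ord_inj[OF g] lt lg(1)[of "b \<otimes> g"] b g by (auto simp: inj_on_def)
      thus ?thesis unfolding * by (simp add: \<mu>_def)
    qed
  qed
  have "\<omega> a b (g [^] (j::nat)) = coboundary2 G \<mu> a b (g [^] j)"
    if "a \<in> carrier G" "b \<in> carrier G" for a b j
  proof (induction j)
    case 0
    thus ?case using that nz by (simp add: coboundary2_def \<mu>_def lg1)
  next
    case (Suc j)
    let ?c = "g [^] j"
    have c: "?c \<in> carrier G" using g by simp
    have "\<omega> (a \<otimes> b) ?c g \<noteq> 0" using that c g by simp
    hence "\<omega> a b (?c \<otimes> g) = \<omega> b ?c g * \<omega> a (b \<otimes> ?c) g * \<omega> a b ?c / \<omega> (a \<otimes> b) ?c g"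
      using pentagon[OF that c g] by (simp add: field_simps)
    also have "\<dots> = coboundary2 G \<mu> a b (?c \<otimes> g)"
      unfolding Suc coboundary2_def using step[of b ?c] step[of a "b \<otimes> ?c"] step[of "a \<otimes> b" ?c] that c g
      by (simp add: m_assoc mult_ac)
    finally show ?case by simp
  qed
  hence "cochain3 G \<omega> = cochain3 G (coboundary2 G \<mu>)"
    using pows by (intro cochain3_eqI) blast
  thus ?thesis using nz by (auto simp: B3_def)
qed

text \<open>
  The factors of the coboundary are translates of each other and cancel in the product over the
  group.
\<close>

lemma translate_prod_coboundary:
  assumes g: "g \<in> carrier G" and B: "cochain3 G \<omega> \<in> B3 G"
  shows "translate_prod g g = 1"
proof -
  obtain \<mu> where \<mu>: "\<forall>a\<in>carrier G. \<forall>b\<in>carrier G. \<mu> a b \<noteq> 0" "cochain3 G \<omega> = cochain3 G (coboundary2 G \<mu>)"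
    using B by (auto simp: B3_def)
  have "translate_prod g g = (\<Prod>c\<in>carrier G. coboundary2 G \<mu> g c g)"
    unfolding translate_prod_def using \<mu>(2) g by (intro prod.cong) (metis cochain3_apply)+
  also have "\<dots> = ((\<Prod>c\<in>carrier G. \<mu> c g) * (\<Prod>c\<in>carrier G. \<mu> g (c \<otimes> g)))
     / ((\<Prod>c\<in>carrier G. \<mu> (g \<otimes> c) g) * (\<Prod>c\<in>carrier G. \<mu> g c))"
    by (simp add: coboundary2_def prod_dividef prod.distrib)
  also have "\<dots> = 1"
    using \<mu>(1) g unfolding prod_carrier_right[OF g, of "\<mu> g"] prod_carrier_left[OF g, of "\<lambda>c. \<mu> c g"]
    by (cases "finite (carrier G)") auto
  finally show ?thesis .
qed

lemma power_cocycle3_group: "cocycle3_group G (\<lambda>a b c. \<omega> a b c ^ m)"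
  using cocycle normalized cocycle3_power
  by unfold_locales (auto simp: normalized3_def)

definition \<Theta> where "\<Theta> m g = (\<Prod>i<(m::nat). \<omega> g (g [^] i) g)"

lemma translate_prod_eq_\<Theta>:
  assumes "g \<in> carrier G" "finite (carrier G)" "carrier G = generate G {g}"
  shows "translate_prod g g = \<Theta> (ord g) g"
  unfolding translate_prod_def \<Theta>_def by (rule prod_powers[OF assms])

lemma class_order_cyclic_dvd_iff:
  assumes g: "g \<in> carrier G" and fin: "finite (carrier G)" and gen: "carrier G = generate G {g}"
  shows "class_order G \<omega> dvd m \<longleftrightarrow> \<Theta> (ord g) g ^ m = 1"
proof -
  interpret m: cocycle3_group G "\<lambda>a b c. \<omega> a b c ^ m" by (rule power_cocycle3_group)
  have "m.translate_prod g g = \<Theta> (ord g) g ^ m"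
    unfolding m.translate_prod_eq_\<Theta>[OF assms] m.\<Theta>_def \<Theta>_def by (simp add: prod_power_distrib)
  thus ?thesis
    using class_order_dvd_iff[OF cocycle] m.coboundary_if_translate_prod[OF g fin gen]
      m.translate_prod_coboundary[OF g] by metis
qed

text \<open>
  The left side is the value of the character \<open>translate_prod g\<close> at \<open>g ^ ord g\<close>.
\<close>

lemma cyclic_\<Theta>_ord_pow:
  assumes g: "g \<in> carrier G" and fin: "finite (carrier G)" and gen: "carrier G = generate G {g}"
  shows "\<Theta> (ord g) g ^ ord g = 1"
proof -
  have "translate_prod g (g [^] (j::nat)) = translate_prod g g ^ j" for j
    by (induction j) (use g in \<open>simp_all add: translate_prod_mult, simp add: translate_prod_def\<close>)
  from this[of "ord g"] show ?thesis
    using g by (simp add: translate_prod_eq_\<Theta>[OF assms] translate_prod_def[of g \<one>])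
qed

lemma cyclic_sub_cocycle3_group:
  assumes g: "g \<in> carrier G" and fin: "finite (carrier G)"
  defines "C \<equiv> cyclic_sub G g"
  shows "cocycle3_group C \<omega>" "g \<in> carrier C" "finite (carrier C)" "carrier C = generate C {g}"
    "group.ord C g = ord g" "cocycle3_group.\<Theta> C \<omega> m g = \<Theta> m g"
proof -
  let ?C = "generate G {g}"
  have sub: "subgroup ?C G" using generate_is_subgroup[of "{g}"] g by simp
  interpret K: group C unfolding C_def using subgroup_imp_group[OF sub] .
  have C: "?C \<subseteq> carrier G" using sub subgroup.subset by blast
  show "cocycle3_group C \<omega>"
    using cocycle normalized C
    by unfold_locales (auto simp: C_def cocycle3_def normalized3_def subset_iff)
  then interpret K: cocycle3_group C \<omega> .
  show gK: "g \<in> carrier C" by (simp add: C_def generate.incl)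
  show finK: "finite (carrier C)" using finite_subset[OF C fin] by (simp add: C_def)
  have pow: "g [^]\<^bsub>C\<^esub> (i::nat) = g [^] i" for i by (simp add: nat_pow_def C_def)
  have genK: "generate C {g} = ?C"
  proof -
    have "generate C {g} = {g [^]\<^bsub>C\<^esub> (k::nat) | k. k \<in> UNIV}"
      by (rule K.generate_pow_on_finite_carrier[OF finK gK])
    also have "\<dots> = ?C"
      unfolding pow by (rule generate_pow_on_finite_carrier[OF fin g, symmetric])
    finally show ?thesis .
  qed
  thus "carrier C = generate C {g}" by (simp add: C_def)
  show "K.ord g = ord g"
    using K.generate_pow_card[OF gK] generate_pow_card[OF g] genK by simp
  show "K.\<Theta> m g = \<Theta> m g"
    by (simp add: K.\<Theta>_def \<Theta>_def pow)
qed

text \<open>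
  The cyclic case applies to \<open>\<langle>g\<rangle>\<close>, where \<open>g\<close> has the same order and the same \<open>\<Theta>\<close> as in the whole group.
\<close>

lemma class_order_cyclic_sub_dvd_iff:
  assumes "g \<in> carrier G" "finite (carrier G)"
  shows "class_order (cyclic_sub G g) \<omega> dvd m \<longleftrightarrow> \<Theta> (ord g) g ^ m = 1"
  using cocycle3_group.class_order_cyclic_dvd_iff[OF cyclic_sub_cocycle3_group(1-4)[OF assms]]
    cyclic_sub_cocycle3_group(5,6)[OF assms] by simp

lemma \<Theta>_ord_pow:
  assumes "g \<in> carrier G" "finite (carrier G)"
  shows "\<Theta> (ord g) g ^ ord g = 1"
  using cocycle3_group.cyclic_\<Theta>_ord_pow[OF cyclic_sub_cocycle3_group(1-4)[OF assms]]
    cyclic_sub_cocycle3_group(5,6)[OF assms] by simp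

text \<open>
  Powers of \<open>g\<close> commute with \<open>g\<close>, so two of the three factors of \<open>\<theta>\<close> cancel. The remaining
  one is what accumulates to \<open>\<Theta>\<close> when \<open>g\<close> acts repeatedly on its own degree.
\<close>

lemma \<theta>_pow:
  assumes "g \<in> carrier G"
  shows "\<theta> g g (g [^] (k::nat)) = \<omega> g (g [^] k) g" "\<theta> g (g [^] k) g = \<omega> g (g [^] k) g"
proof -
  have fixed: "inv (g [^] m) \<otimes> g \<otimes> g [^] m = g" for m :: nat
    using assms nat_pow_comm[of g 1 m] by (simp add: m_assoc)
  have "inv (g [^] k) \<otimes> g \<otimes> g [^] k = g" "g \<triangleleft> (g [^] k \<otimes> g) = g"
    "g \<triangleleft> (g \<otimes> g [^] k) = g"
    using assms fixed[of k] fixed[of "Suc k"] nat_pow_comm[of g 1 k] by simp_all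
  thus "\<theta> g g (g [^] k) = \<omega> g (g [^] k) g" "\<theta> g (g [^] k) g = \<omega> g (g [^] k) g"
    using assms by (simp_all add: dpr_theta_def)
qed

lemma \<Theta>_period:
  assumes g: "g \<in> carrier G"
  shows "\<Theta> (k * ord g) g = \<Theta> (ord g) g ^ k"
proof (induction k)
  case 0 show ?case by (simp add: \<Theta>_def)
next
  case (Suc k)
  have split: "(\<Prod>i<m + n. f i) = (\<Prod>i<m. f i) * (\<Prod>i<n. f (m + i))" for m n and f :: "nat \<Rightarrow> 'k"
    by (induction n) (simp_all add: mult_ac)
  have "g [^] (k * ord g + i) = g [^] i" for i
    using g by (simp flip: nat_pow_mult add: mult.commute[of k] nat_pow_pow[symmetric])
  thus ?case using Suc split[of "\<lambda>i. \<omega> g (g [^] i) g" "k * ord g" "ord g"]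
    by (simp add: \<Theta>_def add.commute mult.commute)
qed

end

section \<open>Tensor products of vectors\<close>

text \<open>
  The vector counterpart of the Kronecker product, with the same lexicographic numbering; it is
  strictly associative.
\<close>

definition vtensor :: "'k::semiring_0 vec \<Rightarrow> 'k vec \<Rightarrow> 'k vec" (infixl \<open>\<otimes>\<^sub>v\<close> 68) where
  "u \<otimes>\<^sub>v w = vec (dim_vec u * dim_vec w) (\<lambda>i. u $ (i div dim_vec w) * w $ (i mod dim_vec w))"

text \<open>
  Summation with the dimension as a parameter, so that empty sums make sense and no condition on
  the summands is needed to know the dimension of the result.
\<close>

definition vsum :: "nat \<Rightarrow> ('i \<Rightarrow> 'k::comm_monoid_add vec) \<Rightarrow> 'i set \<Rightarrow> 'k vec" where
  "vsum n f A = vec n (\<lambda>i. \<Sum>a\<in>A. f a $ i)"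

text \<open>
  The \<open>i\<close>-th coefficient, a vector in the second factor, of a vector in a tensor product.
\<close>

definition block :: "nat \<Rightarrow> nat \<Rightarrow> 'k vec \<Rightarrow> 'k vec" where
  "block n i z = vec n (\<lambda>k. z $ (i * n + k))"

definition flip_mat :: "nat \<Rightarrow> nat \<Rightarrow> 'k::semiring_1 mat" where
  "flip_mat n m = mat (m * n) (n * m) (\<lambda>(i, j). if j = (i mod n) * m + i div n then 1 else 0)"

lemma div_less_mult: "i < n * m \<Longrightarrow> i div m < (n::nat)"
  by (simp add: less_mult_imp_div_less)

lemma mod_less_mult: "i < n * m \<Longrightarrow> i mod m < (m::nat)"
  by (cases "m = 0") auto

lemma pair_less_mult: "i < n \<Longrightarrow> j < m \<Longrightarrow> i * m + j < n * (m::nat)"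
  using mult_le_mono1[of "Suc i" n m] by simp

lemma sum_div_mod:
  fixes f :: "nat \<Rightarrow> nat \<Rightarrow> 'b::comm_monoid_add"
  shows "(\<Sum>i\<in>{0..<n * m}. f (i div m) (i mod m)) = (\<Sum>i\<in>{0..<n}. \<Sum>j\<in>{0..<m}. f i j)"
proof -
  have "(\<Sum>i\<in>{0..<n * m}. f (i div m) (i mod m)) = (\<Sum>(i, j)\<in>{0..<n} \<times> {0..<m}. f i j)"
    by (rule sum.reindex_bij_witness[of _ "\<lambda>(i, j). i * m + j" "\<lambda>i. (i div m, i mod m)"])
      (auto simp: div_less_mult mod_less_mult pair_less_mult)
  thus ?thesis by (simp add: sum.cartesian_product)
qed

lemma dim_vtensor [simp]: "dim_vec (u \<otimes>\<^sub>v w) = dim_vec u * dim_vec w"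
  by (simp add: vtensor_def)

lemma vtensor_carrier [simp]:
  "u \<in> carrier_vec n \<Longrightarrow> w \<in> carrier_vec m \<Longrightarrow> u \<otimes>\<^sub>v w \<in> carrier_vec (n * m)"
  by (auto simp: vtensor_def)

lemma vtensor_index:
  "i < dim_vec u * dim_vec w \<Longrightarrow> (u \<otimes>\<^sub>v w) $ i = u $ (i div dim_vec w) * w $ (i mod dim_vec w)"
  by (simp add: vtensor_def)

lemma vtensor_smult:
  fixes c :: "'k::comm_semiring_0"
  shows "(c \<cdot>\<^sub>v u) \<otimes>\<^sub>v w = c \<cdot>\<^sub>v (u \<otimes>\<^sub>v w)" "u \<otimes>\<^sub>v (c \<cdot>\<^sub>v w) = c \<cdot>\<^sub>v (u \<otimes>\<^sub>v w)"
  by (rule eq_vecI; auto simp: vtensor_index div_less_mult mod_less_mult mult_ac)+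

lemma vtensor_zero [simp]:
  fixes w :: "'k::semiring_0 vec"
  shows "0\<^sub>v n \<otimes>\<^sub>v w = 0\<^sub>v (n * dim_vec w)" "w \<otimes>\<^sub>v 0\<^sub>v n = 0\<^sub>v (dim_vec w * n)"
  by (rule eq_vecI; auto simp: vtensor_index div_less_mult mod_less_mult)+

lemma vtensor_assoc:
  fixes u v w :: "'k::semiring_0 vec"
  shows "(u \<otimes>\<^sub>v v) \<otimes>\<^sub>v w = u \<otimes>\<^sub>v (v \<otimes>\<^sub>v w)"
proof (rule eq_vecI)
  fix i assume "i < dim_vec (u \<otimes>\<^sub>v (v \<otimes>\<^sub>v w))"
  hence i: "i < dim_vec u * (dim_vec v * dim_vec w)" by simp
  let ?m = "dim_vec v" let ?l = "dim_vec w"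
  have l: "?l \<noteq> 0" using i by (cases "?l = 0") auto
  have "i div ?l mod ?m = i mod (?m * ?l) div ?l"
    using l by (simp add: mult.commute[of ?m] mod_mult2_eq)
  moreover have "i mod ?l = i mod (?m * ?l) mod ?l" by (simp add: mod_mod_cancel)
  moreover have "i div ?l div ?m = i div (?m * ?l)" by (metis div_mult2_eq mult.commute)
  moreover have "i < dim_vec u * ?m * ?l" using i by (simp add: mult.assoc)
  moreover have "i mod (?m * ?l) < ?m * ?l" using i mod_less_mult by blast
  ultimately show "((u \<otimes>\<^sub>v v) \<otimes>\<^sub>v w) $ i = (u \<otimes>\<^sub>v (v \<otimes>\<^sub>v w)) $ i"
    using i by (simp add: vtensor_index div_less_mult mult.assoc)
qed (simp add: mult.assoc)

lemma kron_carrier [simp]: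
  "A \<in> carrier_mat n n' \<Longrightarrow> B \<in> carrier_mat m m' \<Longrightarrow> kron A B \<in> carrier_mat (n * m) (n' * m')"
  by (auto simp: kron_def)

lemma kron_mult_vtensor:
  fixes A B :: "'k::comm_semiring_0 mat"
  assumes "A \<in> carrier_mat n n'" "B \<in> carrier_mat m m'" "u \<in> carrier_vec n'" "w \<in> carrier_vec m'"
  shows "kron A B *\<^sub>v (u \<otimes>\<^sub>v w) = (A *\<^sub>v u) \<otimes>\<^sub>v (B *\<^sub>v w)"
proof (rule eq_vecI)
  fix i assume "i < dim_vec ((A *\<^sub>v u) \<otimes>\<^sub>v (B *\<^sub>v w))"
  hence i: "i < n * m" using assms by simp
  have "(kron A B *\<^sub>v (u \<otimes>\<^sub>v w)) $ i = (\<Sum>j\<in>{0..<n' * m'}.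
      (A $$ (i div m, j div m') * B $$ (i mod m, j mod m')) * (u $ (j div m') * w $ (j mod m')))"
    using assms i by (simp add: kron_def scalar_prod_def vtensor_index row_def)
  also have "\<dots> = (\<Sum>j\<in>{0..<n'}. \<Sum>k\<in>{0..<m'}.
      (A $$ (i div m, j) * B $$ (i mod m, k)) * (u $ j * w $ k))"
    by (rule sum_div_mod)
  also have "\<dots> = (\<Sum>j\<in>{0..<n'}. A $$ (i div m, j) * u $ j) * (\<Sum>k\<in>{0..<m'}. B $$ (i mod m, k) * w $ k)"
    by (simp add: sum_product mult_ac)
  also have "\<dots> = ((A *\<^sub>v u) \<otimes>\<^sub>v (B *\<^sub>v w)) $ i"
    using assms i by (simp add: vtensor_index scalar_prod_def div_less_mult mod_less_mult)
  finally show "(kron A B *\<^sub>v (u \<otimes>\<^sub>v w)) $ i = ((A *\<^sub>v u) \<otimes>\<^sub>v (B *\<^sub>v w)) $ i" .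
qed (use assms in \<open>simp add: kron_def\<close>)

lemma vsum_carrier [simp]: "vsum n f A \<in> carrier_vec n"
  by (simp add: vsum_def)

lemma dim_vsum [simp]: "dim_vec (vsum n f A) = n"
  by (simp add: vsum_def)

lemma vsum_cong: "(\<And>a. a \<in> A \<Longrightarrow> f a = g a) \<Longrightarrow> vsum n f A = vsum n g A"
  by (simp add: vsum_def)

lemma vsum_reindex:
  "inj_on h A \<Longrightarrow> vsum n f (h ` A) = vsum n (\<lambda>a. f (h a)) A"
  by (simp add: vsum_def sum.reindex)

lemma vsum_support:
  assumes "finite A" "B \<subseteq> A" "\<And>a. a \<in> A - B \<Longrightarrow> f a = 0\<^sub>v n"
  shows "vsum n f A = vsum n f B"
  unfolding vsum_def using assms by (intro eq_vecI) (auto intro!: sum.mono_neutral_right)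

lemma vsum_single:
  assumes "finite A" "a \<in> A" "\<And>b. b \<in> A \<Longrightarrow> b \<noteq> a \<Longrightarrow> f b = 0\<^sub>v n" "f a \<in> carrier_vec n"
  shows "vsum n f A = f a"
proof -
  have "vsum n f A = vsum n f {a}" using assms by (intro vsum_support) auto
  thus ?thesis using assms(4) by (auto simp: vsum_def)
qed

lemma vsum_zero: "(\<And>a. a \<in> A \<Longrightarrow> f a = 0\<^sub>v n) \<Longrightarrow> vsum n f A = 0\<^sub>v n"
  by (auto simp: vsum_def)

lemma vsum_image_under:
  fixes M :: "'k::comm_semiring_0 mat"
  assumes "\<And>a. a \<in> A \<Longrightarrow> f a \<in> carrier_vec n" "M \<in> carrier_mat m n"
  shows "M *\<^sub>v vsum n f A = vsum m (\<lambda>a. M *\<^sub>v f a) A"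
proof (rule eq_vecI)
  fix i assume "i < dim_vec (vsum m (\<lambda>a. M *\<^sub>v f a) A)"
  hence i: "i < m" by simp
  have "(M *\<^sub>v vsum n f A) $ i = (\<Sum>j\<in>{0..<n}. \<Sum>a\<in>A. M $$ (i, j) * f a $ j)"
    using assms(2) i by (simp add: vsum_def scalar_prod_def sum_distrib_left)
  also have "\<dots> = (\<Sum>a\<in>A. \<Sum>j\<in>{0..<n}. M $$ (i, j) * f a $ j)"
    by (rule sum.swap)
  also have "\<dots> = (vsum m (\<lambda>a. M *\<^sub>v f a) A) $ i"
    using assms(2) i carrier_vecD[OF assms(1)] by (auto simp: vsum_def scalar_prod_def intro!: sum.cong)
  finally show "(M *\<^sub>v vsum n f A) $ i = (vsum m (\<lambda>a. M *\<^sub>v f a) A) $ i" .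
qed (use assms in simp)

lemma vtensor_vsum:
  fixes f :: "'i \<Rightarrow> 'k::comm_semiring_0 vec"
  assumes "\<And>a. a \<in> A \<Longrightarrow> f a \<in> carrier_vec n" "w \<in> carrier_vec m"
  shows "vsum n f A \<otimes>\<^sub>v w = vsum (n * m) (\<lambda>a. f a \<otimes>\<^sub>v w) A"
    and "w \<otimes>\<^sub>v vsum n f A = vsum (m * n) (\<lambda>a. w \<otimes>\<^sub>v f a) A"
proof -
  show "vsum n f A \<otimes>\<^sub>v w = vsum (n * m) (\<lambda>a. f a \<otimes>\<^sub>v w) A"
  proof (rule eq_vecI)
    fix i assume "i < dim_vec (vsum (n * m) (\<lambda>a. f a \<otimes>\<^sub>v w) A)"
    hence i: "i < n * m" by simp
    have "(f a \<otimes>\<^sub>v w) $ i = f a $ (i div m) * w $ (i mod m)" if "a \<in> A" for a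
      using assms(1)[OF that] assms(2) i by (auto simp: vtensor_index)
    thus "(vsum n f A \<otimes>\<^sub>v w) $ i = vsum (n * m) (\<lambda>a. f a \<otimes>\<^sub>v w) A $ i"
      using i assms(2) by (simp add: vtensor_index vsum_def div_less_mult sum_distrib_right)
  qed (use assms in simp)
  show "w \<otimes>\<^sub>v vsum n f A = vsum (m * n) (\<lambda>a. w \<otimes>\<^sub>v f a) A"
  proof (rule eq_vecI)
    fix i assume "i < dim_vec (vsum (m * n) (\<lambda>a. w \<otimes>\<^sub>v f a) A)"
    hence i: "i < m * n" by simp
    have "(w \<otimes>\<^sub>v f a) $ i = w $ (i div n) * f a $ (i mod n)" if "a \<in> A" for a
      using assms(1)[OF that] assms(2) i by (auto simp: vtensor_index)
    thus "(w \<otimes>\<^sub>v vsum n f A) $ i = vsum (m * n) (\<lambda>a. w \<otimes>\<^sub>v f a) A $ i"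
      using i assms(2) by (simp add: vtensor_index vsum_def mod_less_mult sum_distrib_left)
  qed (use assms in simp)
qed

lemma smult_vsum:
  fixes f :: "'i \<Rightarrow> 'k::comm_semiring_0 vec"
  assumes "\<And>a. a \<in> A \<Longrightarrow> f a \<in> carrier_vec n"
  shows "c \<cdot>\<^sub>v vsum n f A = vsum n (\<lambda>a. c \<cdot>\<^sub>v f a) A"
  using carrier_vecD[OF assms] by (intro eq_vecI) (auto simp: vsum_def sum_distrib_left intro!: sum.cong)

lemma mat_sum_mult_vec:
  fixes M :: "'i \<Rightarrow> 'k::comm_semiring_0 mat"
  assumes "\<And>a. a \<in> A \<Longrightarrow> M a \<in> carrier_mat r n" "v \<in> carrier_vec n"
  shows "mat r n (\<lambda>p. \<Sum>a\<in>A. f a * M a $$ p) *\<^sub>v v = vsum r (\<lambda>a. f a \<cdot>\<^sub>v (M a *\<^sub>v v)) A"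
proof (rule eq_vecI)
  fix i assume "i < dim_vec (vsum r (\<lambda>a. f a \<cdot>\<^sub>v (M a *\<^sub>v v)) A)"
  hence i: "i < r" by simp
  have "(mat r n (\<lambda>p. \<Sum>a\<in>A. f a * M a $$ p) *\<^sub>v v) $ i
    = (\<Sum>j\<in>{0..<n}. \<Sum>a\<in>A. f a * (M a $$ (i, j) * v $ j))"
    using assms(2) i by (simp add: scalar_prod_def sum_distrib_right mult.assoc)
  also have "\<dots> = (\<Sum>a\<in>A. \<Sum>j\<in>{0..<n}. f a * (M a $$ (i, j) * v $ j))"
    by (rule sum.swap)
  also have "\<dots> = vsum r (\<lambda>a. f a \<cdot>\<^sub>v (M a *\<^sub>v v)) A $ i"
    using assms(2) i carrier_matD[OF assms(1)]
    by (auto simp: vsum_def scalar_prod_def sum_distrib_left intro!: sum.cong)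
  finally show "(mat r n (\<lambda>p. \<Sum>a\<in>A. f a * M a $$ p) *\<^sub>v v) $ i
    = vsum r (\<lambda>a. f a \<cdot>\<^sub>v (M a *\<^sub>v v)) A $ i" .
qed simp

lemma block_carrier [simp]: "block n i z \<in> carrier_vec n"
  by (simp add: block_def)

lemma block_vtensor:
  fixes u :: "'k::semiring_0 vec"
  assumes "i < dim_vec u" "w \<in> carrier_vec n"
  shows "block n i (u \<otimes>\<^sub>v w) = u $ i \<cdot>\<^sub>v w"
  using assms by (intro eq_vecI) (auto simp: block_def vtensor_index pair_less_mult)

lemma block_vsum:
  assumes "i < m" "\<And>a. a \<in> A \<Longrightarrow> f a \<in> carrier_vec (m * n)"
  shows "block n i (vsum (m * n) f A) = vsum n (\<lambda>a. block n i (f a)) A"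
  using assms(1) carrier_vecD[OF assms(2)] by (intro eq_vecI) (auto simp: block_def vsum_def pair_less_mult)

lemma block_smult:
  fixes c :: "'k::semiring_0"
  assumes "i < m" "z \<in> carrier_vec (m * n)"
  shows "block n i (c \<cdot>\<^sub>v z) = c \<cdot>\<^sub>v block n i z"
  using assms by (intro eq_vecI) (auto simp: block_def pair_less_mult)

lemma vec_eq_vsum_blocks:
  fixes z :: "'k::semiring_1 vec"
  assumes "z \<in> carrier_vec (m * n)"
  shows "z = vsum (m * n) (\<lambda>i. unit_vec m i \<otimes>\<^sub>v block n i z) {0..<m}"
proof (rule eq_vecI)
  fix j assume "j < dim_vec (vsum (m * n) (\<lambda>i. unit_vec m i \<otimes>\<^sub>v block n i z) {0..<m})"
  hence j: "j < m * n" by simp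
  have "(\<Sum>i\<in>{0..<m}. (unit_vec m i \<otimes>\<^sub>v block n i z) $ j)
    = (\<Sum>i\<in>{0..<m}. if i = j div n then z $ j else 0)"
    using j by (intro sum.cong) (auto simp: vtensor_index div_less_mult mod_less_mult block_def)
  also have "\<dots> = z $ j" using j by (simp add: div_less_mult)
  finally show "z $ j = vsum (m * n) (\<lambda>i. unit_vec m i \<otimes>\<^sub>v block n i z) {0..<m} $ j"
    using j by (simp add: vsum_def)
qed (use assms in simp)

lemma flip_mat_carrier [simp]: "flip_mat n m \<in> carrier_mat (m * n) (n * m)"
  by (simp add: flip_mat_def)

lemma flip_mat_vtensor:
  fixes u :: "'k::comm_semiring_1 vec"
  assumes "u \<in> carrier_vec n" "w \<in> carrier_vec m"
  shows "flip_mat n m *\<^sub>v (u \<otimes>\<^sub>v w) = w \<otimes>\<^sub>v u"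
proof (rule eq_vecI)
  fix i assume "i < dim_vec (w \<otimes>\<^sub>v u)"
  hence i: "i < m * n" using assms by simp
  let ?k = "(i mod n) * m + i div n"
  have k: "?k < n * m" using i by (simp add: pair_less_mult div_less_mult mod_less_mult)
  have km: "?k div m = i mod n" "?k mod m = i div n" using div_less_mult[OF i] by simp_all
  have "(flip_mat n m *\<^sub>v (u \<otimes>\<^sub>v w)) $ i = (\<Sum>j\<in>{0..<n * m}. (if j = ?k then 1 else 0) * (u \<otimes>\<^sub>v w) $ j)"
    using i assms by (simp add: flip_mat_def scalar_prod_def)
  also have "\<dots> = (\<Sum>j\<in>{0..<n * m}. if j = ?k then (u \<otimes>\<^sub>v w) $ j else 0)"
    by (intro sum.cong) auto
  also have "\<dots> = (u \<otimes>\<^sub>v w) $ ?k" using k by simp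
  also have "\<dots> = (w \<otimes>\<^sub>v u) $ i"
    using assms i k km by (simp add: vtensor_index mult.commute[of "u $ _"])
  finally show "(flip_mat n m *\<^sub>v (u \<otimes>\<^sub>v w)) $ i = (w \<otimes>\<^sub>v u) $ i" .
qed (use assms in \<open>simp add: flip_mat_def\<close>)

text \<open>
  Over a field this says that \<open>S\<close> spans; in this form it is ready to be used for proving equality of
  linear maps, and it passes to tensor products without a choice of bases.
\<close>

definition separates :: "nat \<Rightarrow> 'k::comm_ring_1 vec set \<Rightarrow> bool" where
  "separates n S \<longleftrightarrow> S \<subseteq> carrier_vec n \<and>
    (\<forall>r. \<forall>A\<in>carrier_mat r n. \<forall>B\<in>carrier_mat r n. (\<forall>s\<in>S. A *\<^sub>v s = B *\<^sub>v s) \<longrightarrow> A = B)"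

lemma separatesD:
  assumes "separates n S" "A \<in> carrier_mat r n" "B \<in> carrier_mat r n" "\<And>s. s \<in> S \<Longrightarrow> A *\<^sub>v s = B *\<^sub>v s"
  shows "A = B"
  using assms unfolding separates_def by blast

lemma mat_eqI_unit_vec:
  fixes A B :: "'k::comm_ring_1 mat"
  assumes A: "A \<in> carrier_mat r n" and B: "B \<in> carrier_mat r n"
    and eq: "\<And>i. i < n \<Longrightarrow> A *\<^sub>v unit_vec n i = B *\<^sub>v unit_vec n i"
  shows "A = B"
proof (rule eq_matI)
  fix i j assume ij: "i < dim_row B" "j < dim_col B"
  have "M $$ (i, j) = (M *\<^sub>v unit_vec n j) $ i" if "M \<in> carrier_mat r n" for M :: "'k mat"
    using that ij B scalar_prod_right_unit[of j n "row M i"] by auto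
  from this[OF A] this[OF B] show "A $$ (i, j) = B $$ (i, j)" using eq[of j] ij B by (metis carrier_matD(2))
qed (use A B in auto)

lemma separatesI:
  fixes S :: "'k::comm_ring_1 vec set"
  assumes "S \<subseteq> carrier_vec n" and "separates n T"
    and "\<And>t. t \<in> T \<Longrightarrow> \<exists>(I :: 'i set) f. (\<forall>i\<in>I. f i \<in> S) \<and> t = vsum n f I"
  shows "separates n S"
  unfolding separates_def
proof (intro conjI allI ballI impI)
  fix r A B assume A: "A \<in> carrier_mat r n" and B: "B \<in> carrier_mat r n"
    and eq: "\<forall>s\<in>S. A *\<^sub>v s = B *\<^sub>v s"
  show "A = B"
  proof (rule separatesD[OF assms(2) A B])
    fix t assume "t \<in> T"
    then obtain I :: "'i set" and f where t: "\<forall>i\<in>I. f i \<in> S" "t = vsum n f I" using assms(3) by blast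
    have f: "f i \<in> carrier_vec n" if "i \<in> I" for i using t(1) assms(1) that by blast
    have "M *\<^sub>v t = vsum r (\<lambda>i. M *\<^sub>v f i) I" if "M \<in> carrier_mat r n" for M
      unfolding t(2) by (rule vsum_image_under[OF f that])
    thus "A *\<^sub>v t = B *\<^sub>v t"
      using eq t(1) A B by (auto intro!: vsum_cong)
  qed
qed (use assms in auto)

lemma separates_carrier: "separates n (carrier_vec n :: 'k::comm_ring_1 vec set)"
  unfolding separates_def using mat_eqI_unit_vec by (metis order_refl unit_vec_carrier)

lemma separates_unit: "separates n (unit_vec n ` {0..<n} :: 'k::comm_ring_1 vec set)"
  unfolding separates_def by (auto intro: mat_eqI_unit_vec)

lemma separates_mult_eq:
  fixes A B :: "'k::comm_ring_1 mat"
  assumes "separates n S" "A \<in> carrier_mat r n" "B \<in> carrier_mat r n"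
    "\<And>s. s \<in> S \<Longrightarrow> A *\<^sub>v s = B *\<^sub>v s"
  shows "A *\<^sub>v v = B *\<^sub>v v"
  using separatesD[OF assms] by simp

text \<open>
  Equality of two linear maps on tensor products is extended from \<open>S\<close> to all vectors in the first
  argument, and then from \<open>T\<close> to all vectors in the second.
\<close>

lemma separates_vtensor:
  fixes S T :: "'k::comm_ring_1 vec set"
  assumes S: "separates n S" and T: "separates m T"
  shows "separates (n * m) {s \<otimes>\<^sub>v t | s t. s \<in> S \<and> t \<in> T}"
  unfolding separates_def
proof (intro conjI allI ballI impI)
  have Sc: "s \<in> carrier_vec n" if "s \<in> S" for s using S that by (auto simp: separates_def)
  have Tc: "t \<in> carrier_vec m" if "t \<in> T" for t using T that by (auto simp: separates_def)
  show "{s \<otimes>\<^sub>v t | s t. s \<in> S \<and> t \<in> T} \<subseteq> carrier_vec (n * m)" using Sc Tc by auto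
  fix r and A B :: "'k mat" assume A: "A \<in> carrier_mat r (n * m)" and B: "B \<in> carrier_mat r (n * m)"
    and eq: "\<forall>x\<in>{s \<otimes>\<^sub>v t | s t. s \<in> S \<and> t \<in> T}. A *\<^sub>v x = B *\<^sub>v x"
  \<comment> \<open>\<open>L u\<close> and \<open>R w\<close> are the matrices of \<open>w \<mapsto> u \<otimes> w\<close> and \<open>u \<mapsto> u \<otimes> w\<close>.\<close>
  define L :: "'k vec \<Rightarrow> 'k mat" where "L u = mat (n * m) m (\<lambda>(i, j). u $ (i div m) * (if i mod m = j then 1 else 0))" for u
  define R :: "'k vec \<Rightarrow> 'k mat" where "R w = mat (n * m) n (\<lambda>(i, j). if i div m = j then w $ (i mod m) else 0)" for w
  have Lc: "L u \<in> carrier_mat (n * m) m" and Rc: "R w \<in> carrier_mat (n * m) n" for u w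
    by (simp_all add: L_def R_def)
  have L: "L u *\<^sub>v w = u \<otimes>\<^sub>v w" if "u \<in> carrier_vec n" "w \<in> carrier_vec m" for u w
    using that by (intro eq_vecI) (auto simp: L_def vtensor_index scalar_prod_def mod_less_mult
      sum_distrib_left[symmetric] mult.assoc if_distrib[of "\<lambda>x. x * _"] cong: if_cong)
  have R: "R w *\<^sub>v u = u \<otimes>\<^sub>v w" if "u \<in> carrier_vec n" "w \<in> carrier_vec m" for u w
    using that by (intro eq_vecI) (auto simp: R_def vtensor_index scalar_prod_def div_less_mult
      if_distrib[of "\<lambda>x. x * _"] mult.commute[of "w $ _"] cong: if_cong)
  have 1: "A *\<^sub>v (u \<otimes>\<^sub>v t) = B *\<^sub>v (u \<otimes>\<^sub>v t)" if u: "u \<in> carrier_vec n" and t: "t \<in> T" for u t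
  proof -
    have "(A * R t) *\<^sub>v u = (B * R t) *\<^sub>v u"
      by (rule separates_mult_eq[OF S mult_carrier_mat[OF A Rc] mult_carrier_mat[OF B Rc]])
        (use A B eq t Sc Tc R in \<open>auto simp: assoc_mult_mat_vec[OF _ Rc]\<close>)
    thus ?thesis using A B Rc R u Tc[OF t] by (simp add: assoc_mult_mat_vec[OF _ Rc])
  qed
  have 2: "A *\<^sub>v (u \<otimes>\<^sub>v w) = B *\<^sub>v (u \<otimes>\<^sub>v w)" if u: "u \<in> carrier_vec n" and w: "w \<in> carrier_vec m" for u w
  proof -
    have "(A * L u) *\<^sub>v w = (B * L u) *\<^sub>v w"
      by (rule separates_mult_eq[OF T mult_carrier_mat[OF A Lc] mult_carrier_mat[OF B Lc]])
        (use A B 1 u Tc L in \<open>auto simp: assoc_mult_mat_vec[OF _ Lc]\<close>)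
    thus ?thesis using A B Lc L u w by (simp add: assoc_mult_mat_vec[OF _ Lc])
  qed
  show "A = B"
  proof (rule mat_eqI_unit_vec[OF A B])
    fix i assume i: "i < n * m"
    have e: "unit_vec (n * m) i = (unit_vec n (i div m) \<otimes>\<^sub>v unit_vec m (i mod m) :: 'k vec)"
    proof (rule eq_vecI)
      fix j assume "j < dim_vec (unit_vec n (i div m) \<otimes>\<^sub>v unit_vec m (i mod m) :: 'k vec)"
      hence j: "j < n * m" by simp
      have "j = i \<longleftrightarrow> j div m = i div m \<and> j mod m = i mod m" by (metis div_mult_mod_eq)
      thus "unit_vec (n * m) i $ j = (unit_vec n (i div m) \<otimes>\<^sub>v unit_vec m (i mod m) :: 'k vec) $ j"
        using i j by (auto simp: vtensor_index div_less_mult mod_less_mult)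
    qed simp
    show "A *\<^sub>v unit_vec (n * m) i = B *\<^sub>v unit_vec (n * m) i" unfolding e by (rule 2) simp_all
  qed
qed

lemma act1_mult_vec:
  assumes "\<And>b. b \<in> qbasis H \<Longrightarrow> ract X b \<in> carrier_mat (rdim X) (rdim X)" "v \<in> carrier_vec (rdim X)"
  shows "act1 H X u *\<^sub>v v = vsum (rdim X) (\<lambda>b. u b \<cdot>\<^sub>v (ract X b *\<^sub>v v)) (qbasis H)"
  unfolding act1_def by (rule mat_sum_mult_vec) (use assms in auto)

lemma act2_mult_vtensor:
  assumes X: "\<And>b. b \<in> qbasis H \<Longrightarrow> ract X b \<in> carrier_mat (rdim X) (rdim X)"
    and Y: "\<And>b. b \<in> qbasis H \<Longrightarrow> ract Y b \<in> carrier_mat (rdim Y) (rdim Y)"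
    and v: "v \<in> carrier_vec (rdim X)" and w: "w \<in> carrier_vec (rdim Y)"
  shows "act2 H X Y u *\<^sub>v (v \<otimes>\<^sub>v w) = vsum (rdim X * rdim Y)
    (\<lambda>(b, c). u b c \<cdot>\<^sub>v ((ract X b *\<^sub>v v) \<otimes>\<^sub>v (ract Y c *\<^sub>v w))) (qbasis H \<times> qbasis H)"
proof -
  let ?B = "qbasis H \<times> qbasis H"
  have "act2 H X Y u *\<^sub>v (v \<otimes>\<^sub>v w) = vsum (rdim X * rdim Y)
    (\<lambda>p. u (fst p) (snd p) \<cdot>\<^sub>v (kron (ract X (fst p)) (ract Y (snd p)) *\<^sub>v (v \<otimes>\<^sub>v w))) ?B"
    unfolding act2_def sum.cartesian_product split_def
    by (rule mat_sum_mult_vec) (use assms in auto)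
  also have "\<dots> = vsum (rdim X * rdim Y)
    (\<lambda>p. u (fst p) (snd p) \<cdot>\<^sub>v ((ract X (fst p) *\<^sub>v v) \<otimes>\<^sub>v (ract Y (snd p) *\<^sub>v w))) ?B"
    by (rule vsum_cong) (use kron_mult_vtensor[OF X Y v w] in auto)
  finally show ?thesis by (simp add: split_def)
qed

lemma act3_mult_vtensor:
  assumes X: "\<And>b. b \<in> qbasis H \<Longrightarrow> ract X b \<in> carrier_mat (rdim X) (rdim X)"
    and Y: "\<And>b. b \<in> qbasis H \<Longrightarrow> ract Y b \<in> carrier_mat (rdim Y) (rdim Y)"
    and Z: "\<And>b. b \<in> qbasis H \<Longrightarrow> ract Z b \<in> carrier_mat (rdim Z) (rdim Z)"
    and v: "v \<in> carrier_vec (rdim X)" and w: "w \<in> carrier_vec (rdim Y)" and z: "z \<in> carrier_vec (rdim Z)"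
  shows "act3 H X Y Z u *\<^sub>v (v \<otimes>\<^sub>v w \<otimes>\<^sub>v z) = vsum (rdim X * rdim Y * rdim Z)
    (\<lambda>(b, c, d). u b c d \<cdot>\<^sub>v ((ract X b *\<^sub>v v) \<otimes>\<^sub>v (ract Y c *\<^sub>v w) \<otimes>\<^sub>v (ract Z d *\<^sub>v z)))
    (qbasis H \<times> qbasis H \<times> qbasis H)"
proof -
  let ?B = "qbasis H \<times> qbasis H \<times> qbasis H"
  have eq: "(\<Sum>b\<in>qbasis H. \<Sum>c\<in>qbasis H. \<Sum>d\<in>qbasis H. f b c d) = (\<Sum>(b, c, d)\<in>?B. f b c d)"
    for f :: "'a \<Rightarrow> 'a \<Rightarrow> 'a \<Rightarrow> 'b" by (simp add: sum.cartesian_product)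
  have "act3 H X Y Z u *\<^sub>v (v \<otimes>\<^sub>v w \<otimes>\<^sub>v z) = vsum (rdim X * rdim Y * rdim Z)
    (\<lambda>p. u (fst p) (fst (snd p)) (snd (snd p)) \<cdot>\<^sub>v
      (kron (kron (ract X (fst p)) (ract Y (fst (snd p)))) (ract Z (snd (snd p))) *\<^sub>v (v \<otimes>\<^sub>v w \<otimes>\<^sub>v z))) ?B"
    unfolding act3_def eq split_def
    by (rule mat_sum_mult_vec) (use assms in \<open>auto intro!: kron_carrier\<close>)
  also have "\<dots> = vsum (rdim X * rdim Y * rdim Z)
    (\<lambda>p. u (fst p) (fst (snd p)) (snd (snd p)) \<cdot>\<^sub>v
      ((ract X (fst p) *\<^sub>v v) \<otimes>\<^sub>v (ract Y (fst (snd p)) *\<^sub>v w) \<otimes>\<^sub>v (ract Z (snd (snd p)) *\<^sub>v z))) ?B"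
    by (rule vsum_cong)
      (use kron_mult_vtensor[OF X Y v w] kron_mult_vtensor[OF kron_carrier[OF X Y] Z vtensor_carrier[OF v w] z] in auto)
  finally show ?thesis by (simp add: split_def)
qed

lemma zero_smult [simp]: "v \<in> carrier_vec n \<Longrightarrow> 0 \<cdot>\<^sub>v v = (0\<^sub>v n :: 'k::semiring_0 vec)"
  by (intro eq_vecI) auto

lemma smult_zero [simp]: "c \<cdot>\<^sub>v 0\<^sub>v n = (0\<^sub>v n :: 'k::semiring_0 vec)"
  by (intro eq_vecI) auto

lemma mult_mat_vec_zero: "A \<in> carrier_mat r c \<Longrightarrow> A *\<^sub>v 0\<^sub>v c = (0\<^sub>v r :: 'k::semiring_0 vec)"
  by (intro eq_vecI) auto

lemma pow_mat_add:
  fixes A :: "'k::semiring_1 mat"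
  assumes A: "A \<in> carrier_mat n n"
  shows "A ^\<^sub>m (i + j) = A ^\<^sub>m i * A ^\<^sub>m j"
  by (induction j) (use A pow_carrier_mat[OF A] in \<open>simp_all add: assoc_mult_mat[OF pow_carrier_mat[OF A] pow_carrier_mat[OF A] A]\<close>)

lemma pow_mat_mult_one:
  fixes A :: "'k::semiring_1 mat"
  assumes A: "A \<in> carrier_mat n n" and L: "A ^\<^sub>m L = 1\<^sub>m n"
  shows "A ^\<^sub>m (k * L) = 1\<^sub>m n"
  by (induction k) (use A in \<open>simp_all add: pow_mat_add[OF A] L\<close>)

section \<open>Modules over the twisted quantum double\<close>

locale finite_cocycle3_group = cocycle3_group G \<omega>
  for G :: "('a, 'm) monoid_scheme" (structure) and \<omega> :: "'a \<Rightarrow> 'a \<Rightarrow> 'a \<Rightarrow> 'k::field" +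
  assumes finite_carrier [simp]: "finite (carrier G)"
begin

abbreviation D where "D \<equiv> twisted_double G \<omega>"

lemma D_simps [simp]:
  "qbasis D = carrier G \<times> carrier G"
  "qmult D (g, x) (h, y) (l, z) = (if g = x \<triangleright> h \<and> l = g \<and> z = x \<otimes> y then \<theta> g x y else 0)"
  "qunit D (g, x) = (if x = \<one> then 1 else 0)"
  "qcomult D (g, x) (s, y) (t, z) = (if s \<otimes> t = g \<and> y = x \<and> z = x then \<gamma> x s t else 0)"
  "qassoc D (a, x) (b, y) (c, z) = (if x = \<one> \<and> y = \<one> \<and> z = \<one> then inverse (\<omega> a b c) else 0)"
  "qRmatrix D (g, x) (h, y) = (if x = \<one> \<and> y = g then 1 else 0)"
  by (simp_all add: twisted_double_def)

lemma \<theta>_one [simp]: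
  assumes "g \<in> carrier G" "x \<in> carrier G"
  shows "\<theta> g \<one> x = 1" "\<theta> g x \<one> = 1"
  using assms by (simp_all add: dpr_theta_def word)

lemma \<gamma>_one [simp]:
  assumes "g \<in> carrier G" "x \<in> carrier G"
  shows "\<gamma> \<one> g x = 1" "\<gamma> g \<one> x = 1" "\<gamma> g x \<one> = 1"
  using assms by (simp_all add: dpr_gamma_def word)

lemma vsum_carrier_single:
  assumes "a \<in> carrier G" "\<And>b. b \<in> carrier G \<Longrightarrow> b \<noteq> a \<Longrightarrow> f b = 0\<^sub>v n" "f a \<in> carrier_vec n"
  shows "vsum n f (carrier G) = f a"
  by (rule vsum_single) (use assms in auto)

lemma vsum_basis_single:
  assumes "a \<in> carrier G" "x \<in> carrier G"
    "\<And>b y. b \<in> carrier G \<Longrightarrow> y \<in> carrier G \<Longrightarrow> (b, y) \<noteq> (a, x) \<Longrightarrow> f (b, y) = 0\<^sub>v n" "f (a, x) \<in> carrier_vec n"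
  shows "vsum n f (carrier G \<times> carrier G) = f (a, x)"
  by (rule vsum_single) (use assms in auto)

text \<open>
  The part of the definition of a representation that is needed to evaluate the action of algebra
  elements on vectors.
\<close>

definition carriers :: "('a \<times> 'a, 'k) rep \<Rightarrow> bool" where
  "carriers X \<longleftrightarrow> (\<forall>g\<in>carrier G. \<forall>x\<in>carrier G. ract X (g, x) \<in> carrier_mat (rdim X) (rdim X))"

lemma carriersD [simp]:
  "carriers X \<Longrightarrow> g \<in> carrier G \<Longrightarrow> x \<in> carrier G \<Longrightarrow> ract X (g, x) \<in> carrier_mat (rdim X) (rdim X)"
  by (simp add: carriers_def)

lemma carriers_vec [simp]:
  "carriers X \<Longrightarrow> g \<in> carrier G \<Longrightarrow> x \<in> carrier G \<Longrightarrow> v \<in> carrier_vec (rdim X) \<Longrightarrow>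
    ract X (g, x) *\<^sub>v v \<in> carrier_vec (rdim X)"
  using carriersD mult_mat_vec_carrier by blast

lemma act1_carrier [simp]: "act1 H X u \<in> carrier_mat (rdim X) (rdim X)"
  by (simp add: act1_def)

lemma act1_vec:
  assumes "carriers X" "v \<in> carrier_vec (rdim X)"
  shows "act1 D X u *\<^sub>v v = vsum (rdim X) (\<lambda>b. u b \<cdot>\<^sub>v (ract X b *\<^sub>v v)) (carrier G \<times> carrier G)"
  using act1_mult_vec[of D X v u] assms by auto

lemma act1_qmult:
  assumes X: "carriers X" and v: "v \<in> carrier_vec (rdim X)"
    and "g \<in> carrier G" "x \<in> carrier G" "h \<in> carrier G" "y \<in> carrier G"
  shows "act1 D X (qmult D (g, x) (h, y)) *\<^sub>v v =
    (if g = x \<triangleright> h then \<theta> g x y \<cdot>\<^sub>v (ract X (g, x \<otimes> y) *\<^sub>v v) else 0\<^sub>v (rdim X))"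
proof (cases "g = x \<triangleright> h")
  case True
  have "act1 D X (qmult D (g, x) (h, y)) *\<^sub>v v
    = qmult D (g, x) (h, y) (g, x \<otimes> y) \<cdot>\<^sub>v (ract X (g, x \<otimes> y) *\<^sub>v v)"
    unfolding act1_vec[OF X v]
    by (rule vsum_basis_single) (use assms carrier_vecD[OF carriers_vec[OF X _ _ v]] in auto)
  thus ?thesis using True by simp
next
  case False
  thus ?thesis unfolding act1_vec[OF X v] using assms carrier_vecD[OF carriers_vec[OF X _ _ v]]
    by (auto intro!: vsum_zero)
qed

lemma act1_qunit:
  assumes X: "carriers X" and v: "v \<in> carrier_vec (rdim X)"
  shows "act1 D X (qunit D) *\<^sub>v v = vsum (rdim X) (\<lambda>g. ract X (g, \<one>) *\<^sub>v v) (carrier G)"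
proof -
  have "act1 D X (qunit D) *\<^sub>v v
    = vsum (rdim X) (\<lambda>b. qunit D b \<cdot>\<^sub>v (ract X b *\<^sub>v v)) ((\<lambda>g. (g, \<one>)) ` carrier G)"
    unfolding act1_vec[OF X v]
    by (rule vsum_support) (use assms in \<open>auto intro!: zero_smult\<close>)
  also have "\<dots> = vsum (rdim X) (\<lambda>g. ract X (g, \<one>) *\<^sub>v v) (carrier G)"
    by (subst vsum_reindex) (auto simp: inj_on_def)
  finally show ?thesis .
qed

text \<open>
  The axioms of a representation need to be tested on spanning vectors only.
\<close>

lemma is_repI:
  assumes X: "carriers X" and S: "separates (rdim X) S"
    and mult: "\<And>v g x h y. v \<in> S \<Longrightarrow> g \<in> carrier G \<Longrightarrow> x \<in> carrier G \<Longrightarrow> h \<in> carrier G \<Longrightarrow> y \<in> carrier G \<Longrightarrow>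
      ract X (g, x) *\<^sub>v (ract X (h, y) *\<^sub>v v) =
      (if g = x \<triangleright> h then \<theta> g x y \<cdot>\<^sub>v (ract X (g, x \<otimes> y) *\<^sub>v v) else 0\<^sub>v (rdim X))"
    and unit: "\<And>v. v \<in> S \<Longrightarrow> vsum (rdim X) (\<lambda>g. ract X (g, \<one>) *\<^sub>v v) (carrier G) = v"
  shows "is_rep D X"
proof -
  have Sc: "v \<in> carrier_vec (rdim X)" if "v \<in> S" for v using S that by (auto simp: separates_def)
  have "ract X (g, x) * ract X (h, y) = act1 D X (qmult D (g, x) (h, y))"
    if *: "g \<in> carrier G" "x \<in> carrier G" "h \<in> carrier G" "y \<in> carrier G" for g x h y
  proof (rule separatesD[OF S mult_carrier_mat[OF carriersD[OF X *(1,2)] carriersD[OF X *(3,4)]] act1_carrier])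
    fix v assume v: "v \<in> S"
    show "ract X (g, x) * ract X (h, y) *\<^sub>v v = act1 D X (qmult D (g, x) (h, y)) *\<^sub>v v"
      unfolding act1_qmult[OF X Sc[OF v] *] mult[OF v *, symmetric]
      by (rule assoc_mult_mat_vec[OF carriersD[OF X *(1,2)] carriersD[OF X *(3,4)] Sc[OF v]])
  qed
  moreover have "act1 D X (qunit D) = 1\<^sub>m (rdim X)"
    by (rule separatesD[OF S act1_carrier one_carrier_mat]) (use unit act1_qunit[OF X Sc] Sc in auto)
  ultimately show ?thesis using X by (auto simp: is_rep_def)
qed

lemma rep_carriers: "is_rep D X \<Longrightarrow> carriers X"
  by (auto simp: is_rep_def carriers_def)

lemma rep_mult:
  assumes "is_rep D X" "v \<in> carrier_vec (rdim X)"
    and *: "g \<in> carrier G" "x \<in> carrier G" "h \<in> carrier G" "y \<in> carrier G"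
  shows "ract X (g, x) *\<^sub>v (ract X (h, y) *\<^sub>v v) =
    (if g = x \<triangleright> h then \<theta> g x y \<cdot>\<^sub>v (ract X (g, x \<otimes> y) *\<^sub>v v) else 0\<^sub>v (rdim X))"
proof -
  note X = rep_carriers[OF assms(1)]
  have "ract X (g, x) *\<^sub>v (ract X (h, y) *\<^sub>v v) = ract X (g, x) * ract X (h, y) *\<^sub>v v"
    using assoc_mult_mat_vec[OF carriersD[OF X *(1,2)] carriersD[OF X *(3,4)] assms(2)] ..
  also have "\<dots> = act1 D X (qmult D (g, x) (h, y)) *\<^sub>v v"
  proof -
    have "\<forall>b\<in>qbasis D. \<forall>c\<in>qbasis D. ract X b * ract X c = act1 D X (qmult D b c)"
      using assms(1) unfolding is_rep_def by blast
    from this[rule_format, of "(g, x)" "(h, y)"] show ?thesis using * by simp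
  qed
  finally show ?thesis unfolding act1_qmult[OF X assms(2-6)] .
qed

lemma rep_unit:
  assumes "is_rep D X" "v \<in> carrier_vec (rdim X)"
  shows "vsum (rdim X) (\<lambda>g. ract X (g, \<one>) *\<^sub>v v) (carrier G) = v"
proof -
  have "act1 D X (qunit D) = 1\<^sub>m (rdim X)" using assms(1) by (simp only: is_rep_def)
  thus ?thesis unfolding act1_qunit[OF rep_carriers[OF assms(1)] assms(2), symmetric]
    using assms(2) by simp
qed

text \<open>
  The image of the idempotent \<open>e\<^sub>a\<close>, that is, the part of degree \<open>a\<close>.
\<close>

definition grade :: "('a \<times> 'a, 'k) rep \<Rightarrow> 'a \<Rightarrow> 'k vec set" where
  "grade X a = {v \<in> carrier_vec (rdim X). ract X (a, \<one>) *\<^sub>v v = v}"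

text \<open>
  The action of the element \<open>x\<close>, the sum of all \<open>e\<^sub>g # x\<close>.
\<close>

definition trans :: "('a \<times> 'a, 'k) rep \<Rightarrow> 'a \<Rightarrow> 'k mat" where
  "trans X x = act1 D X (\<lambda>(g, y). if y = x then 1 else 0)"

abbreviation \<rho> where "\<rho> X x v \<equiv> trans X x *\<^sub>v v"

lemma trans_carrier [simp]: "trans X x \<in> carrier_mat (rdim X) (rdim X)"
  by (simp add: trans_def)

lemma dim_trans [simp]: "dim_row (trans X x) = rdim X" "dim_col (trans X x) = rdim X"
  using trans_carrier by blast+

lemma \<rho>_carrier [simp]: "v \<in> carrier_vec (rdim X) \<Longrightarrow> \<rho> X x v \<in> carrier_vec (rdim X)"
  by (rule mult_mat_vec_carrier[OF trans_carrier])

lemma \<rho>_smult: "v \<in> carrier_vec (rdim X) \<Longrightarrow> \<rho> X x (c \<cdot>\<^sub>v v) = c \<cdot>\<^sub>v \<rho> X x v"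
  by (rule mult_mat_vec[OF trans_carrier])

lemma gradeI: "v \<in> carrier_vec (rdim X) \<Longrightarrow> ract X (a, \<one>) *\<^sub>v v = v \<Longrightarrow> v \<in> grade X a"
  by (simp add: grade_def)

lemma gradeD [simp]: "v \<in> grade X a \<Longrightarrow> v \<in> carrier_vec (rdim X)"
  by (simp add: grade_def)

lemma grade_fixed [simp]: "v \<in> grade X a \<Longrightarrow> ract X (a, \<one>) *\<^sub>v v = v"
  unfolding grade_def by blast

lemma grade_smult [simp]:
  assumes "carriers X" "a \<in> carrier G" "v \<in> grade X a"
  shows "c \<cdot>\<^sub>v v \<in> grade X a"
  using mult_mat_vec[OF carriersD[OF assms(1,2) one_closed] gradeD[OF assms(3)], of c] assms
  by (auto intro: gradeI)

text \<open>
  On the part of degree \<open>b\<close> the basis element \<open>e\<^sub>g # x\<close> acts like \<open>x\<close> if \<open>g\<close> is the conjugate of \<open>b\<close> by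
  \<open>x\<close>, and otherwise by zero. So a representation is a graded space with a projective
  action of the group that conjugates degrees.
\<close>

lemma ract_grade:
  assumes X: "is_rep D X" and v: "v \<in> grade X b" and *: "b \<in> carrier G" "g \<in> carrier G" "x \<in> carrier G"
  shows "ract X (g, x) *\<^sub>v v = (if g = x \<triangleright> b then \<rho> X x v else 0\<^sub>v (rdim X))"
proof -
  note c = rep_carriers[OF X] gradeD[OF v]
  have zero: "ract X (g, x) *\<^sub>v v = 0\<^sub>v (rdim X)"
    if "g \<noteq> x \<triangleright> b" "g \<in> carrier G" for g
    using rep_mult[OF X gradeD[OF v], of g x b \<one>] that v * by simp
  have "\<rho> X x v = (\<lambda>(g, y). if y = x then 1 else 0) (x \<triangleright> b, x) \<cdot>\<^sub>v (ract X (x \<triangleright> b, x) *\<^sub>v v)"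
    unfolding trans_def act1_vec[OF c]
    by (rule vsum_basis_single) (use zero * c carrier_vecD[OF carriers_vec[OF c(1) _ _ c(2)]] in auto)
  thus ?thesis using zero * by simp
qed

lemma \<rho>_eq:
  assumes "is_rep D X" "v \<in> grade X b" "b \<in> carrier G" "x \<in> carrier G"
  shows "\<rho> X x v = ract X (x \<triangleright> b, x) *\<^sub>v v"
  using ract_grade[of X v b "x \<triangleright> b" x] assms by simp

lemma \<rho>_grade [simp]:
  assumes X: "is_rep D X" and v: "v \<in> grade X b" and *: "b \<in> carrier G" "x \<in> carrier G"
  shows "\<rho> X x v \<in> grade X (x \<triangleright> b)"
  using rep_mult[OF X gradeD[OF v], of "x \<triangleright> b" \<one> "x \<triangleright> b" x] * v
  by (auto intro!: gradeI simp: \<rho>_eq[OF X v *] rep_carriers[OF X])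

lemma \<rho>_\<rho>:
  assumes X: "is_rep D X" and v: "v \<in> grade X b" and *: "b \<in> carrier G" "x \<in> carrier G" "y \<in> carrier G"
  shows "\<rho> X x (\<rho> X y v) = \<theta> ((x \<otimes> y) \<triangleright> b) x y \<cdot>\<^sub>v \<rho> X (x \<otimes> y) v"
  using rep_mult[OF X gradeD[OF v], of "(x \<otimes> y) \<triangleright> b" x "y \<triangleright> b" y] *
    \<rho>_eq[OF X \<rho>_grade[OF X v], of y x] \<rho>_eq[OF X v, of y] \<rho>_eq[OF X v, of "x \<otimes> y"]
  by (simp add: word)

lemma \<rho>_one [simp]:
  assumes "is_rep D X" "v \<in> grade X b" "b \<in> carrier G"
  shows "\<rho> X \<one> v = v"
  using \<rho>_eq[OF assms, of \<one>] assms by simp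

lemma ract_one_grade:
  assumes X: "is_rep D X" and v: "v \<in> carrier_vec (rdim X)" and "a \<in> carrier G"
  shows "ract X (a, \<one>) *\<^sub>v v \<in> grade X a"
  using rep_mult[OF X v, of a \<one> a \<one>] assms rep_carriers[OF X] by (auto intro: gradeI)

lemma separates_grade:
  assumes X: "is_rep D X"
  shows "separates (rdim X) (\<Union>a\<in>carrier G. grade X a)"
proof (rule separatesI[OF _ separates_carrier])
  fix v :: "'k vec" assume v: "v \<in> carrier_vec (rdim X)"
  show "\<exists>(I :: 'a set) f. (\<forall>i\<in>I. f i \<in> (\<Union>a\<in>carrier G. grade X a)) \<and> v = vsum (rdim X) f I"
    using rep_unit[OF X v] ract_one_grade[OF X v]
    by (intro exI[of _ "carrier G"] exI[of _ "\<lambda>g. ract X (g, \<one>) *\<^sub>v v"]) auto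
qed auto

lemma separates_grade_tensor:
  assumes "is_rep D X" "is_rep D Y"
  shows "separates (rdim X * rdim Y)
    {u \<otimes>\<^sub>v w | u w. u \<in> (\<Union>a\<in>carrier G. grade X a) \<and> w \<in> (\<Union>a\<in>carrier G. grade Y a)}"
  by (rule separates_vtensor[OF separates_grade separates_grade]) fact+

lemma act2_vtensor:
  assumes "carriers X" "carriers Y" "v \<in> carrier_vec (rdim X)" "w \<in> carrier_vec (rdim Y)"
  shows "act2 D X Y u *\<^sub>v (v \<otimes>\<^sub>v w) = vsum (rdim X * rdim Y)
    (\<lambda>(b, c). u b c \<cdot>\<^sub>v ((ract X b *\<^sub>v v) \<otimes>\<^sub>v (ract Y c *\<^sub>v w)))
      ((carrier G \<times> carrier G) \<times> (carrier G \<times> carrier G))"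
  using act2_mult_vtensor[of D X Y v w u] assms by auto

lemma act2_carrier [simp]: "act2 H X Y u \<in> carrier_mat (rdim X * rdim Y) (rdim X * rdim Y)"
  by (simp add: act2_def)

lemma rdim_tensor [simp]: "rdim (rep_tensor H X Y) = rdim X * rdim Y"
  by (simp add: rep_tensor_def)

lemma ract_tensor: "ract (rep_tensor H X Y) b = act2 H X Y (qcomult H b)"
  by (simp add: rep_tensor_def)

lemma carriers_tensor [simp]: "carriers (rep_tensor D X Y)"
  by (simp add: carriers_def ract_tensor)

lemma ract_tensor_grade_left:
  assumes X: "is_rep D X" and Y: "is_rep D Y" and u: "u \<in> grade X a" and w: "w \<in> carrier_vec (rdim Y)"
    and *: "a \<in> carrier G" "g \<in> carrier G" "x \<in> carrier G"
  defines "s \<equiv> x \<triangleright> a"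
  shows "ract (rep_tensor D X Y) (g, x) *\<^sub>v (u \<otimes>\<^sub>v w)
    = \<gamma> x s (inv s \<otimes> g) \<cdot>\<^sub>v (\<rho> X x u \<otimes>\<^sub>v (ract Y (inv s \<otimes> g, x) *\<^sub>v w))"
proof -
  let ?F = "\<lambda>(b, c). qcomult D (g, x) b c \<cdot>\<^sub>v ((ract X b *\<^sub>v u) \<otimes>\<^sub>v (ract Y c *\<^sub>v w))"
  note c = rep_carriers[OF X] rep_carriers[OF Y]
  have s: "s \<in> carrier G" using * by (simp add: s_def)
  have dim: "dim_vec (ract Y (t, z) *\<^sub>v w) = rdim Y" if "t \<in> carrier G" "z \<in> carrier G" for t z
    using carrier_vecD[OF carriers_vec[OF c(2) that w]] .
  have dim': "dim_vec (ract X (t, z) *\<^sub>v u) = rdim X" if "t \<in> carrier G" "z \<in> carrier G" for t z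
    using carrier_vecD[OF carriers_vec[OF c(1) that gradeD[OF u]]] .
  have "ract (rep_tensor D X Y) (g, x) *\<^sub>v (u \<otimes>\<^sub>v w) = ?F ((s, x), (inv s \<otimes> g, x))"
    unfolding ract_tensor act2_vtensor[OF c gradeD[OF u] w]
  proof (rule vsum_single)
    fix p assume "p \<in> (carrier G \<times> carrier G) \<times> (carrier G \<times> carrier G)"
      "p \<noteq> ((s, x), (inv s \<otimes> g, x))"
    then obtain t y r z where p: "p = ((t, y), (r, z))" "t \<in> carrier G" "y \<in> carrier G" "r \<in> carrier G" "z \<in> carrier G"
      and ne: "\<not> (t = s \<and> y = x \<and> r = inv s \<otimes> g \<and> z = x)" by auto
    show "?F p = 0\<^sub>v (rdim X * rdim Y)"
    proof (cases "t \<otimes> r = g \<and> y = x \<and> z = x")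
      case True
      hence "t \<noteq> s" using ne p s by auto
      hence "ract X (t, y) *\<^sub>v u = 0\<^sub>v (rdim X)"
        using ract_grade[OF X u, of t y] True p * by (simp add: s_def)
      thus ?thesis using p dim by simp
    next
      case False
      thus ?thesis using p dim dim' by auto
    qed
  next
    show "?F ((s, x), (inv s \<otimes> g, x)) \<in> carrier_vec (rdim X * rdim Y)"
      using s * c w gradeD[OF u] by auto
  qed (use s * in auto)
  thus ?thesis using s * ract_grade[OF X u *(1) s *(3)] by (simp add: s_def[symmetric])
qed

lemma ract_tensor_grade:
  assumes X: "is_rep D X" and Y: "is_rep D Y" and u: "u \<in> grade X a" and w: "w \<in> grade Y b"
    and *: "a \<in> carrier G" "b \<in> carrier G" "g \<in> carrier G" "x \<in> carrier G"
  shows "ract (rep_tensor D X Y) (g, x) *\<^sub>v (u \<otimes>\<^sub>v w)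
    = (if g = x \<triangleright> (a \<otimes> b) then \<gamma> x (x \<triangleright> a) (x \<triangleright> b) \<cdot>\<^sub>v (\<rho> X x u \<otimes>\<^sub>v \<rho> Y x w)
       else 0\<^sub>v (rdim X * rdim Y))"
proof -
  let ?s = "x \<triangleright> a"
  have s: "?s \<in> carrier G" using * by simp
  have eq: "inv ?s \<otimes> g = x \<triangleright> b \<longleftrightarrow> g = x \<triangleright> (a \<otimes> b)"
    using * inv_solve_left'[of "x \<triangleright> b" ?s g] by (auto simp: word)
  show ?thesis
    unfolding ract_tensor_grade_left[OF X Y u gradeD[OF w] *(1,3,4)]
    using ract_grade[OF Y w *(2), of "inv ?s \<otimes> g" x] s * eq carrier_vecD[OF \<rho>_carrier[OF gradeD[OF u]]] by auto
qed

text \<open>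
  The comultiplication is multiplicative by \<open>\<gamma>_\<theta>\<close>.
\<close>

lemma is_rep_tensor [simp]:
  assumes X: "is_rep D X" and Y: "is_rep D Y"
  shows "is_rep D (rep_tensor D X Y)"
proof (rule is_repI[OF carriers_tensor])
  show "separates (rdim (rep_tensor D X Y))
     {u \<otimes>\<^sub>v w | u w. u \<in> (\<Union>a\<in>carrier G. grade X a) \<and> w \<in> (\<Union>a\<in>carrier G. grade Y a)}"
    using separates_grade_tensor[OF X Y] by simp
next
  let ?T = "rep_tensor D X Y"
  fix v assume "v \<in> {u \<otimes>\<^sub>v w | u w. u \<in> (\<Union>a\<in>carrier G. grade X a) \<and> w \<in> (\<Union>a\<in>carrier G. grade Y a)}"
  then obtain a b u w where v: "v = u \<otimes>\<^sub>v w" and u: "u \<in> grade X a" and w: "w \<in> grade Y b"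
    and ab: "a \<in> carrier G" "b \<in> carrier G" by blast
  note R = ract_tensor_grade[OF X Y u w ab]
  have dims: "dim_vec (\<rho> X x u) = rdim X" "dim_vec (\<rho> Y x w) = rdim Y" for x
    using carrier_vecD[OF \<rho>_carrier[OF gradeD[OF u]]] carrier_vecD[OF \<rho>_carrier[OF gradeD[OF w]]] by auto
  have "vsum (rdim ?T) (\<lambda>g. ract ?T (g, \<one>) *\<^sub>v v) (carrier G) = ract ?T (a \<otimes> b, \<one>) *\<^sub>v v"
    by (rule vsum_carrier_single) (use R ab u w v dims X Y in auto)
  thus "vsum (rdim ?T) (\<lambda>g. ract ?T (g, \<one>) *\<^sub>v v) (carrier G) = v"
    using R ab u w v X Y by simp
  fix g x h y assume *: "g \<in> carrier G" "x \<in> carrier G" "h \<in> carrier G" "y \<in> carrier G"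
  show "ract ?T (g, x) *\<^sub>v (ract ?T (h, y) *\<^sub>v v) =
       (if g = x \<triangleright> h then \<theta> g x y \<cdot>\<^sub>v (ract ?T (g, x \<otimes> y) *\<^sub>v v) else 0\<^sub>v (rdim ?T))"
  proof (cases "h = y \<triangleright> (a \<otimes> b)")
    case False
    have "(x \<triangleright> h) \<triangleleft> x = h"
      "((x \<otimes> y) \<triangleright> (a \<otimes> b)) \<triangleleft> x = y \<triangleright> (a \<otimes> b)"
      using ab * by (simp_all add: word)
    hence ne: "g = x \<triangleright> h \<Longrightarrow> g \<noteq> (x \<otimes> y) \<triangleright> (a \<otimes> b)" using False by metis
    have "ract ?T (h, y) *\<^sub>v v = 0\<^sub>v (rdim X * rdim Y)" using False R * v by simp
    moreover have "ract ?T (g, x) *\<^sub>v 0\<^sub>v (rdim X * rdim Y) = 0\<^sub>v (rdim X * rdim Y)"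
      using carriersD[OF carriers_tensor, of g x X Y] * by (intro eq_vecI) auto
    ultimately show ?thesis using ne R[of g "x \<otimes> y"] * ab v by auto
  next
    case True
    let ?a = "y \<triangleright> a" let ?b = "y \<triangleright> b"
    let ?c = "\<gamma> y ?a ?b"
    have 1: "ract ?T (h, y) *\<^sub>v v = ?c \<cdot>\<^sub>v (\<rho> X y u \<otimes>\<^sub>v \<rho> Y y w)"
      using True R * v by simp
    have h: "h = ?a \<otimes> ?b" using True ab * by (simp add: word)
    have "ract ?T (g, x) *\<^sub>v (ract ?T (h, y) *\<^sub>v v) = ?c \<cdot>\<^sub>v (ract ?T (g, x) *\<^sub>v (\<rho> X y u \<otimes>\<^sub>v \<rho> Y y w))"
      unfolding 1 by (rule mult_mat_vec[OF carriersD[OF carriers_tensor]]) (use * u w in simp_all)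
    also have "\<dots> = (if g = x \<triangleright> h then
      ?c \<cdot>\<^sub>v (\<gamma> x (x \<triangleright> ?a) (x \<triangleright> ?b) \<cdot>\<^sub>v (\<rho> X x (\<rho> X y u) \<otimes>\<^sub>v \<rho> Y x (\<rho> Y y w)))
        else 0\<^sub>v (rdim X * rdim Y))"
      using ract_tensor_grade[OF X Y \<rho>_grade[OF X u] \<rho>_grade[OF Y w], of y y g x] ab * h by auto
    also have "\<dots> = (if g = x \<triangleright> h then \<theta> g x y \<cdot>\<^sub>v (ract ?T (g, x \<otimes> y) *\<^sub>v v) else 0\<^sub>v (rdim ?T))"
    proof (cases "g = x \<triangleright> h")
      case g: True
      let ?s = "(x \<otimes> y) \<triangleright> a" let ?t = "(x \<otimes> y) \<triangleright> b"
      have gst: "g = ?s \<otimes> ?t" "g = (x \<otimes> y) \<triangleright> (a \<otimes> b)"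
        using g h ab * by (simp_all add: word)
      have \<gamma>\<theta>: "\<gamma> x ?s ?t * ?c * \<theta> ?s x y * \<theta> ?t x y = \<theta> g x y * \<gamma> (x \<otimes> y) ?s ?t"
        using \<gamma>_\<theta>[of ?s ?t x y] ab * gst by (simp add: word)
      have "?c \<cdot>\<^sub>v (\<gamma> x (x \<triangleright> ?a) (x \<triangleright> ?b) \<cdot>\<^sub>v (\<rho> X x (\<rho> X y u) \<otimes>\<^sub>v \<rho> Y x (\<rho> Y y w)))
        = (\<gamma> x ?s ?t * ?c * \<theta> ?s x y * \<theta> ?t x y) \<cdot>\<^sub>v (\<rho> X (x \<otimes> y) u \<otimes>\<^sub>v \<rho> Y (x \<otimes> y) w)"
        using \<rho>_\<rho>[OF X u ab(1) *(2,4)] \<rho>_\<rho>[OF Y w ab(2) *(2,4)] ab *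
        by (simp add: vtensor_smult smult_smult_assoc word mult_ac)
      also have "\<dots> = \<theta> g x y \<cdot>\<^sub>v (ract ?T (g, x \<otimes> y) *\<^sub>v v)"
        unfolding \<gamma>\<theta> v using R[OF *(1), of "x \<otimes> y"] gst(2) * by (simp add: smult_smult_assoc)
      finally show ?thesis using g by simp
    qed simp
    finally show ?thesis .
  qed
qed

lemma vtensor_grade [simp]:
  assumes "is_rep D X" "is_rep D Y" "u \<in> grade X a" "w \<in> grade Y b" "a \<in> carrier G" "b \<in> carrier G"
  shows "u \<otimes>\<^sub>v w \<in> grade (rep_tensor D X Y) (a \<otimes> b)"
  using ract_tensor_grade[of X Y u a w b "a \<otimes> b" \<one>] assms by (intro gradeI) simp_all

lemma \<rho>_tensor:
  assumes X: "is_rep D X" and Y: "is_rep D Y" and u: "u \<in> grade X a" and w: "w \<in> grade Y b"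
    and *: "a \<in> carrier G" "b \<in> carrier G" "x \<in> carrier G"
  shows "\<rho> (rep_tensor D X Y) x (u \<otimes>\<^sub>v w)
    = \<gamma> x (x \<triangleright> a) (x \<triangleright> b) \<cdot>\<^sub>v (\<rho> X x u \<otimes>\<^sub>v \<rho> Y x w)"
  using \<rho>_eq[of "rep_tensor D X Y" "u \<otimes>\<^sub>v w" "a \<otimes> b" x] assms
    ract_tensor_grade[OF X Y u w *(1,2), of "x \<triangleright> (a \<otimes> b)" x] by simp

lemma rep_assoc_carrier [simp]:
  "rep_assoc H X Y Z \<in> carrier_mat (rdim X * rdim Y * rdim Z) (rdim X * rdim Y * rdim Z)"
  by (simp add: rep_assoc_def act3_def)

lemma rep_assoc_grade:
  assumes X: "is_rep D X" and Y: "is_rep D Y" and Z: "is_rep D Z"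
    and u: "u \<in> grade X a" and v: "v \<in> grade Y b" and w: "w \<in> grade Z c"
    and *: "a \<in> carrier G" "b \<in> carrier G" "c \<in> carrier G"
  shows "rep_assoc D X Y Z *\<^sub>v (u \<otimes>\<^sub>v v \<otimes>\<^sub>v w) = inverse (\<omega> a b c) \<cdot>\<^sub>v (u \<otimes>\<^sub>v v \<otimes>\<^sub>v w)"
proof -
  let ?F = "\<lambda>(p, q, r). qassoc D p q r \<cdot>\<^sub>v ((ract X p *\<^sub>v u) \<otimes>\<^sub>v (ract Y q *\<^sub>v v) \<otimes>\<^sub>v (ract Z r *\<^sub>v w))"
  let ?B = "carrier G \<times> carrier G"
  note cX = rep_carriers[OF X] and cY = rep_carriers[OF Y] and cZ = rep_carriers[OF Z]
  note dims = carrier_vecD[OF carriers_vec[OF cX _ _ gradeD[OF u]]]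
    carrier_vecD[OF carriers_vec[OF cY _ _ gradeD[OF v]]] carrier_vecD[OF carriers_vec[OF cZ _ _ gradeD[OF w]]]
  have "rep_assoc D X Y Z *\<^sub>v (u \<otimes>\<^sub>v v \<otimes>\<^sub>v w) = vsum (rdim X * rdim Y * rdim Z) ?F (?B \<times> ?B \<times> ?B)"
    unfolding rep_assoc_def using act3_mult_vtensor[of D X Y Z u v w "qassoc D"] cX cY cZ u v w by auto
  also have "\<dots> = ?F ((a, \<one>), (b, \<one>), (c, \<one>))"
  proof (rule vsum_single)
    fix z assume zB: "z \<in> ?B \<times> ?B \<times> ?B" and ne: "z \<noteq> ((a, \<one>), (b, \<one>), (c, \<one>))"
    obtain p x q y r t where z: "z = ((p, x), (q, y), (r, t))" by (metis prod.exhaust)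
    have pq: "p \<in> carrier G" "x \<in> carrier G" "q \<in> carrier G" "y \<in> carrier G" "r \<in> carrier G" "t \<in> carrier G"
      using zB z by auto
    show "?F z = 0\<^sub>v (rdim X * rdim Y * rdim Z)"
    proof (cases "x = \<one> \<and> y = \<one> \<and> t = \<one>")
      case True
      thus ?thesis using ne z dims ract_grade[OF X u *(1) pq(1,2)] ract_grade[OF Y v *(2) pq(3,4)]
         ract_grade[OF Z w *(3) pq(5,6)] pq * by auto
    qed (use z dims pq in auto)
  next
    show "?F ((a, \<one>), (b, \<one>), (c, \<one>)) \<in> carrier_vec (rdim X * rdim Y * rdim Z)"
      using * cX cY cZ gradeD[OF u] gradeD[OF v] gradeD[OF w] by auto
  qed (use * in auto)
  finally show ?thesis using u v w by simp
qed

definition basis_index :: "'a \<times> 'a \<Rightarrow> nat" where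
  "basis_index = (SOME f. bij_betw f (carrier G \<times> carrier G) {0..<card (carrier G \<times> carrier G)})"

definition reg_dim :: nat where "reg_dim = card (carrier G \<times> carrier G)"

lemma basis_index: "bij_betw basis_index (carrier G \<times> carrier G) {0..<reg_dim}"
  using someI_ex[OF ex_bij_betw_finite_nat[of "carrier G \<times> carrier G"]]
  by (simp add: basis_index_def reg_dim_def)

lemma basis_index_less [simp]: "g \<in> carrier G \<Longrightarrow> x \<in> carrier G \<Longrightarrow> basis_index (g, x) < reg_dim"
  using bij_betwE[OF basis_index] by auto

lemma basis_index_eq [simp]:
  "g \<in> carrier G \<Longrightarrow> x \<in> carrier G \<Longrightarrow> h \<in> carrier G \<Longrightarrow> y \<in> carrier G \<Longrightarrow>
    basis_index (g, x) = basis_index (h, y) \<longleftrightarrow> g = h \<and> x = y"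
  using inj_on_eq_iff[OF bij_betw_imp_inj_on[OF basis_index], of "(g, x)" "(h, y)"] by auto

definition index_label :: "nat \<Rightarrow> 'a \<times> 'a" where
  "index_label = the_inv_into (carrier G \<times> carrier G) basis_index"

lemma index_label [simp]:
  "g \<in> carrier G \<Longrightarrow> x \<in> carrier G \<Longrightarrow> index_label (basis_index (g, x)) = (g, x)"
  unfolding index_label_def using the_inv_into_f_f[OF bij_betw_imp_inj_on[OF basis_index]] by auto

lemma index_cases:
  assumes "i < reg_dim"
  obtains g x where "g \<in> carrier G" "x \<in> carrier G" "i = basis_index (g, x)"
proof -
  have "i \<in> basis_index ` (carrier G \<times> carrier G)"
    using assms bij_betw_imp_surj_on[OF basis_index] by auto
  thus thesis using that by auto
qed

definition basis_vec :: "'a \<times> 'a \<Rightarrow> 'k vec" where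
  "basis_vec b = unit_vec reg_dim (basis_index b)"

text \<open>
  Left multiplication on the algebra, on the basis \<open>e\<^sub>g # x\<close> in an arbitrary but fixed numbering.
\<close>

definition regular :: "('a \<times> 'a, 'k) rep" where
  "regular = (reg_dim, \<lambda>b. mat reg_dim reg_dim (\<lambda>(i, j). qmult D b (index_label j) (index_label i)))"

lemma rdim_regular [simp]: "rdim regular = reg_dim"
  by (simp add: regular_def)

lemma basis_vec_carrier [simp]: "basis_vec b \<in> carrier_vec reg_dim"
  by (simp add: basis_vec_def)

lemma dim_basis_vec [simp]: "dim_vec (basis_vec b) = reg_dim"
  by (simp add: basis_vec_def)

lemma carriers_regular [simp]: "carriers regular"
  by (simp add: carriers_def regular_def)

lemma regular_act:
  assumes "g \<in> carrier G" "x \<in> carrier G" "h \<in> carrier G" "y \<in> carrier G"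
  shows "ract regular (g, x) *\<^sub>v basis_vec (h, y) =
    (if g = x \<triangleright> h then \<theta> g x y \<cdot>\<^sub>v basis_vec (g, x \<otimes> y) else 0\<^sub>v reg_dim)" (is "_ = ?r")
proof (rule eq_vecI)
  have d: "dim_vec ?r = reg_dim" by simp
  thus "dim_vec (ract regular (g, x) *\<^sub>v basis_vec (h, y)) = dim_vec ?r" by (simp add: regular_def)
  fix i assume "i < dim_vec ?r"
  hence i: "i < reg_dim" by (simp add: d)
  then obtain l z where l: "l \<in> carrier G" "z \<in> carrier G" "i = basis_index (l, z)" by (rule index_cases)
  have "(ract regular (g, x) *\<^sub>v basis_vec (h, y)) $ i = qmult D (g, x) (h, y) (l, z)"
    using l assms i by (simp add: regular_def basis_vec_def)
  thus "(ract regular (g, x) *\<^sub>v basis_vec (h, y)) $ i = ?r $ i"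
    using l assms by (auto simp: basis_vec_def)
qed

lemma separates_basis: "separates reg_dim (basis_vec ` (carrier G \<times> carrier G))"
proof -
  have "basis_vec ` (carrier G \<times> carrier G) = unit_vec reg_dim ` {0..<reg_dim}"
    unfolding basis_vec_def bij_betw_imp_surj_on[OF basis_index, symmetric] image_image ..
  thus ?thesis using separates_unit by simp
qed

lemma is_rep_regular [simp]: "is_rep D regular"
proof (rule is_repI[OF carriers_regular])
  show "separates (rdim regular) (basis_vec ` (carrier G \<times> carrier G))" using separates_basis by simp
  fix v assume "v \<in> basis_vec ` (carrier G \<times> carrier G)"
  then obtain l z where v: "v = basis_vec (l, z)" and l: "l \<in> carrier G" "z \<in> carrier G" by auto
  have "vsum reg_dim (\<lambda>g. ract regular (g, \<one>) *\<^sub>v v) (carrier G) = ract regular (l, \<one>) *\<^sub>v v"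
    by (rule vsum_carrier_single) (use l v in \<open>auto simp: regular_act\<close>)
  thus "vsum (rdim regular) (\<lambda>g. ract regular (g, \<one>) *\<^sub>v v) (carrier G) = v"
    using l v by (simp add: regular_act)
  fix g x h y assume *: "g \<in> carrier G" "x \<in> carrier G" "h \<in> carrier G" "y \<in> carrier G"
  have "ract regular (g, x) *\<^sub>v (c \<cdot>\<^sub>v basis_vec (h, w)) = c \<cdot>\<^sub>v (ract regular (g, x) *\<^sub>v basis_vec (h, w))" for c w
    by (rule mult_mat_vec[OF carriersD[OF carriers_regular *(1,2)]]) simp
  moreover have "ract regular (g, x) *\<^sub>v 0\<^sub>v reg_dim = 0\<^sub>v reg_dim"
    using mult_mat_vec_zero[OF carriersD[OF carriers_regular *(1,2)]] by simp
  moreover have "\<theta> g x y * \<theta> g (x \<otimes> y) z = \<theta> h y z * \<theta> g x (y \<otimes> z)" if "g = x \<triangleright> h"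
    using \<theta>_cocycle[of g x y z] * l that by (simp add: word)
  moreover have "g = x \<triangleright> h \<Longrightarrow> h = y \<triangleright> l \<longleftrightarrow> g = (x \<otimes> y) \<triangleright> l"
  proof -
    have "(x \<triangleright> h) \<triangleleft> x = h"
      "((x \<otimes> y) \<triangleright> l) \<triangleleft> x = y \<triangleright> l"
      "x \<triangleright> (y \<triangleright> l) = (x \<otimes> y) \<triangleright> l"
      using l * by (simp_all add: word)
    thus "g = x \<triangleright> h \<Longrightarrow> h = y \<triangleright> l \<longleftrightarrow> g = (x \<otimes> y) \<triangleright> l" by metis
  qed
  ultimately show "ract regular (g, x) *\<^sub>v (ract regular (h, y) *\<^sub>v v) =
       (if g = x \<triangleright> h then \<theta> g x y \<cdot>\<^sub>v (ract regular (g, x \<otimes> y) *\<^sub>v v) else 0\<^sub>v (rdim regular))"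
    using regular_act[OF *(3,4) l] regular_act[OF *(1-3) m_closed[OF *(4) l(2)]]
      regular_act[OF *(1) m_closed[OF *(2,4)] l] m_assoc[OF *(2,4) l(2)]
    unfolding v rdim_regular
    by (cases "h = y \<triangleright> l"; cases "g = x \<triangleright> h")
       (simp_all add: smult_smult_assoc)
qed

lemma basis_vec_grade [simp]:
  "g \<in> carrier G \<Longrightarrow> x \<in> carrier G \<Longrightarrow> basis_vec (g, x) \<in> grade regular g"
  by (intro gradeI) (simp_all add: regular_act)

lemma \<rho>_regular:
  "h \<in> carrier G \<Longrightarrow> x \<in> carrier G \<Longrightarrow> y \<in> carrier G \<Longrightarrow>
    \<rho> regular x (basis_vec (h, y)) = \<theta> (x \<triangleright> h) x y \<cdot>\<^sub>v basis_vec (x \<triangleright> h, x \<otimes> y)"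
  by (simp add: \<rho>_eq[of regular _ h] regular_act)

definition one_vec :: "'k vec" where
  "one_vec = vsum reg_dim (\<lambda>g. basis_vec (g, \<one>)) (carrier G)"

text \<open>
  The homomorphism from the regular representation that sends the unit to \<open>\<xi>\<close>.
\<close>

definition orbit_mat :: "('a \<times> 'a, 'k) rep \<Rightarrow> 'k vec \<Rightarrow> 'k mat" where
  "orbit_mat X \<xi> = mat (rdim X) reg_dim (\<lambda>(i, j). (ract X (index_label j) *\<^sub>v \<xi>) $ i)"

lemma orbit_mat_carrier [simp]: "orbit_mat X \<xi> \<in> carrier_mat (rdim X) reg_dim"
  by (simp add: orbit_mat_def)

lemma orbit_mat_basis_vec:
  assumes "carriers X" "\<xi> \<in> carrier_vec (rdim X)" "g \<in> carrier G" "x \<in> carrier G"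
  shows "orbit_mat X \<xi> *\<^sub>v basis_vec (g, x) = ract X (g, x) *\<^sub>v \<xi>"
  using assms carrier_vecD[OF carriers_vec[OF assms(1,3,4,2)]]
  by (intro eq_vecI) (auto simp: orbit_mat_def basis_vec_def)

lemma one_vec_carrier [simp]: "one_vec \<in> carrier_vec reg_dim"
  by (simp add: one_vec_def)

lemma orbit_mat_one_vec:
  assumes "is_rep D X" "\<xi> \<in> carrier_vec (rdim X)"
  shows "orbit_mat X \<xi> *\<^sub>v one_vec = \<xi>"
proof -
  have "orbit_mat X \<xi> *\<^sub>v one_vec = vsum (rdim X) (\<lambda>g. orbit_mat X \<xi> *\<^sub>v basis_vec (g, \<one>)) (carrier G)"
    unfolding one_vec_def by (rule vsum_image_under) simp_all
  also have "\<dots> = vsum (rdim X) (\<lambda>g. ract X (g, \<one>) *\<^sub>v \<xi>) (carrier G)"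
    using assms rep_carriers by (intro vsum_cong orbit_mat_basis_vec) auto
  finally show ?thesis using rep_unit[OF assms] by simp
qed

lemma orbit_mat_hom:
  assumes X: "is_rep D X" and \<xi>: "\<xi> \<in> carrier_vec (rdim X)"
  shows "orbit_mat X \<xi> \<in> rep_hom D regular X"
  unfolding rep_hom_def
proof (intro CollectI conjI ballI)
  show "orbit_mat X \<xi> \<in> carrier_mat (rdim X) (rdim regular)" by simp
  fix b assume "b \<in> qbasis D"
  then obtain g x where b: "b = (g, x)" "g \<in> carrier G" "x \<in> carrier G" by auto
  note c = rep_carriers[OF X]
  note R = carriersD[OF carriers_regular b(2,3), unfolded rdim_regular] and RX = carriersD[OF c b(2,3)]
  show "orbit_mat X \<xi> * ract regular b = ract X b * orbit_mat X \<xi>" unfolding b(1)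
  proof (rule separatesD[OF separates_basis mult_carrier_mat[OF orbit_mat_carrier R] mult_carrier_mat[OF RX orbit_mat_carrier]])
    fix s assume "s \<in> basis_vec ` (carrier G \<times> carrier G)"
    then obtain h y where s: "s = basis_vec (h, y)" "h \<in> carrier G" "y \<in> carrier G" by auto
    have "orbit_mat X \<xi> *\<^sub>v (ract regular (g, x) *\<^sub>v s) = ract X (g, x) *\<^sub>v (orbit_mat X \<xi> *\<^sub>v s)"
      using s b mult_mat_vec[OF orbit_mat_carrier[of X \<xi>] basis_vec_carrier] mult_mat_vec_zero[OF orbit_mat_carrier[of X \<xi>]]
      by (simp add: regular_act orbit_mat_basis_vec[OF c \<xi>] rep_mult[OF X \<xi>])
    thus "orbit_mat X \<xi> * ract regular (g, x) *\<^sub>v s = ract X (g, x) * orbit_mat X \<xi> *\<^sub>v s"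
      using assoc_mult_mat_vec[OF orbit_mat_carrier[of X \<xi>] R] assoc_mult_mat_vec[OF RX orbit_mat_carrier[of X \<xi>]]
        s by simp
  qed
qed

text \<open>
  The coefficient of a basis vector of the regular representation in a tensor product with it.
\<close>

definition coef :: "nat \<Rightarrow> 'a \<times> 'a \<Rightarrow> 'k vec \<Rightarrow> 'k vec" where
  "coef n b z = block n (basis_index b) z"

lemma coef_carrier [simp]: "coef n b z \<in> carrier_vec n"
  by (simp add: coef_def)

lemma coef_basis_vec [simp]:
  assumes "g \<in> carrier G" "x \<in> carrier G" "h \<in> carrier G" "y \<in> carrier G" "w \<in> carrier_vec n"
  shows "coef n (g, x) (basis_vec (h, y) \<otimes>\<^sub>v w) = (if g = h \<and> x = y then w else 0\<^sub>v n)"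
  unfolding coef_def using assms by (subst block_vtensor) (auto simp: basis_vec_def)

lemma coef_vsum:
  assumes "g \<in> carrier G" "x \<in> carrier G" "\<And>a. a \<in> A \<Longrightarrow> f a \<in> carrier_vec (reg_dim * n)"
  shows "coef n (g, x) (vsum (reg_dim * n) f A) = vsum n (\<lambda>a. coef n (g, x) (f a)) A"
  unfolding coef_def using assms by (intro block_vsum) auto

lemma coef_smult:
  assumes "g \<in> carrier G" "x \<in> carrier G" "z \<in> carrier_vec (reg_dim * n)"
  shows "coef n (g, x) (c \<cdot>\<^sub>v z) = c \<cdot>\<^sub>v coef n (g, x) z"
  unfolding coef_def using assms by (intro block_smult) auto

text \<open>
  Vectors in a tensor product with the regular representation are compared coefficient by
  coefficient; here the basis vectors that occur are distinguished by their second label.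
\<close>

lemma coef_vsum_basis_vec:
  assumes f: "\<And>y. y \<in> carrier G \<Longrightarrow> f y \<in> carrier_vec n" and h: "\<And>y. y \<in> carrier G \<Longrightarrow> h y \<in> carrier G"
    and k: "\<And>y. y \<in> carrier G \<Longrightarrow> k y \<in> carrier G" "inj_on k (carrier G)" and x: "x \<in> carrier G"
  shows "coef n (h x, k x) (vsum (reg_dim * n) (\<lambda>y. basis_vec (h y, k y) \<otimes>\<^sub>v f y) (carrier G)) = f x"
proof -
  have "coef n (h x, k x) (vsum (reg_dim * n) (\<lambda>y. basis_vec (h y, k y) \<otimes>\<^sub>v f y) (carrier G))
    = vsum n (\<lambda>y. coef n (h x, k x) (basis_vec (h y, k y) \<otimes>\<^sub>v f y)) (carrier G)"
    by (rule coef_vsum) (use assms in auto)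
  also have "\<dots> = coef n (h x, k x) (basis_vec (h x, k x) \<otimes>\<^sub>v f x)"
    by (rule vsum_carrier_single) (use assms in \<open>auto simp: inj_on_eq_iff[OF k(2)]\<close>)
  finally show ?thesis using assms by simp
qed

lemma vec_eq_vsum_coef:
  assumes "z \<in> carrier_vec (reg_dim * n)"
  shows "z = vsum (reg_dim * n) (\<lambda>b. basis_vec b \<otimes>\<^sub>v coef n b z) (carrier G \<times> carrier G)"
proof -
  have "z = vsum (reg_dim * n) (\<lambda>i. unit_vec reg_dim i \<otimes>\<^sub>v block n i z) (basis_index ` (carrier G \<times> carrier G))"
    using vec_eq_vsum_blocks[OF assms] by (simp add: bij_betw_imp_surj_on[OF basis_index])
  thus ?thesis
    by (simp add: vsum_reindex[OF bij_betw_imp_inj_on[OF basis_index]] basis_vec_def coef_def)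
qed

end

section \<open>Objects of the center as twisted bimodules\<close>

locale center_object = finite_cocycle3_group G \<omega>
  for G :: "('a, 'm) monoid_scheme" (structure) and \<omega> :: "'a \<Rightarrow> 'a \<Rightarrow> 'a \<Rightarrow> 'k::field" +
  fixes V :: "('a \<times> 'a, 'k) rep" and e :: "('a \<times> 'a, 'k) rep \<Rightarrow> 'k mat"
  assumes rep_V: "is_rep (twisted_double G \<omega>) V"
    and half_braiding: "half_braiding (twisted_double G \<omega>) V e"
begin

abbreviation n where "n \<equiv> rdim V"

lemma e_hom: "is_rep D X \<Longrightarrow> e X \<in> rep_hom D (rep_tensor D V X) (rep_tensor D X V)"
  and e_invertible: "is_rep D X \<Longrightarrow> invertible_mat (e X)"
  and e_natural: "is_rep D X \<Longrightarrow> is_rep D Y \<Longrightarrow> f \<in> rep_hom D X Y \<Longrightarrow>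
      e Y * kron (1\<^sub>m n) f = kron f (1\<^sub>m n) * e X"
  and e_hexagon: "is_rep D X \<Longrightarrow> is_rep D Y \<Longrightarrow>
      rep_assoc D X Y V * e (rep_tensor D X Y) * rep_assoc D V X Y =
      kron (1\<^sub>m (rdim X)) (e Y) * rep_assoc D X V Y * kron (e X) (1\<^sub>m (rdim Y))"
  using half_braiding unfolding half_braiding_def by blast+

lemma e_carrier [simp]: "is_rep D X \<Longrightarrow> e X \<in> carrier_mat (rdim X * n) (n * rdim X)"
  using e_hom by (auto simp: rep_hom_def)

text \<open>
  The value of the half-braiding at \<open>v \<otimes> 1\<close> in the regular representation is the sum of
  \<open>b \<otimes> E b v\<close> over the basis elements \<open>b\<close> of the algebra.
\<close>

definition E :: "'a \<times> 'a \<Rightarrow> 'k vec \<Rightarrow> 'k vec" where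
  "E b v = coef n b (e regular *\<^sub>v (v \<otimes>\<^sub>v one_vec))"

lemma E_carrier [simp]: "E b v \<in> carrier_vec n"
  by (simp add: E_def)

lemma dim_E [simp]: "dim_vec (E b v) = n"
  using E_carrier carrier_vecD by blast

lemma e_regular_carrier: "e regular \<in> carrier_mat (reg_dim * n) (n * reg_dim)"
  using e_carrier[OF is_rep_regular] by simp

lemma E_smult:
  assumes "g \<in> carrier G" "x \<in> carrier G" "v \<in> carrier_vec n"
  shows "E (g, x) (c \<cdot>\<^sub>v v) = c \<cdot>\<^sub>v E (g, x) v"
proof -
  have "e regular *\<^sub>v (c \<cdot>\<^sub>v v \<otimes>\<^sub>v one_vec) = c \<cdot>\<^sub>v (e regular *\<^sub>v (v \<otimes>\<^sub>v one_vec))"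
    unfolding vtensor_smult by (rule mult_mat_vec[OF e_regular_carrier]) (use assms in simp)
  thus ?thesis unfolding E_def using assms
    by (simp add: coef_smult mult_mat_vec_carrier[OF e_regular_carrier])
qed

lemma E_vsum:
  assumes "g \<in> carrier G" "x \<in> carrier G" "\<And>a. a \<in> A \<Longrightarrow> f a \<in> carrier_vec n"
  shows "E (g, x) (vsum n f A) = vsum n (\<lambda>a. E (g, x) (f a)) A"
proof -
  have "e regular *\<^sub>v (vsum n f A \<otimes>\<^sub>v one_vec) = e regular *\<^sub>v vsum (n * reg_dim) (\<lambda>a. f a \<otimes>\<^sub>v one_vec) A"
    by (subst vtensor_vsum) (use assms in auto)
  also have "\<dots> = vsum (reg_dim * n) (\<lambda>a. e regular *\<^sub>v (f a \<otimes>\<^sub>v one_vec)) A"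
    by (rule vsum_image_under) (use assms e_regular_carrier in auto)
  finally show ?thesis unfolding E_def using assms
    by (simp add: coef_vsum mult_mat_vec_carrier[OF e_regular_carrier])
qed

text \<open>
  Naturality with respect to \<open>orbit_mat X \<xi>\<close> transports the value at the regular representation to
  all representations.
\<close>

lemma e_apply:
  assumes X: "is_rep D X" and v: "v \<in> carrier_vec n" and \<xi>: "\<xi> \<in> carrier_vec (rdim X)"
  shows "e X *\<^sub>v (v \<otimes>\<^sub>v \<xi>) = vsum (rdim X * n) (\<lambda>b. (ract X b *\<^sub>v \<xi>) \<otimes>\<^sub>v E b v) (carrier G \<times> carrier G)"
proof -
  let ?f = "orbit_mat X \<xi>" and ?B = "carrier G \<times> carrier G"
  have f: "?f \<in> carrier_mat (rdim X) reg_dim" and one: "1\<^sub>m n \<in> carrier_mat n n" by auto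
  note eR = e_regular_carrier and eX = e_carrier[OF X]
  have "e X *\<^sub>v (v \<otimes>\<^sub>v \<xi>) = e X *\<^sub>v (kron (1\<^sub>m n) ?f *\<^sub>v (v \<otimes>\<^sub>v one_vec))"
    using kron_mult_vtensor[OF one f v one_vec_carrier] orbit_mat_one_vec[OF X \<xi>] v by simp
  also have "\<dots> = e X * kron (1\<^sub>m n) ?f *\<^sub>v (v \<otimes>\<^sub>v one_vec)"
    using assoc_mult_mat_vec[OF eX kron_carrier[OF one f]] v by simp
  also have "\<dots> = kron ?f (1\<^sub>m n) *\<^sub>v (e regular *\<^sub>v (v \<otimes>\<^sub>v one_vec))"
    unfolding e_natural[OF is_rep_regular X orbit_mat_hom[OF X \<xi>]]
    using assoc_mult_mat_vec[OF kron_carrier[OF f one] eR] v by simp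
  also have "\<dots> = kron ?f (1\<^sub>m n) *\<^sub>v vsum (reg_dim * n) (\<lambda>b. basis_vec b \<otimes>\<^sub>v E b v) ?B"
    unfolding E_def by (subst vec_eq_vsum_coef) (simp_all add: mult_mat_vec_carrier[OF eR] v)
  also have "\<dots> = vsum (rdim X * n) (\<lambda>b. kron ?f (1\<^sub>m n) *\<^sub>v (basis_vec b \<otimes>\<^sub>v E b v)) ?B"
    by (rule vsum_image_under) (simp_all add: kron_carrier[OF f one])
  also have "\<dots> = vsum (rdim X * n) (\<lambda>b. (ract X b *\<^sub>v \<xi>) \<otimes>\<^sub>v E b v) ?B"
    by (rule vsum_cong)
      (use orbit_mat_basis_vec[OF rep_carriers[OF X] \<xi>] kron_mult_vtensor[OF f one basis_vec_carrier E_carrier] in auto)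
  finally show ?thesis .
qed

text \<open>
  Only the basis elements \<open>e\<^sub>g # x\<close> with \<open>g\<close> conjugate to \<open>b\<close> by \<open>x\<close> act on \<open>\<xi>\<close>, so the sum runs
  over \<open>x\<close> alone.
\<close>

lemma e_apply_grade:
  assumes X: "is_rep D X" and v: "v \<in> carrier_vec n" and \<xi>: "\<xi> \<in> grade X b" and b: "b \<in> carrier G"
  shows "e X *\<^sub>v (v \<otimes>\<^sub>v \<xi>) = vsum (rdim X * n) (\<lambda>x. \<rho> X x \<xi> \<otimes>\<^sub>v E (x \<triangleright> b, x) v) (carrier G)"
proof -
  let ?F = "\<lambda>b. (ract X b *\<^sub>v \<xi>) \<otimes>\<^sub>v E b v" and ?h = "\<lambda>x. (x \<triangleright> b, x)"
  have "vsum (rdim X * n) ?F (carrier G \<times> carrier G) = vsum (rdim X * n) ?F (?h ` carrier G)"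
    by (rule vsum_support) (use b ract_grade[OF X \<xi> b] in \<open>auto simp: image_iff\<close>)
  also have "\<dots> = vsum (rdim X * n) (\<lambda>x. ?F (?h x)) (carrier G)"
    by (rule vsum_reindex) (auto simp: inj_on_def)
  also have "\<dots> = vsum (rdim X * n) (\<lambda>x. \<rho> X x \<xi> \<otimes>\<^sub>v E (?h x) v) (carrier G)"
    by (rule vsum_cong) (use b \<rho>_eq[OF X \<xi> b] in auto)
  finally show ?thesis unfolding e_apply[OF X v gradeD[OF \<xi>]] .
qed

lemma e_basis_vec:
  assumes "v \<in> carrier_vec n" "b \<in> carrier G"
  shows "e regular *\<^sub>v (v \<otimes>\<^sub>v basis_vec (b, \<one>))
    = vsum (reg_dim * n) (\<lambda>x. basis_vec (x \<triangleright> b, x) \<otimes>\<^sub>v E (x \<triangleright> b, x) v) (carrier G)"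
  unfolding e_apply_grade[OF is_rep_regular assms(1) basis_vec_grade[OF assms(2) one_closed] assms(2)]
  using assms by (auto intro!: vsum_cong simp: \<rho>_regular)

lemma coef_e_basis_vec:
  assumes "v \<in> carrier_vec n" "b \<in> carrier G" "x \<in> carrier G"
  shows "coef n (x \<triangleright> b, x) (e regular *\<^sub>v (v \<otimes>\<^sub>v basis_vec (b, \<one>))) = E (x \<triangleright> b, x) v"
  unfolding e_basis_vec[OF assms(1,2)]
  by (rule coef_vsum_basis_vec[where h = "\<lambda>x. x \<triangleright> b" and k = "\<lambda>x. x"]) (use assms in auto)

lemma e_equivariant:
  assumes X: "is_rep D X" and z: "z \<in> carrier_vec (n * rdim X)" and "g \<in> carrier G" "y \<in> carrier G"
  shows "e X *\<^sub>v (ract (rep_tensor D V X) (g, y) *\<^sub>v z) = ract (rep_tensor D X V) (g, y) *\<^sub>v (e X *\<^sub>v z)"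
proof -
  have "e X * ract (rep_tensor D V X) (g, y) = ract (rep_tensor D X V) (g, y) * e X"
    using e_hom[OF X] assms by (auto simp: rep_hom_def)
  thus ?thesis
    using assoc_mult_mat_vec[OF e_carrier[OF X] carriersD[OF carriers_tensor, of g y V X, unfolded rdim_tensor] z]
      assoc_mult_mat_vec[OF carriersD[OF carriers_tensor, of g y X V, unfolded rdim_tensor] e_carrier[OF X] z] assms by simp
qed

text \<open>
  The half-braiding preserves the total degree.
\<close>

lemma E_grade:
  assumes v: "v \<in> grade V a" and *: "a \<in> carrier G" "b \<in> carrier G" "x \<in> carrier G"
  shows "E (x \<triangleright> b, x) v \<in> grade V (x \<otimes> inv b \<otimes> inv x \<otimes> a \<otimes> b)"
proof (rule gradeI)
  let ?T = "rep_tensor D V regular" and ?T' = "rep_tensor D regular V"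
  let ?B = "\<lambda>x. x \<triangleright> b"
  have "v \<otimes>\<^sub>v basis_vec (b, \<one>) \<in> grade ?T (a \<otimes> b)"
    by (rule vtensor_grade) (use rep_V v * in auto)
  hence "e regular *\<^sub>v (v \<otimes>\<^sub>v basis_vec (b, \<one>))
    = ract ?T' (a \<otimes> b, \<one>) *\<^sub>v (e regular *\<^sub>v (v \<otimes>\<^sub>v basis_vec (b, \<one>)))"
    using e_equivariant[OF is_rep_regular, of "v \<otimes>\<^sub>v basis_vec (b, \<one>)" "a \<otimes> b" \<one>] v * by simp
  also have "\<dots> = vsum (reg_dim * n) (\<lambda>x. ract ?T' (a \<otimes> b, \<one>) *\<^sub>v (basis_vec (?B x, x) \<otimes>\<^sub>v E (?B x, x) v)) (carrier G)"
    unfolding e_basis_vec[OF gradeD[OF v] *(2)]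
    by (rule vsum_image_under) (use carriersD[OF carriers_tensor, of _ _ regular V] * in auto)
  also have "\<dots> = vsum (reg_dim * n) (\<lambda>x. basis_vec (?B x, x) \<otimes>\<^sub>v (ract V (inv (?B x) \<otimes> (a \<otimes> b), \<one>) *\<^sub>v E (?B x, x) v)) (carrier G)"
    by (rule vsum_cong)
      (use ract_tensor_grade_left[OF is_rep_regular rep_V basis_vec_grade E_carrier] rep_V * in \<open>auto simp: \<rho>_regular\<close>)
  finally have "coef n (?B x, x) (e regular *\<^sub>v (v \<otimes>\<^sub>v basis_vec (b, \<one>)))
    = ract V (inv (?B x) \<otimes> (a \<otimes> b), \<one>) *\<^sub>v E (?B x, x) v"
    using coef_vsum_basis_vec[of "\<lambda>x. ract V (inv (?B x) \<otimes> (a \<otimes> b), \<one>) *\<^sub>v E (?B x, x) v" n ?B "\<lambda>x. x" x] *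
    by (simp add: carriers_vec[OF rep_carriers[OF rep_V]])
  hence "ract V (inv (?B x) \<otimes> (a \<otimes> b), \<one>) *\<^sub>v E (?B x, x) v = E (?B x, x) v"
    by (simp only: coef_e_basis_vec[OF gradeD[OF v] *(2,3)])
  thus "ract V (x \<otimes> inv b \<otimes> inv x \<otimes> a \<otimes> b, \<one>) *\<^sub>v E (?B x, x) v = E (?B x, x) v"
    using * by (simp add: word)
qed simp

text \<open>
  The half-braiding at the regular representation commutes with the action of \<open>y\<close> on the tensor
  product; coefficients at \<open>e # (y \<otimes> x)\<close> are compared.
\<close>

lemma E_\<rho>:
  assumes v: "v \<in> grade V a" and *: "a \<in> carrier G" "b \<in> carrier G" "x \<in> carrier G" "y \<in> carrier G"
  defines "B \<equiv> x \<triangleright> b"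
  shows "(\<gamma> y (y \<triangleright> a) (y \<triangleright> b) * \<theta> (y \<triangleright> B) (y \<triangleright> x) y)
      \<cdot>\<^sub>v E (y \<triangleright> B, y \<triangleright> x) (\<rho> V y v)
    = (\<gamma> y (y \<triangleright> B) (y \<triangleright> (x \<otimes> inv b \<otimes> inv x \<otimes> a \<otimes> b)) * \<theta> (y \<triangleright> B) y x)
      \<cdot>\<^sub>v \<rho> V y (E (B, x) v)"
proof -
  let ?T = "rep_tensor D V regular" and ?T' = "rep_tensor D regular V"
  let ?g = "y \<triangleright> (a \<otimes> b)" let ?c = "\<gamma> y (y \<triangleright> a) (y \<triangleright> b)"
  let ?B = "\<lambda>x. x \<triangleright> b" let ?yb = "y \<triangleright> b"
  let ?z = "v \<otimes>\<^sub>v basis_vec (b, \<one>)"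
  let ?h = "\<lambda>w. w \<triangleright> ?yb"
  note R = is_rep_regular
  have \<rho>v: "\<rho> V y v \<in> carrier_vec n" using v by simp
  have z: "?z \<in> carrier_vec (n * reg_dim)" using v by simp
  have lhs: "ract ?T (?g, y) *\<^sub>v ?z = ?c \<cdot>\<^sub>v (\<rho> V y v \<otimes>\<^sub>v basis_vec (?yb, y))"
    using ract_tensor_grade[OF rep_V R v basis_vec_grade *(1,2), of \<one> ?g y] * by (simp add: \<rho>_regular)
  define f where "f w = (?c * \<theta> (?h w) w y) \<cdot>\<^sub>v E (?h w, w) (\<rho> V y v)" for w
  have "e regular *\<^sub>v (ract ?T (?g, y) *\<^sub>v ?z) = ?c \<cdot>\<^sub>v (e regular *\<^sub>v (\<rho> V y v \<otimes>\<^sub>v basis_vec (?yb, y)))"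
    unfolding lhs by (rule mult_mat_vec[OF e_regular_carrier]) (use v in simp)
  also have "\<dots> = ?c \<cdot>\<^sub>v vsum (reg_dim * n) (\<lambda>w. \<rho> regular w (basis_vec (?yb, y)) \<otimes>\<^sub>v E (?h w, w) (\<rho> V y v)) (carrier G)"
    using e_apply_grade[OF R \<rho>v basis_vec_grade, of ?yb y] * by simp
  also have "\<dots> = vsum (reg_dim * n) (\<lambda>w. basis_vec (?h w, w \<otimes> y) \<otimes>\<^sub>v f w) (carrier G)"
    by (subst smult_vsum) (use * in \<open>auto intro!: vsum_cong simp: \<rho>_regular f_def vtensor_smult smult_smult_assoc\<close>)
  finally have L: "e regular *\<^sub>v (ract ?T (?g, y) *\<^sub>v ?z) = \<dots>" .
  define f' where "f' w = (\<gamma> y (y \<triangleright> ?B w) (y \<triangleright> (w \<otimes> inv b \<otimes> inv w \<otimes> a \<otimes> b)) * \<theta> (y \<triangleright> ?B w) y w)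
      \<cdot>\<^sub>v \<rho> V y (E (?B w, w) v)" for w
  have "ract ?T' (?g, y) *\<^sub>v (e regular *\<^sub>v ?z) = vsum (reg_dim * n) (\<lambda>w. ract ?T' (?g, y) *\<^sub>v (basis_vec (?B w, w) \<otimes>\<^sub>v E (?B w, w) v)) (carrier G)"
    unfolding e_basis_vec[OF gradeD[OF v] *(2)]
    by (rule vsum_image_under) (use carriersD[OF carriers_tensor, of _ _ regular V] * in auto)
  also have "\<dots> = vsum (reg_dim * n) (\<lambda>w. basis_vec (y \<triangleright> ?B w, y \<otimes> w) \<otimes>\<^sub>v f' w) (carrier G)"
  proof (rule vsum_cong)
    fix w assume w: "w \<in> carrier G"
    have "?g = y \<triangleright> (?B w \<otimes> (w \<otimes> inv b \<otimes> inv w \<otimes> a \<otimes> b))" using w * by (simp add: word)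
    thus "ract ?T' (?g, y) *\<^sub>v (basis_vec (?B w, w) \<otimes>\<^sub>v E (?B w, w) v) = basis_vec (y \<triangleright> ?B w, y \<otimes> w) \<otimes>\<^sub>v f' w"
      using ract_tensor_grade[OF R rep_V basis_vec_grade E_grade[OF v *(1,2)], of "?B w" w w ?g y] w *
      by (simp add: \<rho>_regular f'_def vtensor_smult smult_smult_assoc)
  qed
  finally have Rr: "ract ?T' (?g, y) *\<^sub>v (e regular *\<^sub>v ?z) = \<dots>" .
  let ?x = "y \<triangleright> x"
  have c1: "coef n (?h ?x, ?x \<otimes> y) (vsum (reg_dim * n) (\<lambda>w. basis_vec (?h w, w \<otimes> y) \<otimes>\<^sub>v f w) (carrier G)) = f ?x"
    by (rule coef_vsum_basis_vec[where h = ?h and k = "\<lambda>w. w \<otimes> y"]) (use * in \<open>auto simp: f_def inj_on_def\<close>)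
  have c2: "coef n (y \<triangleright> ?B x, y \<otimes> x) (vsum (reg_dim * n) (\<lambda>w. basis_vec (y \<triangleright> ?B w, y \<otimes> w) \<otimes>\<^sub>v f' w) (carrier G)) = f' x"
    by (rule coef_vsum_basis_vec[where h = "\<lambda>w. y \<triangleright> ?B w" and k = "\<lambda>w. y \<otimes> w"]) (use * in \<open>auto simp: f'_def inj_on_def\<close>)
  have hx: "?h ?x = y \<triangleright> ?B x" "?x \<otimes> y = y \<otimes> x" using * by (simp_all add: word)
  have "f ?x = f' x"
    using c1 c2 L Rr e_equivariant[OF R, of ?z ?g y] z * unfolding hx by simp
  thus ?thesis unfolding f_def f'_def hx B_def .
qed

text \<open>
  This is the hexagon at two copies of the regular representation. In a tensor product an element
  acts on both factors through the same \<open>x\<close>, so products of operators \<open>E\<close> with different second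
  labels vanish.
\<close>

lemma E_E:
  assumes v: "v \<in> grade V a" and *: "a \<in> carrier G" "b \<in> carrier G" "b' \<in> carrier G" "x \<in> carrier G" "y \<in> carrier G"
  shows "E (y \<triangleright> b', y) (E (x \<triangleright> b, x) v)
    = (if x = y then hex a x b b' \<cdot>\<^sub>v E (x \<triangleright> (b \<otimes> b'), x) v else 0\<^sub>v n)"
proof -
  let ?m = reg_dim
  let ?T = "rep_tensor D regular regular"
  let ?B = "\<lambda>x. x \<triangleright> b" and ?B' = "\<lambda>x. x \<triangleright> b'"
  let ?a1 = "\<lambda>x. x \<otimes> inv b \<otimes> inv x \<otimes> a \<otimes> b" and ?a2 = "\<lambda>x. x \<otimes> inv b' \<otimes> inv b \<otimes> inv x \<otimes> a \<otimes> b \<otimes> b'"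
  let ?u = "basis_vec (b, \<one>)" and ?u' = "basis_vec (b', \<one>)"
  let ?z = "v \<otimes>\<^sub>v ?u \<otimes>\<^sub>v ?u'"
  note R = is_rep_regular
  have z: "?z \<in> carrier_vec (n * ?m * ?m)" using v by simp
  have eT: "e ?T \<in> carrier_mat (?m * ?m * n) (n * ?m * ?m)"
    using e_carrier[OF is_rep_tensor[OF R R]] by (simp add: mult.assoc)
  have aV: "rep_assoc D V regular regular \<in> carrier_mat (n * ?m * ?m) (n * ?m * ?m)"
    using rep_assoc_carrier[of D V regular regular] by simp
  have aL: "rep_assoc D regular regular V \<in> carrier_mat (?m * ?m * n) (?m * ?m * n)"
    using rep_assoc_carrier[of D regular regular V] by simp
  have aM: "rep_assoc D regular V regular \<in> carrier_mat (?m * n * ?m) (?m * n * ?m)"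
    using rep_assoc_carrier[of D regular V regular] by simp
  have one: "1\<^sub>m ?m \<in> carrier_mat ?m ?m" by simp
  have k1: "kron (1\<^sub>m ?m) (e regular) \<in> carrier_mat (?m * ?m * n) (?m * n * ?m)"
    using kron_carrier[OF one e_regular_carrier] by (simp add: mult.assoc)
  have k2: "kron (e regular) (1\<^sub>m ?m) \<in> carrier_mat (?m * n * ?m) (n * ?m * ?m)"
    using kron_carrier[OF e_regular_carrier one] by simp
  have uu: "?u \<otimes>\<^sub>v ?u' \<in> grade ?T (b \<otimes> b')" by (rule vtensor_grade) (use * in auto)
  have hexagon: "rep_assoc D regular regular V *\<^sub>v (e ?T *\<^sub>v (rep_assoc D V regular regular *\<^sub>v ?z))
    = kron (1\<^sub>m ?m) (e regular) *\<^sub>v (rep_assoc D regular V regular *\<^sub>v (kron (e regular) (1\<^sub>m ?m) *\<^sub>v ?z))"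
    using arg_cong[OF e_hexagon[OF R R], of "\<lambda>M. M *\<^sub>v ?z"]
    by (simp only: rdim_regular assoc_mult_mat_vec[OF mult_carrier_mat[OF aL eT] aV z]
        assoc_mult_mat_vec[OF aL eT mult_mat_vec_carrier[OF aV z]]
        assoc_mult_mat_vec[OF mult_carrier_mat[OF k1 aM] k2 z] assoc_mult_mat_vec[OF k1 aM mult_mat_vec_carrier[OF k2 z]])
  \<comment> \<open>On the left-hand side the half-braiding passes the product \<open>?u \<otimes> ?u'\<close> at once.\<close>
  define s where "s x = inverse (\<omega> a b b') * \<gamma> x (?B x) (?B' x) * inverse (\<omega> (?B x) (?B' x) (?a2 x))" for x
  define w where "w x = E (x \<triangleright> (b \<otimes> b'), x) v" for x
  have w: "w x \<in> grade V (?a2 x)" if "x \<in> carrier G" for x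
    using E_grade[OF v *(1) m_closed[OF *(2,3)] that] that * by (simp add: w_def word)
  have wc [simp]: "w x \<in> carrier_vec n" for x by (simp add: w_def)
  have "e ?T *\<^sub>v ?z = vsum (?m * ?m * n) (\<lambda>x. \<rho> ?T x (?u \<otimes>\<^sub>v ?u') \<otimes>\<^sub>v w x) (carrier G)"
    using e_apply_grade[OF is_rep_tensor[OF R R] gradeD[OF v] uu] * by (simp add: vtensor_assoc w_def)
  also have "\<dots> = vsum (?m * ?m * n) (\<lambda>x. \<gamma> x (?B x) (?B' x) \<cdot>\<^sub>v (basis_vec (?B x, x) \<otimes>\<^sub>v basis_vec (?B' x, x) \<otimes>\<^sub>v w x)) (carrier G)"
    by (rule vsum_cong) (use * \<rho>_tensor[OF R R basis_vec_grade basis_vec_grade] in \<open>auto simp: \<rho>_regular vtensor_smult\<close>)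
  finally have eTz: "e ?T *\<^sub>v ?z = \<dots>" .
  let ?F = "\<lambda>x. s x \<cdot>\<^sub>v (basis_vec (?B' x, x) \<otimes>\<^sub>v w x)"
  have "rep_assoc D regular regular V *\<^sub>v (e ?T *\<^sub>v (rep_assoc D V regular regular *\<^sub>v ?z))
    = inverse (\<omega> a b b') \<cdot>\<^sub>v (rep_assoc D regular regular V *\<^sub>v (e ?T *\<^sub>v ?z))"
    using rep_assoc_grade[OF rep_V R R v basis_vec_grade basis_vec_grade *(1-3)] * z
      mult_mat_vec[OF eT z] mult_mat_vec[OF aL mult_mat_vec_carrier[OF eT z]] by simp
  also have "\<dots> = inverse (\<omega> a b b') \<cdot>\<^sub>v vsum (?m * ?m * n) (\<lambda>x. rep_assoc D regular regular V *\<^sub>v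
      (\<gamma> x (?B x) (?B' x) \<cdot>\<^sub>v (basis_vec (?B x, x) \<otimes>\<^sub>v basis_vec (?B' x, x) \<otimes>\<^sub>v w x))) (carrier G)"
    unfolding eTz by (subst vsum_image_under[OF _ aL]) (use w * in auto)
  also have "\<dots> = inverse (\<omega> a b b') \<cdot>\<^sub>v vsum (?m * ?m * n) (\<lambda>x. (\<gamma> x (?B x) (?B' x) * inverse (\<omega> (?B x) (?B' x) (?a2 x))) \<cdot>\<^sub>v
      (basis_vec (?B x, x) \<otimes>\<^sub>v basis_vec (?B' x, x) \<otimes>\<^sub>v w x)) (carrier G)"
  proof (intro arg_cong[where f = "\<lambda>z. _ \<cdot>\<^sub>v z"] vsum_cong)
    fix x assume x: "x \<in> carrier G"
    let ?t = "basis_vec (?B x, x) \<otimes>\<^sub>v basis_vec (?B' x, x) \<otimes>\<^sub>v w x"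
    have t: "?t \<in> carrier_vec (?m * ?m * n)" using w[OF x] by simp
    have "rep_assoc D regular regular V *\<^sub>v ?t = inverse (\<omega> (?B x) (?B' x) (?a2 x)) \<cdot>\<^sub>v ?t"
      by (rule rep_assoc_grade[OF R R rep_V basis_vec_grade basis_vec_grade w[OF x]]) (use x * in auto)
    thus "rep_assoc D regular regular V *\<^sub>v (\<gamma> x (?B x) (?B' x) \<cdot>\<^sub>v ?t)
      = (\<gamma> x (?B x) (?B' x) * inverse (\<omega> (?B x) (?B' x) (?a2 x))) \<cdot>\<^sub>v ?t"
      using mult_mat_vec[OF aL t] by (simp add: smult_smult_assoc)
  qed
  also have "\<dots> = vsum (?m * (?m * n)) (\<lambda>x. basis_vec (?B x, x) \<otimes>\<^sub>v ?F x) (carrier G)"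
    by (subst smult_vsum) (use w in \<open>auto intro!: vsum_cong simp: s_def vtensor_smult smult_smult_assoc vtensor_assoc mult.assoc\<close>)
  finally have L: "rep_assoc D regular regular V *\<^sub>v (e ?T *\<^sub>v (rep_assoc D V regular regular *\<^sub>v ?z)) = \<dots>" .
  \<comment> \<open>On the right-hand side it passes the two factors one after the other.\<close>
  define r where "r x = inverse (\<omega> (?B x) (?a1 x) b')" for x
  define w1 where "w1 x = E (?B x, x) v" for x
  have w1: "w1 x \<in> grade V (?a1 x)" if "x \<in> carrier G" for x
    using E_grade[OF v *(1,2) that] by (simp add: w1_def)
  have w1c [simp]: "w1 x \<in> carrier_vec n" for x by (simp add: w1_def)
  let ?F' = "\<lambda>x. r x \<cdot>\<^sub>v (e regular *\<^sub>v (w1 x \<otimes>\<^sub>v ?u'))"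
  have vu: "v \<otimes>\<^sub>v ?u \<in> carrier_vec (n * ?m)" using v by simp
  have "kron (e regular) (1\<^sub>m ?m) *\<^sub>v ?z = vsum (?m * n) (\<lambda>x. basis_vec (?B x, x) \<otimes>\<^sub>v w1 x) (carrier G) \<otimes>\<^sub>v ?u'"
    using kron_mult_vtensor[OF e_regular_carrier one vu basis_vec_carrier] e_basis_vec[OF gradeD[OF v] *(2)]
    by (simp add: w1_def)
  also have "\<dots> = vsum (?m * n * ?m) (\<lambda>x. basis_vec (?B x, x) \<otimes>\<^sub>v w1 x \<otimes>\<^sub>v ?u') (carrier G)"
    by (rule vtensor_vsum) (use w1 in auto)
  finally have k2z: "kron (e regular) (1\<^sub>m ?m) *\<^sub>v ?z = \<dots>" .
  have "rep_assoc D regular V regular *\<^sub>v (kron (e regular) (1\<^sub>m ?m) *\<^sub>v ?z)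
    = vsum (?m * n * ?m) (\<lambda>x. r x \<cdot>\<^sub>v (basis_vec (?B x, x) \<otimes>\<^sub>v w1 x \<otimes>\<^sub>v ?u')) (carrier G)"
    unfolding k2z
  proof (subst vsum_image_under[OF _ aM])
    show "vsum (?m * n * ?m) (\<lambda>x. rep_assoc D regular V regular *\<^sub>v (basis_vec (?B x, x) \<otimes>\<^sub>v w1 x \<otimes>\<^sub>v ?u')) (carrier G)
      = vsum (?m * n * ?m) (\<lambda>x. r x \<cdot>\<^sub>v (basis_vec (?B x, x) \<otimes>\<^sub>v w1 x \<otimes>\<^sub>v ?u')) (carrier G)"
      unfolding r_def
      by (intro vsum_cong rep_assoc_grade[OF R rep_V R basis_vec_grade w1 basis_vec_grade]) (use * in auto)
  qed (use w1 in auto)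
  hence "kron (1\<^sub>m ?m) (e regular) *\<^sub>v (rep_assoc D regular V regular *\<^sub>v (kron (e regular) (1\<^sub>m ?m) *\<^sub>v ?z))
    = vsum (?m * ?m * n) (\<lambda>x. kron (1\<^sub>m ?m) (e regular) *\<^sub>v (r x \<cdot>\<^sub>v (basis_vec (?B x, x) \<otimes>\<^sub>v w1 x \<otimes>\<^sub>v ?u'))) (carrier G)"
    by (simp only:) (rule vsum_image_under[OF _ k1], use w1 in auto)
  also have "\<dots> = vsum (?m * (?m * n)) (\<lambda>x. basis_vec (?B x, x) \<otimes>\<^sub>v ?F' x) (carrier G)"
    unfolding mult.assoc
  proof (rule vsum_cong)
    fix x assume x: "x \<in> carrier G"
    have t: "basis_vec (?B x, x) \<otimes>\<^sub>v w1 x \<otimes>\<^sub>v ?u' \<in> carrier_vec (?m * n * ?m)" using w1[OF x] by simp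
    have "w1 x \<otimes>\<^sub>v ?u' \<in> carrier_vec (n * ?m)" using w1[OF x] by simp
    thus "kron (1\<^sub>m ?m) (e regular) *\<^sub>v (r x \<cdot>\<^sub>v (basis_vec (?B x, x) \<otimes>\<^sub>v w1 x \<otimes>\<^sub>v ?u')) = basis_vec (?B x, x) \<otimes>\<^sub>v ?F' x"
      unfolding mult_mat_vec[OF k1 t] unfolding vtensor_assoc
      using kron_mult_vtensor[OF one e_regular_carrier basis_vec_carrier] by (simp add: vtensor_smult)
  qed
  finally have Rr: "kron (1\<^sub>m ?m) (e regular) *\<^sub>v (rep_assoc D regular V regular *\<^sub>v (kron (e regular) (1\<^sub>m ?m) *\<^sub>v ?z)) = \<dots>" .
  \<comment> \<open>Both sides are sums over the distinct basis vectors \<open>basis_vec (?B x, x)\<close>.\<close>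
  have eq: "vsum (?m * (?m * n)) (\<lambda>x. basis_vec (?B x, x) \<otimes>\<^sub>v ?F x) (carrier G)
    = vsum (?m * (?m * n)) (\<lambda>x. basis_vec (?B x, x) \<otimes>\<^sub>v ?F' x) (carrier G)"
    using hexagon unfolding L Rr .
  have c1: "coef (?m * n) (?B x, x) (vsum (?m * (?m * n)) (\<lambda>x. basis_vec (?B x, x) \<otimes>\<^sub>v ?F x) (carrier G)) = ?F x"
    by (rule coef_vsum_basis_vec[where h = ?B and k = "\<lambda>x. x"]) (use w * in auto)
  have c2: "coef (?m * n) (?B x, x) (vsum (?m * (?m * n)) (\<lambda>x. basis_vec (?B x, x) \<otimes>\<^sub>v ?F' x) (carrier G)) = ?F' x"
    by (rule coef_vsum_basis_vec[where h = ?B and k = "\<lambda>x. x"])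
      (use w1 * mult_mat_vec_carrier[OF e_regular_carrier] in auto)
  have "?F x = ?F' x" using c1 c2 eq by simp
  hence "coef n (?B' y, y) (?F x) = coef n (?B' y, y) (?F' x)" by simp
  moreover have "coef n (?B' y, y) (?F x) = (if x = y then s x \<cdot>\<^sub>v w x else 0\<^sub>v n)"
    using w[OF *(4)] * by (auto simp: coef_smult)
  moreover have "coef n (?B' y, y) (?F' x) = r x \<cdot>\<^sub>v E (?B' y, y) (w1 x)"
    using coef_e_basis_vec[OF gradeD[OF w1[OF *(4)]] *(3,5)] w1[OF *(4)] *
    by (simp add: coef_smult mult_mat_vec_carrier[OF e_regular_carrier])
  ultimately have main: "r x \<cdot>\<^sub>v E (?B' y, y) (w1 x) = (if x = y then s x \<cdot>\<^sub>v w x else 0\<^sub>v n)" by simp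
  have nz: "\<omega> (?B x) (?a1 x) b' \<noteq> 0" using * by simp
  have "E (?B' y, y) (w1 x) = \<omega> (?B x) (?a1 x) b' \<cdot>\<^sub>v (r x \<cdot>\<^sub>v E (?B' y, y) (w1 x))"
    using nz by (simp add: r_def smult_smult_assoc)
  also have "\<dots> = (if x = y then hex a x b b' \<cdot>\<^sub>v w x else 0\<^sub>v n)"
    unfolding main by (simp add: smult_smult_assoc hex_def s_def field_simps)
  finally show ?thesis by (simp add: w_def w1_def)
qed

lemma hex_one [simp]:
  assumes "a \<in> carrier G" "x \<in> carrier G" "b \<in> carrier G"
  shows "hex a x \<one> b = 1" "hex a x b \<one> = 1"
  using assms by (simp_all add: hex_def)

lemma hex_nonzero [simp]:
  "a \<in> carrier G \<Longrightarrow> x \<in> carrier G \<Longrightarrow> b \<in> carrier G \<Longrightarrow> b' \<in> carrier G \<Longrightarrow> hex a x b b' \<noteq> 0"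
  by (simp add: hex_def)

lemma E_one_E_one:
  assumes "v \<in> grade V a" "a \<in> carrier G" "x \<in> carrier G" "y \<in> carrier G"
  shows "E (\<one>, y) (E (\<one>, x) v) = (if x = y then E (\<one>, x) v else 0\<^sub>v n)"
  using E_E[OF assms(1,2) one_closed one_closed assms(3,4)] assms by simp

lemma e_regular_inj:
  assumes "u \<in> carrier_vec (n * reg_dim)" "w \<in> carrier_vec (n * reg_dim)"
    "e regular *\<^sub>v u = e regular *\<^sub>v w"
  shows "u = w"
proof -
  obtain B where B: "inverts_mat (e regular) B" "inverts_mat B (e regular)" and sq: "square_mat (e regular)"
    using e_invertible[OF is_rep_regular] by (auto simp: invertible_mat_def)
  note c = e_regular_carrier
  have BA: "B * e regular = 1\<^sub>m (dim_row B)" and AB: "e regular * B = 1\<^sub>m (dim_row (e regular))"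
    using B by (auto simp: inverts_mat_def)
  have "dim_row B = n * reg_dim" using arg_cong[OF BA, of dim_col] c by auto
  moreover have "dim_col B = reg_dim * n" using arg_cong[OF AB, of dim_col] c by auto
  ultimately have Bc: "B \<in> carrier_mat (n * reg_dim) (reg_dim * n)" by auto
  have "B *\<^sub>v (e regular *\<^sub>v z) = z" if "z \<in> carrier_vec (n * reg_dim)" for z
    using assoc_mult_mat_vec[OF Bc c that] BA Bc that by simp
  thus ?thesis using assms by metis
qed

text \<open>
  The operators \<open>E (\<one>, x)\<close> are orthogonal idempotents by \<open>E_one_E_one\<close>. Their sum \<open>p\<close> satisfies
  \<open>E (\<one>, y) p = E (\<one>, y)\<close>, so the half-braiding takes equal values at \<open>p v\<close> and \<open>v\<close>
  tensored with a vector of degree \<open>\<one>\<close>; as it is injective, \<open>p v = v\<close>.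
\<close>

lemma E_one_sum:
  assumes v: "v \<in> grade V a" and a: "a \<in> carrier G"
  shows "vsum n (\<lambda>x. E (\<one>, x) v) (carrier G) = v" (is "?p = v")
proof -
  let ?u = "basis_vec (\<one>, \<one>)"
  have 1: "E (\<one>, y) ?p = E (\<one>, y) v" if y: "y \<in> carrier G" for y
  proof -
    have "E (\<one>, y) ?p = vsum n (\<lambda>x. E (\<one>, y) (E (\<one>, x) v)) (carrier G)"
      by (rule E_vsum) (use y in auto)
    also have "\<dots> = E (\<one>, y) (E (\<one>, y) v)"
      by (rule vsum_carrier_single) (use y E_one_E_one[OF v a] in auto)
    finally show ?thesis using E_one_E_one[OF v a y y] by simp
  qed
  have "e regular *\<^sub>v (?p \<otimes>\<^sub>v ?u) = e regular *\<^sub>v (v \<otimes>\<^sub>v ?u)"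
    using v by (simp add: e_basis_vec) (rule vsum_cong, simp add: 1)
  hence "?p \<otimes>\<^sub>v ?u = v \<otimes>\<^sub>v ?u"
    by (rule e_regular_inj[rotated 2]) (use v in auto)
  hence "flip_mat n reg_dim *\<^sub>v (?p \<otimes>\<^sub>v ?u) = flip_mat n reg_dim *\<^sub>v (v \<otimes>\<^sub>v ?u)" by simp
  hence "?u \<otimes>\<^sub>v ?p = ?u \<otimes>\<^sub>v v" using v by (simp add: flip_mat_vtensor)
  hence "coef n (\<one>, \<one>) (?u \<otimes>\<^sub>v ?p) = coef n (\<one>, \<one>) (?u \<otimes>\<^sub>v v)" by simp
  thus ?thesis using v by simp
qed

text \<open>
  The part that behaves like \<open>A\<^sub>x \<otimes> B\<^sub>c\<close>: the degree is \<open>x \<otimes> c\<close>, and objects passed by the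
  half-braiding are acted on by \<open>x\<close>.
\<close>

definition bigrade where
  "bigrade x c = {v \<in> grade V (x \<otimes> c). E (\<one>, x) v = v}"

lemma bigradeI: "v \<in> grade V (x \<otimes> c) \<Longrightarrow> E (\<one>, x) v = v \<Longrightarrow> v \<in> bigrade x c"
  by (simp add: bigrade_def)

lemma bigradeD:
  assumes "v \<in> bigrade x c"
  shows "v \<in> grade V (x \<otimes> c)" "E (\<one>, x) v = v"
  using assms by (simp_all add: bigrade_def)

lemma bigrade_carrier [simp]: "v \<in> bigrade x c \<Longrightarrow> v \<in> carrier_vec n"
  using bigradeD(1) gradeD by blast

lemma bigrade_smult [simp]:
  assumes "x \<in> carrier G" "c \<in> carrier G" and v: "v \<in> bigrade x c"
  shows "r \<cdot>\<^sub>v v \<in> bigrade x c"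
  using E_smult[of \<one> x v r] rep_carriers[OF rep_V] bigradeD[OF v] assms by (intro bigradeI) auto

lemma separates_bigrade: "separates n (\<Union>x\<in>carrier G. \<Union>c\<in>carrier G. bigrade x c)"
proof (rule separatesI[OF _ separates_grade[OF rep_V]])
  fix v assume "v \<in> (\<Union>a\<in>carrier G. grade V a)"
  then obtain a where a: "a \<in> carrier G" and v: "v \<in> grade V a" by blast
  have "E (\<one>, x) v \<in> bigrade x (inv x \<otimes> a)" if "x \<in> carrier G" for x
    using E_grade[OF v a one_closed that] E_one_E_one[OF v a that that] that a
    by (intro bigradeI) simp_all
  thus "\<exists>(I :: 'a set) f. (\<forall>i\<in>I. f i \<in> (\<Union>x\<in>carrier G. \<Union>c\<in>carrier G. bigrade x c)) \<and> v = vsum n f I"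
    using E_one_sum[OF v a] a
    by (intro exI[of _ "carrier G"] exI[of _ "\<lambda>x. E (\<one>, x) v"]) force
qed auto

lemma E_other:
  assumes v: "v \<in> bigrade x c" and "x \<in> carrier G" "c \<in> carrier G" "g \<in> carrier G" "y \<in> carrier G" "y \<noteq> x"
  shows "E (g, y) v = 0\<^sub>v n"
  using E_E[OF bigradeD(1)[OF v], of \<one> "g \<triangleleft> y" x y] bigradeD(2)[OF v] assms by (simp add: word)

text \<open>
  The inverse of the action of \<open>b\<close> on the factor \<open>B\<^sub>c\<close>, which is what a half-braiding of reversed
  type applies to \<open>B\<close> when it passes an object of degree \<open>b\<close>.
\<close>

definition Q where
  "Q x c b v = inverse (reassoc x c b) \<cdot>\<^sub>v E (x \<triangleright> b, x) v"

lemma Q_bigrade [simp]: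
  assumes v: "v \<in> bigrade x c" and *: "x \<in> carrier G" "c \<in> carrier G" "b \<in> carrier G"
  shows "Q x c b v \<in> bigrade x (c \<triangleleft> b)"
proof -
  have "E (x \<triangleright> b, x) v \<in> bigrade x (c \<triangleleft> b)"
    using E_grade[OF bigradeD(1)[OF v], of b x] E_E[OF bigradeD(1)[OF v], of b \<one> x x] *
    by (intro bigradeI) (simp_all add: word)
  thus ?thesis using * by (simp add: Q_def)
qed

lemma Q_smult:
  "x \<in> carrier G \<Longrightarrow> c \<in> carrier G \<Longrightarrow> b \<in> carrier G \<Longrightarrow> v \<in> carrier_vec n \<Longrightarrow>
    Q x c b (r \<cdot>\<^sub>v v) = r \<cdot>\<^sub>v Q x c b v"
  by (simp add: Q_def E_smult smult_smult_assoc mult.commute)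

lemma Q_one [simp]:
  "x \<in> carrier G \<Longrightarrow> c \<in> carrier G \<Longrightarrow> v \<in> bigrade x c \<Longrightarrow> Q x c \<one> v = v"
  by (simp add: Q_def reassoc_def bigradeD(2))

lemma Q_Q:
  assumes v: "v \<in> bigrade x c" and *: "x \<in> carrier G" "c \<in> carrier G" "b \<in> carrier G" "b' \<in> carrier G"
  shows "Q x (c \<triangleleft> b) b' (Q x c b v) = inverse (\<theta> c b b') \<cdot>\<^sub>v Q x c (b \<otimes> b') v"
proof -
  let ?c = "c \<triangleleft> b"
  have "Q x ?c b' (Q x c b v) = (inverse (reassoc x ?c b') * inverse (reassoc x c b))
      \<cdot>\<^sub>v E (x \<triangleright> b', x) (E (x \<triangleright> b, x) v)"
    using * by (simp add: Q_def E_smult smult_smult_assoc)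
  also have "\<dots> = (inverse (reassoc x ?c b') * inverse (reassoc x c b) * hex (x \<otimes> c) x b b')
      \<cdot>\<^sub>v E (x \<triangleright> (b \<otimes> b'), x) v"
    using E_E[OF bigradeD(1)[OF v], of b b' x x] * by (simp add: smult_smult_assoc)
  also have "inverse (reassoc x ?c b') * inverse (reassoc x c b) * hex (x \<otimes> c) x b b'
    = inverse (\<theta> c b b') * inverse (reassoc x c (b \<otimes> b'))"
    using reassoc_hex[OF *] * by (simp add: field_simps)
  finally show ?thesis by (simp add: Q_def smult_smult_assoc)
qed

text \<open>
  On doubly homogeneous vectors the half-braiding sends pure tensors to pure tensors.
\<close>

lemma e_apply_bigrade:
  assumes X: "is_rep D X" and v: "v \<in> bigrade x c" and \<xi>: "\<xi> \<in> grade X b"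
    and *: "x \<in> carrier G" "c \<in> carrier G" "b \<in> carrier G"
  shows "e X *\<^sub>v (v \<otimes>\<^sub>v \<xi>) = reassoc x c b \<cdot>\<^sub>v (\<rho> X x \<xi> \<otimes>\<^sub>v Q x c b v)"
proof -
  have d: "dim_vec (\<rho> X y \<xi>) = rdim X" for y using carrier_vecD[OF \<rho>_carrier[OF gradeD[OF \<xi>]]] .
  have "e X *\<^sub>v (v \<otimes>\<^sub>v \<xi>) = \<rho> X x \<xi> \<otimes>\<^sub>v E (x \<triangleright> b, x) v"
    unfolding e_apply_grade[OF X bigrade_carrier[OF v] \<xi> *(3)]
    by (rule vsum_carrier_single)
      (use * E_other[OF v] d \<rho>_carrier[OF gradeD[OF \<xi>]] in \<open>auto intro!: vtensor_carrier\<close>)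
  thus ?thesis using * by (simp add: Q_def vtensor_smult smult_smult_assoc)
qed

lemma \<rho>_bigrade [simp]:
  assumes v: "v \<in> bigrade x c" and *: "x \<in> carrier G" "c \<in> carrier G" "y \<in> carrier G"
  shows "\<rho> V y v \<in> bigrade (y \<triangleright> x) (y \<triangleright> c)"
  using E_\<rho>[OF bigradeD(1)[OF v], of \<one> x y] \<rho>_grade[OF rep_V bigradeD(1)[OF v], of y] bigradeD(2)[OF v] *
  by (intro bigradeI) (simp_all add: word dpr_theta_def)

text \<open>
  The element \<open>y\<close> acts diagonally on \<open>A\<^sub>x \<otimes> B\<^sub>c\<close>, with a factor \<open>\<gamma>\<close>, and \<open>Q\<close> is
  projective on the second factor. This determines the commutation factor, which is verified by
  \<open>reassoc_conj\<close>.
\<close>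

lemma Q_\<rho>:
  assumes v: "v \<in> bigrade x c" and *: "x \<in> carrier G" "c \<in> carrier G" "b \<in> carrier G" "y \<in> carrier G"
  defines "b' \<equiv> y \<triangleright> b" and "x' \<equiv> y \<triangleright> x" and "c' \<equiv> y \<triangleright> c"
  shows "Q x' c' b' (\<rho> V y v) =
    (\<theta> c' y b * \<gamma> y x' c' / (\<theta> c' b' y * \<gamma> y x' (y \<triangleright> (c \<triangleleft> b)))) \<cdot>\<^sub>v \<rho> V y (Q x c b v)"
proof -
  let ?B = "x \<triangleright> b" let ?c1 = "c \<triangleleft> b"
  define k where "k = \<gamma> y (y \<triangleright> (x \<otimes> c)) b' * \<theta> (y \<triangleright> ?B) x' y"
  define k' where "k' = \<gamma> y (y \<triangleright> ?B) (y \<triangleright> (x \<otimes> ?c1)) * \<theta> (y \<triangleright> ?B) y x"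
  have nz: "k \<noteq> 0" "k' \<noteq> 0" using * by (simp_all add: k_def k'_def b'_def x'_def)
  have cl: "x' \<in> carrier G" "c' \<in> carrier G" "b' \<in> carrier G" using * by (simp_all add: b'_def x'_def c'_def)
  have B': "x' \<triangleright> b' = y \<triangleright> ?B" using * by (simp add: b'_def x'_def word)
  have a1: "x \<otimes> inv b \<otimes> inv x \<otimes> (x \<otimes> c) \<otimes> b = x \<otimes> ?c1" using * by (simp add: word)
  have "k \<cdot>\<^sub>v E (y \<triangleright> ?B, x') (\<rho> V y v) = k' \<cdot>\<^sub>v \<rho> V y (E (?B, x) v)"
    using E_\<rho>[OF bigradeD(1)[OF v] m_closed[OF *(1,2)] *(3,1,4)] unfolding a1 k_def k'_def b'_def x'_def .
  hence "inverse k \<cdot>\<^sub>v (k \<cdot>\<^sub>v E (y \<triangleright> ?B, x') (\<rho> V y v)) = inverse k \<cdot>\<^sub>v (k' \<cdot>\<^sub>v \<rho> V y (E (?B, x) v))" by simp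
  hence E: "E (y \<triangleright> ?B, x') (\<rho> V y v) = (k' / k) \<cdot>\<^sub>v \<rho> V y (E (?B, x) v)"
    using nz by (simp add: smult_smult_assoc field_simps)
  have conj: "k * reassoc x' c' b' * \<theta> c' y b * \<gamma> y x' c'
     = k' * reassoc x c b * \<theta> c' b' y * \<gamma> y x' (y \<triangleright> ?c1)"
    using reassoc_conj[OF *(1-4)] unfolding k_def k'_def b'_def x'_def c'_def .
  have "Q x' c' b' (\<rho> V y v) = (inverse (reassoc x' c' b') * (k' / k)) \<cdot>\<^sub>v \<rho> V y (E (?B, x) v)"
    unfolding Q_def B' E by (simp add: smult_smult_assoc)
  also have "E (?B, x) v = reassoc x c b \<cdot>\<^sub>v Q x c b v"
    using * by (simp add: Q_def smult_smult_assoc)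
  also have "\<rho> V y (reassoc x c b \<cdot>\<^sub>v Q x c b v) = reassoc x c b \<cdot>\<^sub>v \<rho> V y (Q x c b v)"
    by (rule \<rho>_smult) (simp add: Q_def)
  finally have "Q x' c' b' (\<rho> V y v) = (inverse (reassoc x' c' b') * (k' / k) * reassoc x c b) \<cdot>\<^sub>v \<rho> V y (Q x c b v)"
    by (simp add: smult_smult_assoc)
  also have "inverse (reassoc x' c' b') * (k' / k) * reassoc x c b
    = \<theta> c' y b * \<gamma> y x' c' / (\<theta> c' b' y * \<gamma> y x' (y \<triangleright> ?c1))"
    using conj nz cl * by (simp add: field_simps)
  finally show ?thesis .
qed

text \<open>
  The action of \<open>y\<close> on the factor \<open>A\<^sub>x\<close> alone: the diagonal action, with its factor \<open>\<gamma>\<close> and its effect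
  on \<open>B\<^sub>c\<close> removed. Applying \<open>Q\<close> first makes the diagonal action end in the original degree \<open>c\<close>.
\<close>

definition P where
  "P x c y v = inverse (\<gamma> y (y \<triangleright> x) c) \<cdot>\<^sub>v \<rho> V y (Q x c y v)"

lemma P_bigrade [simp]:
  assumes v: "v \<in> bigrade x c" and *: "x \<in> carrier G" "c \<in> carrier G" "y \<in> carrier G"
  shows "P x c y v \<in> bigrade (y \<triangleright> x) c"
  using \<rho>_bigrade[OF Q_bigrade[OF v *] *(1) _ *(3)] * by (simp add: P_def word)

lemma P_smult:
  assumes "x \<in> carrier G" "c \<in> carrier G" "y \<in> carrier G" "v \<in> bigrade x c"
  shows "P x c y (r \<cdot>\<^sub>v v) = r \<cdot>\<^sub>v P x c y v"
  using assms \<rho>_smult[OF bigrade_carrier[OF Q_bigrade[OF assms(4,1-3)]]]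
  by (simp add: P_def Q_smult smult_smult_assoc mult.commute)

lemma P_one [simp]:
  "x \<in> carrier G \<Longrightarrow> c \<in> carrier G \<Longrightarrow> v \<in> bigrade x c \<Longrightarrow> P x c \<one> v = v"
  using \<rho>_one[OF rep_V bigradeD(1)] by (simp add: P_def)

lemma P_eq_\<rho>:
  assumes v: "v \<in> bigrade x c" and *: "x \<in> carrier G" "c \<in> carrier G" "y \<in> carrier G"
  shows "\<rho> V y (Q x c y v) = \<gamma> y (y \<triangleright> x) c \<cdot>\<^sub>v P x c y v"
  using * by (simp add: P_def smult_smult_assoc)

lemma P_Q:
  assumes v: "v \<in> bigrade x c" and *: "x \<in> carrier G" "c \<in> carrier G" "b \<in> carrier G" "y \<in> carrier G"
  shows "Q (y \<triangleright> x) c b (P x c y v) = P x (c \<triangleleft> b) y (Q x c b v)"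
proof -
  let ?x = "y \<triangleright> x" let ?b = "b \<triangleleft> y" let ?c = "c \<triangleleft> y" let ?c1 = "c \<triangleleft> b"
  let ?u = "Q x c (b \<otimes> y) v"
  note u = Q_bigrade[OF v *(1,2,4)] and w = Q_bigrade[OF v *(1-3)]
  have \<rho>u: "\<rho> V y ?u \<in> carrier_vec n" and uc: "?u \<in> carrier_vec n"
    using Q_bigrade[OF v *(1,2) m_closed[OF *(3,4)]] by (simp_all add: Q_def)
  have words: "y \<triangleright> ?c = c" "y \<triangleright> ?b = b"
    "y \<triangleright> (?c \<triangleleft> ?b) = ?c1" "y \<otimes> ?b = b \<otimes> y"
    using * by (simp_all add: word)
  have 1: "Q x ?c ?b (Q x c y v) = inverse (\<theta> c y ?b) \<cdot>\<^sub>v ?u"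
    using Q_Q[OF v *(1,2,4), of ?b] * unfolding words(4) by simp
  have 2: "Q ?x c b (\<rho> V y (Q x c y v)) = (\<theta> c y ?b * \<gamma> y ?x c / (\<theta> c b y * \<gamma> y ?x ?c1)) \<cdot>\<^sub>v \<rho> V y (Q x ?c ?b (Q x c y v))"
    using Q_\<rho>[OF u *(1) _ _ *(4), of ?b] * unfolding words(1-3) by simp
  have "Q ?x c b (P x c y v) = inverse (\<gamma> y ?x c) \<cdot>\<^sub>v Q ?x c b (\<rho> V y (Q x c y v))"
    unfolding P_def using * u by (intro Q_smult) auto
  also have "\<dots> = inverse (\<theta> c b y * \<gamma> y ?x ?c1) \<cdot>\<^sub>v \<rho> V y ?u"
    unfolding 2 1 \<rho>_smult[OF uc] smult_smult_assoc by (rule arg_cong[where f = "\<lambda>r. r \<cdot>\<^sub>v _"]) (use * in \<open>simp add: field_simps\<close>)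
  also have "\<dots> = P x ?c1 y (Q x c b v)"
    unfolding P_def Q_Q[OF v *(1-4)] \<rho>_smult[OF uc] smult_smult_assoc by (simp add: mult.commute)
  finally show ?thesis .
qed

text \<open>
  The multiplier of the diagonal action is that of the representation \<open>V\<close>, at the degree
  \<open>x \<otimes> c\<close>; by \<open>\<gamma>_\<theta>\<close> what remains after splitting off \<open>Q\<close> is \<open>\<theta>\<close> at the degree \<open>x\<close>.
\<close>

lemma P_P:
  assumes v: "v \<in> bigrade x c" and *: "x \<in> carrier G" "c \<in> carrier G" "y \<in> carrier G" "z \<in> carrier G"
  shows "P (z \<triangleright> x) c y (P x c z v)
    = \<theta> ((y \<otimes> z) \<triangleright> x) y z \<cdot>\<^sub>v P x c (y \<otimes> z) v"
proof -
  let ?x1 = "z \<triangleright> x" let ?x2 = "(y \<otimes> z) \<triangleright> x" let ?c1 = "c \<triangleleft> y"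
  let ?u = "Q x c (y \<otimes> z) v"
  have u: "?u \<in> bigrade x (c \<triangleleft> (y \<otimes> z))" using v * by simp
  have uc: "?u \<in> carrier_vec n" using bigrade_carrier[OF u] .
  have words: "y \<triangleright> ?x1 = ?x2" "?x2 \<triangleleft> y = ?x1"
    "(y \<otimes> z) \<triangleright> (x \<otimes> (c \<triangleleft> (y \<otimes> z))) = ?x2 \<otimes> c"
    using * by (simp_all add: word)
  have "Q ?x1 c y (P x c z v) = P x ?c1 z (Q x c y v)" by (rule P_Q[OF v *])
  also have "\<dots> = (inverse (\<gamma> z ?x1 ?c1) * inverse (\<theta> c y z)) \<cdot>\<^sub>v \<rho> V z ?u"
    unfolding P_def Q_Q[OF v *] \<rho>_smult[OF uc] smult_smult_assoc ..
  finally have 1: "Q ?x1 c y (P x c z v) = \<dots>" .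
  have 2: "\<rho> V y (\<rho> V z ?u) = \<theta> (?x2 \<otimes> c) y z \<cdot>\<^sub>v \<rho> V (y \<otimes> z) ?u"
    using \<rho>_\<rho>[OF rep_V bigradeD(1)[OF u] _ *(3,4)] * unfolding words(3) by simp
  have "P ?x1 c y (P x c z v) = inverse (\<gamma> y ?x2 c) \<cdot>\<^sub>v \<rho> V y (Q ?x1 c y (P x c z v))"
    by (simp only: P_def[of ?x1] words(1))
  also have "\<dots> = (inverse (\<gamma> y ?x2 c) * ((inverse (\<gamma> z ?x1 ?c1) * inverse (\<theta> c y z)) * \<theta> (?x2 \<otimes> c) y z)) \<cdot>\<^sub>v \<rho> V (y \<otimes> z) ?u"
    unfolding 1 \<rho>_smult[OF \<rho>_carrier[OF uc]] 2 smult_smult_assoc ..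
  also have "inverse (\<gamma> y ?x2 c) * ((inverse (\<gamma> z ?x1 ?c1) * inverse (\<theta> c y z)) * \<theta> (?x2 \<otimes> c) y z)
     = \<theta> ?x2 y z * inverse (\<gamma> (y \<otimes> z) ?x2 c)"
    using \<gamma>_\<theta>[of ?x2 c y z] * unfolding words(2) by (simp add: field_simps)
  finally show ?thesis by (simp add: P_def smult_smult_assoc)
qed

text \<open>
  The simultaneous action of \<open>y\<close> on the first and of \<open>z\<close> on the second factor of \<open>A\<^sub>x \<otimes> B\<^sub>d\<close>.
\<close>

definition act where
  "act x d y z v = P x (d \<triangleleft> z) y (Q x d z v)"

lemma act_bigrade [simp]:
  assumes "v \<in> bigrade x d" "x \<in> carrier G" "d \<in> carrier G" "y \<in> carrier G" "z \<in> carrier G"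
  shows "act x d y z v \<in> bigrade (y \<triangleright> x) (d \<triangleleft> z)"
  using assms by (simp add: act_def)

lemma act_smult:
  assumes "v \<in> bigrade x d" "x \<in> carrier G" "d \<in> carrier G" "y \<in> carrier G" "z \<in> carrier G"
  shows "act x d y z (r \<cdot>\<^sub>v v) = r \<cdot>\<^sub>v act x d y z v"
  unfolding act_def Q_smult[OF assms(2,3,5) bigrade_carrier[OF assms(1)]]
  by (rule P_smult) (use assms in simp_all)

lemma act_one [simp]:
  "v \<in> bigrade x d \<Longrightarrow> x \<in> carrier G \<Longrightarrow> d \<in> carrier G \<Longrightarrow> act x d \<one> \<one> v = v"
  by (simp add: act_def)

lemma act_act:
  assumes v: "v \<in> bigrade x d" and *: "x \<in> carrier G" "d \<in> carrier G"
    "y \<in> carrier G" "z \<in> carrier G" "y' \<in> carrier G" "z' \<in> carrier G"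
  shows "act (y \<triangleright> x) (d \<triangleleft> z) y' z' (act x d y z v)
    = (\<theta> ((y' \<otimes> y) \<triangleright> x) y' y / \<theta> d z z') \<cdot>\<^sub>v act x d (y' \<otimes> y) (z \<otimes> z') v"
proof -
  let ?d1 = "d \<triangleleft> z" let ?d2 = "?d1 \<triangleleft> z'"
  let ?t = "\<theta> ((y' \<otimes> y) \<triangleright> x) y' y"
  note u = Q_bigrade[OF v *(1,2,4)]
  have d2: "d \<triangleleft> (z \<otimes> z') = ?d2" using * by (simp add: word)
  have u2: "Q x d (z \<otimes> z') v \<in> bigrade x ?d2" using Q_bigrade[OF v *(1,2) m_closed[OF *(4,6)]] unfolding d2 .
  have cl: "?d1 \<in> carrier G" "?d2 \<in> carrier G" using * by simp_all
  have "act (y \<triangleright> x) ?d1 y' z' (act x d y z v)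
    = P (y \<triangleright> x) ?d2 y' (P x ?d2 y (Q x ?d1 z' (Q x d z v)))"
    unfolding act_def P_Q[OF u *(1) cl(1) *(6,3)] ..
  also have "\<dots> = P (y \<triangleright> x) ?d2 y' (P x ?d2 y (inverse (\<theta> d z z') \<cdot>\<^sub>v Q x d (z \<otimes> z') v))"
    unfolding Q_Q[OF v *(1,2,4,6)] ..
  also have "\<dots> = inverse (\<theta> d z z') \<cdot>\<^sub>v P (y \<triangleright> x) ?d2 y' (P x ?d2 y (Q x d (z \<otimes> z') v))"
    using * u2 by (simp add: P_smult)
  also have "\<dots> = (inverse (\<theta> d z z') * ?t) \<cdot>\<^sub>v P x ?d2 (y' \<otimes> y) (Q x d (z \<otimes> z') v)"
    unfolding P_P[OF u2 *(1) cl(2) *(5,3)] smult_smult_assoc ..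
  finally show ?thesis unfolding act_def d2 by (simp add: divide_inverse mult.commute)
qed

text \<open>
  The twist of the center: each factor is acted on by its own degree.
\<close>

definition T where "T x d v = act x d x d v"

lemma T_bigrade [simp]:
  assumes "v \<in> bigrade x d" "x \<in> carrier G" "d \<in> carrier G"
  shows "T x d v \<in> bigrade x d"
  using act_bigrade[of v x d x d] assms by (simp add: T_def word)

lemma T_pow_bigrade [simp]:
  "v \<in> bigrade x d \<Longrightarrow> x \<in> carrier G \<Longrightarrow> d \<in> carrier G \<Longrightarrow> (T x d ^^ k) v \<in> bigrade x d"
  by (induction k) simp_all

lemma T_act:
  assumes v: "v \<in> bigrade x d" and *: "x \<in> carrier G" "d \<in> carrier G" "y \<in> carrier G" "z \<in> carrier G"
  shows "T (y \<triangleright> x) (d \<triangleleft> z) (act x d y z v) = act x d y z (T x d v)"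
proof -
  let ?x = "y \<triangleright> x" let ?d = "d \<triangleleft> z"
  have eqs: "(?x \<otimes> y) \<triangleright> x = ?x" "?x \<otimes> y = y \<otimes> x" "z \<otimes> ?d = d \<otimes> z"
      "(y \<otimes> x) \<triangleright> x = ?x" "x \<triangleright> x = x" "d \<triangleleft> d = d" "?x \<triangleleft> y = x"
    using * by (simp_all add: word)
  have "T ?x ?d (act x d y z v) = (\<theta> ?x ?x y / \<theta> d z ?d) \<cdot>\<^sub>v act x d (y \<otimes> x) (d \<otimes> z) v"
    using act_act[OF v *, of ?x ?d] * unfolding T_def eqs(1) unfolding eqs(2,3) by simp
  also have "\<theta> ?x ?x y / \<theta> d z ?d = \<theta> ?x y x / \<theta> d d z"
    using \<theta>_conj[of ?x y] \<theta>_conj[of d z] * unfolding eqs(7) by simp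
  also have "(\<theta> ?x y x / \<theta> d d z) \<cdot>\<^sub>v act x d (y \<otimes> x) (d \<otimes> z) v = act x d y z (T x d v)"
    using act_act[OF v *(1,2,1,2), of y z] * unfolding T_def eqs(4-6) by simp
  finally show ?thesis .
qed

lemma T_pow_act:
  assumes v: "v \<in> bigrade x d" and *: "x \<in> carrier G" "d \<in> carrier G" "y \<in> carrier G" "z \<in> carrier G"
  shows "(T (y \<triangleright> x) (d \<triangleleft> z) ^^ k) (act x d y z v) = act x d y z ((T x d ^^ k) v)"
  by (induction k) (use assms T_act[OF T_pow_bigrade[OF v *(1,2)] *] in simp_all)

lemma T_pow:
  assumes v: "v \<in> bigrade x d" and *: "x \<in> carrier G" "d \<in> carrier G"
  shows "(T x d ^^ k) v = (\<Theta> k x / \<Theta> k d) \<cdot>\<^sub>v act x d (x [^] k) (d [^] k) v"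
proof (induction k)
  case 0
  show ?case using assms by (simp add: \<Theta>_def)
next
  case (Suc k)
  let ?y = "x [^] k" let ?z = "d [^] k"
  have comm: "g \<otimes> g [^] k = g [^] k \<otimes> g" if "g \<in> carrier G" for g using nat_pow_comm[of g 1 k] that by simp
  have eqs: "?y \<triangleright> x = x" "d \<triangleleft> ?z = d" "(x \<otimes> ?y) \<triangleright> x = x"
    using * by (simp_all add: word flip: comm) (simp_all add: comm flip: m_assoc)
  have "act x d ?y ?z v \<in> bigrade x d" using act_bigrade[OF v *, of ?y ?z] * unfolding eqs by simp
  hence "T x d ((\<Theta> k x / \<Theta> k d) \<cdot>\<^sub>v act x d ?y ?z v) = (\<Theta> k x / \<Theta> k d) \<cdot>\<^sub>v act x d x d (act x d ?y ?z v)"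
    unfolding T_def by (rule act_smult) (use * in simp_all)
  hence "(T x d ^^ Suc k) v = (\<Theta> k x / \<Theta> k d) \<cdot>\<^sub>v act x d x d (act x d ?y ?z v)"
    by (simp add: Suc)
  also have "act x d x d (act x d ?y ?z v) = (\<omega> x ?y x / \<omega> d ?z d) \<cdot>\<^sub>v act x d (x \<otimes> ?y) (?z \<otimes> d) v"
    using act_act[OF v *, of ?y ?z x d] * unfolding eqs by (simp add: \<theta>_pow)
  finally show ?case using * by (simp add: \<Theta>_def smult_smult_assoc comm)
qed

text \<open>
  The inverse of \<open>Q\<close>, in terms of \<open>Q\<close> at the inverse element.
\<close>

definition unQ where "unQ x d b v = \<theta> d (inv b) b \<cdot>\<^sub>v Q x d (inv b) v"

lemma unQ_bigrade [simp]:
  assumes "v \<in> bigrade x d" "x \<in> carrier G" "d \<in> carrier G" "b \<in> carrier G"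
  shows "unQ x d b v \<in> bigrade x (b \<triangleright> d)"
  using Q_bigrade[of v x d "inv b"] assms by (simp add: unQ_def)

lemma Q_unQ:
  assumes v: "v \<in> bigrade x d" and *: "x \<in> carrier G" "d \<in> carrier G" "b \<in> carrier G"
  shows "Q x (b \<triangleright> d) b (unQ x d b v) = v"
  using Q_Q[OF v *(1,2) inv_closed[OF *(3)] *(3)] v *
    bigrade_carrier[OF Q_bigrade[OF v *(1,2) inv_closed[OF *(3)]]]
  by (simp add: unQ_def Q_smult smult_smult_assoc)

lemma unQ_Q:
  assumes u: "u \<in> bigrade x c" and *: "x \<in> carrier G" "c \<in> carrier G" "b \<in> carrier G"
  shows "unQ x (c \<triangleleft> b) b (Q x c b u) = u"
  using Q_Q[OF u *(1-3) inv_closed[OF *(3)]] \<theta>_cocycle[OF *(2,3) inv_closed[OF *(3)] *(3)] u *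
  by (simp add: unQ_def smult_smult_assoc)

lemma unQ_smult:
  assumes "v \<in> bigrade x d" "x \<in> carrier G" "d \<in> carrier G" "b \<in> carrier G"
  shows "unQ x d b (r \<cdot>\<^sub>v v) = r \<cdot>\<^sub>v unQ x d b v"
  using assms by (simp add: unQ_def Q_smult smult_smult_assoc mult.commute)

lemma unQ_P:
  assumes w: "w \<in> bigrade x' c'" and *: "x' \<in> carrier G" "c' \<in> carrier G" "x \<in> carrier G"
  defines "y \<equiv> x \<triangleright> x'"
  shows "\<rho> V x w = \<gamma> x y (x \<triangleright> c') \<cdot>\<^sub>v unQ y c' x (P x' c' x w)"
proof -
  let ?c = "x \<triangleright> c'"
  have eqs: "x \<triangleright> x = x" "x \<triangleright> (c' \<triangleleft> x) = c'" "?c \<triangleleft> x = c'"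
    using * by (simp_all add: word)
  have y: "y \<in> carrier G" and c: "?c \<in> carrier G" using * by (simp_all add: y_def)
  have Pb: "P x' c' x w \<in> bigrade y c'" using P_bigrade[OF w *] by (simp add: y_def)
  have \<rho>b: "\<rho> V x w \<in> bigrade y ?c" using \<rho>_bigrade[OF w *] by (simp add: y_def)
  have "Q y ?c x (\<rho> V x w) = (\<gamma> x y ?c / \<gamma> x y c') \<cdot>\<^sub>v \<rho> V x (Q x' c' x w)"
    using Q_\<rho>[OF w *(1-3) *(3)] * y unfolding eqs y_def[symmetric] by simp
  also have "\<dots> = \<gamma> x y ?c \<cdot>\<^sub>v P x' c' x w"
    unfolding P_eq_\<rho>[OF w *] y_def[symmetric] smult_smult_assoc using y * by simp
  finally have "unQ y c' x (\<gamma> x y ?c \<cdot>\<^sub>v P x' c' x w) = \<rho> V x w"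
    using unQ_Q[OF \<rho>b y c *(3)] unfolding eqs by simp
  thus ?thesis using unQ_smult[OF Pb y *(2,3)] by simp
qed

end

section \<open>The order of the double braiding\<close>

locale center_pair = V: center_object G \<omega> V e + W: center_object G \<omega> W f
  for G :: "('a, 'm) monoid_scheme" (structure) and \<omega> :: "'a \<Rightarrow> 'a \<Rightarrow> 'a \<Rightarrow> 'k::field"
    and V :: "('a \<times> 'a, 'k) rep" and e :: "('a \<times> 'a, 'k) rep \<Rightarrow> 'k mat"
    and W :: "('a \<times> 'a, 'k) rep" and f :: "('a \<times> 'a, 'k) rep \<Rightarrow> 'k mat"
begin

text \<open>
  Coordinates on \<open>V \<otimes> W\<close> in which the factors are ordered as \<open>(A A') (B B')\<close>: the factor \<open>B\<^sub>d\<close> of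
  \<open>v\<close>, standing after \<open>A'\<close> of degree \<open>x'\<close>, is moved back in front of it.
\<close>

definition K where
  "K x d x' c' v w = inverse (V.shuffle x (x' \<triangleright> d) x' c') \<cdot>\<^sub>v (V.unQ x d x' v \<otimes>\<^sub>v w)"

lemma K_smult:
  assumes "v \<in> V.bigrade x d" "x \<in> carrier G" "d \<in> carrier G" "x' \<in> carrier G"
  shows "K x d x' c' (r \<cdot>\<^sub>v v) (s \<cdot>\<^sub>v w) = (r * s) \<cdot>\<^sub>v K x d x' c' v w"
  using assms by (simp add: K_def V.unQ_smult vtensor_smult smult_smult_assoc mult_ac)

lemma K_carrier:
  assumes "v \<in> V.bigrade x d" "w \<in> W.bigrade x' c'" "x \<in> carrier G" "d \<in> carrier G" "x' \<in> carrier G" "c' \<in> carrier G"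
  shows "K x d x' c' v w \<in> carrier_vec (rdim V * rdim W)"
proof -
  have "V.unQ x d x' v \<in> carrier_vec (rdim V)" "w \<in> carrier_vec (rdim W)"
    using V.bigrade_carrier[OF V.unQ_bigrade[OF assms(1,3-5)]] W.bigrade_carrier[OF assms(2)] by auto
  thus ?thesis by (simp add: K_def)
qed

end

text \<open>
  In the coordinates \<open>K\<close> a single braiding acts separately on the two kinds of factors: \<open>A\<close> acts on
  \<open>A'\<close> by its degree \<open>x\<close>, and, the braiding of the factors \<open>B\<close> being reversed, \<open>B'\<close> acts on \<open>B\<close> by
  the inverse of its degree \<open>c'\<close>.
\<close>

lemma (in center_pair) crossing:
  assumes v: "v \<in> V.bigrade x d" and w: "w \<in> W.bigrade x' c'"
    and *: "x \<in> carrier G" "d \<in> carrier G" "x' \<in> carrier G" "c' \<in> carrier G"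
  shows "e W *\<^sub>v K x d x' c' v w =
    center_pair.K G \<omega> W f (x \<triangleright> x') c' x (d \<triangleleft> c') (W.P x' c' x w) (V.Q x d c' v)"
proof -
  interpret WV: center_pair G \<omega> W f V e by unfold_locales
  let ?c = "x' \<triangleright> d" let ?b = "x' \<otimes> c'" let ?y = "x \<triangleright> x'" let ?d1 = "d \<triangleleft> c'"
  let ?u = "V.unQ x d x' v" let ?c'' = "x \<triangleright> c'"
  have cl: "?c \<in> carrier G" "?b \<in> carrier G" using * by simp_all
  have eqs: "?c \<triangleleft> x' = d" "?c \<triangleleft> ?b = ?d1" using * by (simp_all add: V.word)
  have u: "?u \<in> V.bigrade x ?c" using V.unQ_bigrade[OF v *(1-3)] .
  have "V.Q x d c' (V.Q x ?c x' ?u) = inverse (V.\<theta> ?c x' c') \<cdot>\<^sub>v V.Q x ?c ?b ?u"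
    using V.Q_Q[OF u *(1) cl(1) *(3,4)] unfolding eqs .
  hence "V.\<theta> ?c x' c' \<cdot>\<^sub>v V.Q x d c' v = V.\<theta> ?c x' c' \<cdot>\<^sub>v (inverse (V.\<theta> ?c x' c') \<cdot>\<^sub>v V.Q x ?c ?b ?u)"
    unfolding V.Q_unQ[OF v *(1-3)] by simp
  hence Qu: "V.Q x ?c ?b ?u = V.\<theta> ?c x' c' \<cdot>\<^sub>v V.Q x d c' v"
    using cl * by (simp add: smult_smult_assoc)
  have wg: "w \<in> V.grade W ?b" using W.bigradeD(1)[OF w] .
  have "e W *\<^sub>v (?u \<otimes>\<^sub>v w) = V.reassoc x ?c ?b \<cdot>\<^sub>v (V.\<rho> W x w \<otimes>\<^sub>v V.Q x ?c ?b ?u)"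
    by (rule V.e_apply_bigrade[OF W.rep_V u wg *(1) cl])
  also have "\<dots> = (V.reassoc x ?c ?b * V.\<theta> ?c x' c' * V.\<gamma> x ?y ?c'') \<cdot>\<^sub>v (W.unQ ?y c' x (W.P x' c' x w) \<otimes>\<^sub>v V.Q x d c' v)"
    unfolding Qu W.unQ_P[OF w *(3,4,1)] by (simp add: vtensor_smult smult_smult_assoc mult_ac)
  finally have 1: "e W *\<^sub>v (?u \<otimes>\<^sub>v w) = \<dots>" .
  have uw: "?u \<otimes>\<^sub>v w \<in> carrier_vec (rdim V * rdim W)"
    using V.bigrade_carrier[OF u] W.bigrade_carrier[OF w] by simp
  have "e W *\<^sub>v K x d x' c' v w = inverse (V.shuffle x ?c x' c') \<cdot>\<^sub>v (e W *\<^sub>v (?u \<otimes>\<^sub>v w))"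
    unfolding K_def by (rule mult_mat_vec[OF V.e_carrier[OF W.rep_V] uw])
  also have "\<dots> = (inverse (V.shuffle x ?c x' c') * (V.reassoc x ?c ?b * V.\<theta> ?c x' c' * V.\<gamma> x ?y ?c''))
      \<cdot>\<^sub>v (W.unQ ?y c' x (W.P x' c' x w) \<otimes>\<^sub>v V.Q x d c' v)"
    unfolding 1 smult_smult_assoc ..
  also have "inverse (V.shuffle x ?c x' c') * (V.reassoc x ?c ?b * V.\<theta> ?c x' c' * V.\<gamma> x ?y ?c'')
     = inverse (V.shuffle ?y ?c'' x ?d1)"
    using V.shuffle_crossing[OF *(1) cl(1) *(3,4)] cl * unfolding eqs
    by (simp add: field_simps)
  finally show ?thesis unfolding WV.K_def .
qed

context center_pair begin

abbreviation M where "M \<equiv> f V * e W"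

lemma M_carrier: "M \<in> carrier_mat (rdim V * rdim W) (rdim V * rdim W)"
  using V.e_carrier[OF W.rep_V] W.e_carrier[OF V.rep_V] by simp

lemma M_K:
  assumes v: "v \<in> V.bigrade x d" and w: "w \<in> W.bigrade x' c'"
    and *: "x \<in> carrier G" "d \<in> carrier G" "x' \<in> carrier G" "c' \<in> carrier G"
  defines "y \<equiv> x \<triangleright> x'" and "d1 \<equiv> d \<triangleleft> c'"
  shows "M *\<^sub>v K x d x' c' v w =
    K (y \<triangleright> x) d1 y (c' \<triangleleft> d1) (V.act x d y c' v) (W.act x' c' x d1 w)"
proof -
  interpret WV: center_pair G \<omega> W f V e by unfold_locales
  have cl: "y \<in> carrier G" "d1 \<in> carrier G" using * by (simp_all add: y_def d1_def)
  have w': "W.P x' c' x w \<in> W.bigrade y c'" using W.P_bigrade[OF w *(3,4,1)] by (simp add: y_def)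
  have v': "V.Q x d c' v \<in> V.bigrade x d1" using V.Q_bigrade[OF v *(1,2,4)] by (simp add: d1_def)
  have "M *\<^sub>v K x d x' c' v w = f V *\<^sub>v (e W *\<^sub>v K x d x' c' v w)"
    by (rule assoc_mult_mat_vec[OF W.e_carrier[OF V.rep_V] V.e_carrier[OF W.rep_V] K_carrier[OF v w *]])
  also have "\<dots> = f V *\<^sub>v WV.K y c' x d1 (W.P x' c' x w) (V.Q x d c' v)"
    unfolding crossing[OF v w *] y_def d1_def ..
  also have "\<dots> = K (y \<triangleright> x) d1 y (c' \<triangleleft> d1) (V.P x d1 y (V.Q x d c' v)) (W.Q y c' d1 (W.P x' c' x w))"
    by (rule WV.crossing[OF w' v' cl(1) *(4,1) cl(2)])
  also have "W.Q y c' d1 (W.P x' c' x w) = W.act x' c' x d1 w"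
    unfolding W.act_def y_def by (rule W.P_Q[OF w *(3,4) cl(2) *(1)])
  also have "V.P x d1 y (V.Q x d c' v) = V.act x d y c' v"
    by (simp add: V.act_def d1_def)
  finally show ?thesis .
qed

text \<open>
  The balancing property: the double braiding composed with the twists is the action of the total
  bidegree \<open>(p, q)\<close>. By \<open>\<theta>_\<gamma>\<close>, once for each kind of factors, the scalars are those by which \<open>(p, q)\<close>
  acts on the tensor product.
\<close>

lemma M_K_T:
  assumes v: "v \<in> V.bigrade x d" and w: "w \<in> W.bigrade x' c'"
    and *: "x \<in> carrier G" "d \<in> carrier G" "x' \<in> carrier G" "c' \<in> carrier G"
  defines "p \<equiv> x \<otimes> x'" and "q \<equiv> d \<otimes> c'"
  shows "M *\<^sub>v K x d x' c' (V.T x d v) (W.T x' c' w) =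
    (V.\<gamma> p (p \<triangleright> x) (p \<triangleright> x') / V.\<gamma> q d c') \<cdot>\<^sub>v
    K (p \<triangleright> x) (d \<triangleleft> q) (p \<triangleright> x') (c' \<triangleleft> q) (V.act x d p q v) (W.act x' c' p q w)"
proof -
  let ?y = "x \<triangleright> x'" let ?d1 = "d \<triangleleft> c'"
  let ?a = "p \<triangleright> x" let ?b = "p \<triangleright> x'"
  have cl: "?y \<in> carrier G" "?d1 \<in> carrier G" "p \<in> carrier G" "q \<in> carrier G" "?a \<in> carrier G" "?b \<in> carrier G"
    using * by (simp_all add: p_def q_def)
  have eqs: "?y \<triangleright> x = ?a" "?y = ?b" "?d1 = d \<triangleleft> q" "c' \<triangleleft> ?d1 = c' \<triangleleft> q"
    "?y \<otimes> x = p" "c' \<otimes> ?d1 = q" "x \<triangleright> x = x" "x' \<triangleright> x' = x'" "d \<triangleleft> d = d" "c' \<triangleleft> c' = c'"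
    "?a \<triangleleft> ?b = x" "?b \<triangleleft> x = x'" "?a \<otimes> ?b = p"
    using * by (simp_all add: p_def q_def V.word)
  have 1: "V.act x d ?y c' (V.T x d v) = (V.\<theta> ?a ?y x / V.\<theta> d d c') \<cdot>\<^sub>v V.act x d p q v"
    using V.act_act[OF v *(1,2,1,2) cl(1) *(4)] unfolding eqs(5,7,9) V.T_def q_def .
  have 2: "W.act x' c' x ?d1 (W.T x' c' w) = (V.\<theta> ?b x x' / V.\<theta> c' c' ?d1) \<cdot>\<^sub>v W.act x' c' p q w"
    using W.act_act[OF w *(3,4,3,4,1) cl(2)] unfolding eqs(6,8,10) W.T_def p_def[symmetric] .
  have a: "V.act x d p q v \<in> V.bigrade ?a (d \<triangleleft> q)" using V.act_bigrade[OF v *(1,2) cl(3,4)] .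
  have \<theta>1: "V.\<theta> ?a ?y x = V.\<theta> ?a ?a ?b" "V.\<theta> ?b x x' = V.\<theta> ?b ?b x"
    using V.\<theta>_conj[OF cl(5,6)] V.\<theta>_conj[OF cl(6) *(1)] unfolding eqs(2,11,12) by simp_all
  have "V.\<theta> ?a ?a ?b * V.\<theta> ?b ?b x = V.\<gamma> p ?a ?b"
    using V.\<theta>_\<gamma>[OF cl(5,6)] unfolding eqs(11,13) .
  moreover have "V.\<theta> d d c' * V.\<theta> c' c' ?d1 = V.\<gamma> q d c'"
    using V.\<theta>_\<gamma>[OF *(2,4)] by (simp add: q_def)
  ultimately have sc: "V.\<theta> ?a ?y x / V.\<theta> d d c' * (V.\<theta> ?b x x' / V.\<theta> c' c' ?d1) = V.\<gamma> p ?a ?b / V.\<gamma> q d c'"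
    unfolding \<theta>1 by (simp add: times_divide_times_eq)
  have "M *\<^sub>v K x d x' c' (V.T x d v) (W.T x' c' w)
    = K ?a (d \<triangleleft> q) ?b (c' \<triangleleft> q) (V.act x d ?y c' (V.T x d v)) (W.act x' c' x ?d1 (W.T x' c' w))"
    using M_K[OF V.T_bigrade[OF v *(1,2)] W.T_bigrade[OF w *(3,4)] *] unfolding eqs(1,4) eqs(2,3)[symmetric] by simp
  also have "\<dots> = (V.\<gamma> p ?a ?b / V.\<gamma> q d c') \<cdot>\<^sub>v K ?a (d \<triangleleft> q) ?b (c' \<triangleleft> q) (V.act x d p q v) (W.act x' c' p q w)"
    unfolding 1 2 sc[symmetric] by (rule K_smult[OF a]) (use cl * in simp_all)
  finally show ?thesis .
qed

text \<open>
  Induction on \<open>k\<close>: after one step, \<open>(p, q)\<close> is still the total bidegree, the twists commute with the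
  action by \<open>T_pow_act\<close>, and \<open>\<gamma>_\<theta>\<close> combines two actions on the tensor product into one at the
  cost of the next factor of \<open>\<Theta>\<close>.
\<close>

lemma M_pow_K:
  assumes "v \<in> V.bigrade x d" and "w \<in> W.bigrade x' c'"
    and "x \<in> carrier G" "d \<in> carrier G" "x' \<in> carrier G" "c' \<in> carrier G"
    and "p = x \<otimes> x'" and "q = d \<otimes> c'"
  shows "(M ^\<^sub>m k) *\<^sub>v K x d x' c' ((V.T x d ^^ k) v) ((W.T x' c' ^^ k) w) =
    (V.\<Theta> k p / V.\<Theta> k q * (V.\<gamma> (p [^] k) (p [^] k \<otimes> x \<otimes> inv (p [^] k)) (p [^] k \<otimes> x' \<otimes> inv (p [^] k))
        / V.\<gamma> (q [^] k) d c')) \<cdot>\<^sub>v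
    K (p [^] k \<otimes> x \<otimes> inv (p [^] k)) (inv (q [^] k) \<otimes> d \<otimes> q [^] k)
      (p [^] k \<otimes> x' \<otimes> inv (p [^] k)) (inv (q [^] k) \<otimes> c' \<otimes> q [^] k)
      (V.act x d (p [^] k) (q [^] k) v) (W.act x' c' (p [^] k) (q [^] k) w)"
  using assms
proof (induction k arbitrary: x d x' c' v w)
  case 0
  thus ?case using W.e_carrier[OF V.rep_V] K_carrier[OF 0(1-6)] by (simp add: V.\<Theta>_def)
next
  case (Suc k)
  note v = Suc.prems(1) and w = Suc.prems(2) and * = Suc.prems(3-6) and p = Suc.prems(7) and q = Suc.prems(8)
  let ?x = "p \<triangleright> x" let ?x' = "p \<triangleright> x'" let ?d = "d \<triangleleft> q" let ?c = "c' \<triangleleft> q"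
  let ?p = "p [^] k" let ?q = "q [^] k"
  let ?p1 = "p [^] Suc k" let ?q1 = "q [^] Suc k"
  let ?xk = "?p1 \<triangleright> x" let ?xk' = "?p1 \<triangleright> x'"
  let ?dk = "d \<triangleleft> ?q1" let ?ck = "c' \<triangleleft> ?q1"
  let ?v = "V.act x d p q v" let ?w = "W.act x' c' p q w"
  let ?s = "V.\<gamma> p ?x ?x' / V.\<gamma> q d c'"
  have pq: "p \<in> carrier G" "q \<in> carrier G" "?p \<in> carrier G" "?q \<in> carrier G" "?p1 \<in> carrier G" "?q1 \<in> carrier G"
    using p q * by simp_all
  have cl: "?x \<in> carrier G" "?d \<in> carrier G" "?x' \<in> carrier G" "?c \<in> carrier G"
    "?xk \<in> carrier G" "?dk \<in> carrier G" "?xk' \<in> carrier G" "?ck \<in> carrier G" using pq * by simp_all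
  have pk: "?p \<otimes> p = ?p1" and qk: "q \<otimes> ?q = ?q1"
    using pq V.nat_pow_comm[of q k 1] by simp_all
  have eqs: "?p \<triangleright> ?x = ?xk" "?p \<triangleright> ?x' = ?xk'"
     "?d \<triangleleft> ?q = ?dk" "?c \<triangleleft> ?q = ?ck" "?xk \<triangleleft> ?p = ?x" "?xk' \<triangleleft> ?p = ?x'"
    using pq * unfolding pk[symmetric] qk[symmetric] by (simp_all add: V.word)
  have p1: "p = ?x \<otimes> ?x'" and q1: "q = ?d \<otimes> ?c" and pp: "?xk \<otimes> ?xk' = p"
  proof -
    show "p = ?x \<otimes> ?x'" "q = ?d \<otimes> ?c" using p q * by (simp_all add: V.word)
    have "?xk \<otimes> ?xk' = ?p1 \<triangleright> p" unfolding p using pq * p by (simp add: V.word)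
    also have "?p1 \<otimes> p = p \<otimes> ?p1" using V.nat_pow_comm[of p "Suc k" 1] pq by simp
    finally show "?xk \<otimes> ?xk' = p" using pq by (simp add: V.m_assoc)
  qed
  have vb: "?v \<in> V.bigrade ?x ?d" using V.act_bigrade[OF v *(1,2) pq(1,2)] .
  have wb: "?w \<in> W.bigrade ?x' ?c" using W.act_bigrade[OF w *(3,4) pq(1,2)] .
  have Tv: "(V.T x d ^^ k) v \<in> V.bigrade x d" and Tw: "(W.T x' c' ^^ k) w \<in> W.bigrade x' c'"
    using v w * by simp_all
  have Tv1: "(V.T ?x ?d ^^ k) ?v \<in> V.bigrade ?x ?d" and Tw1: "(W.T ?x' ?c ^^ k) ?w \<in> W.bigrade ?x' ?c"
    using vb wb cl by simp_all
  have Mk: "M ^\<^sub>m k \<in> carrier_mat (rdim V * rdim W) (rdim V * rdim W)"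
    using pow_carrier_mat[OF M_carrier] .
  have Kc: "K ?x ?d ?x' ?c ((V.T ?x ?d ^^ k) ?v) ((W.T ?x' ?c ^^ k) ?w) \<in> carrier_vec (rdim V * rdim W)"
    by (rule K_carrier[OF Tv1 Tw1 cl(1-4)])
  have Kc0: "K x d x' c' ((V.T x d ^^ Suc k) v) ((W.T x' c' ^^ Suc k) w) \<in> carrier_vec (rdim V * rdim W)"
    by (rule K_carrier[OF V.T_pow_bigrade[OF v *(1,2)] W.T_pow_bigrade[OF w *(3,4)] *])
  have "(M ^\<^sub>m Suc k) *\<^sub>v K x d x' c' ((V.T x d ^^ Suc k) v) ((W.T x' c' ^^ Suc k) w)
    = (M ^\<^sub>m k) *\<^sub>v (M *\<^sub>v K x d x' c' (V.T x d ((V.T x d ^^ k) v)) (W.T x' c' ((W.T x' c' ^^ k) w)))"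
    using assoc_mult_mat_vec[OF Mk M_carrier Kc0] by simp
  also have "\<dots> = (M ^\<^sub>m k) *\<^sub>v (?s \<cdot>\<^sub>v K ?x ?d ?x' ?c ((V.T ?x ?d ^^ k) ?v) ((W.T ?x' ?c ^^ k) ?w))"
    unfolding M_K_T[OF Tv Tw *] p[symmetric] q[symmetric]
      V.T_pow_act[OF v *(1,2) pq(1,2)] W.T_pow_act[OF w *(3,4) pq(1,2)] ..
  also have "\<dots> = ?s \<cdot>\<^sub>v ((M ^\<^sub>m k) *\<^sub>v K ?x ?d ?x' ?c ((V.T ?x ?d ^^ k) ?v) ((W.T ?x' ?c ^^ k) ?w))"
    by (rule mult_mat_vec[OF Mk Kc])
  also have "\<dots> = (?s * (V.\<Theta> k p / V.\<Theta> k q * (V.\<gamma> ?p ?xk ?xk' / V.\<gamma> ?q ?d ?c))) \<cdot>\<^sub>v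
     K ?xk ?dk ?xk' ?ck (V.act ?x ?d ?p ?q ?v) (W.act ?x' ?c ?p ?q ?w)"
    unfolding Suc.IH[OF vb wb cl(1-4) p1 q1] eqs smult_smult_assoc ..
  also have "V.act ?x ?d ?p ?q ?v = (V.\<theta> ?xk ?p p / V.\<theta> d q ?q) \<cdot>\<^sub>v V.act x d ?p1 ?q1 v"
    using V.act_act[OF v *(1,2) pq(1-4)] unfolding pk qk .
  also have "W.act ?x' ?c ?p ?q ?w = (V.\<theta> ?xk' ?p p / V.\<theta> c' q ?q) \<cdot>\<^sub>v W.act x' c' ?p1 ?q1 w"
    using W.act_act[OF w *(3,4) pq(1-4)] unfolding pk qk .
  also have "K ?xk ?dk ?xk' ?ck ((V.\<theta> ?xk ?p p / V.\<theta> d q ?q) \<cdot>\<^sub>v V.act x d ?p1 ?q1 v) ((V.\<theta> ?xk' ?p p / V.\<theta> c' q ?q) \<cdot>\<^sub>v W.act x' c' ?p1 ?q1 w)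
    = (V.\<theta> ?xk ?p p / V.\<theta> d q ?q * (V.\<theta> ?xk' ?p p / V.\<theta> c' q ?q)) \<cdot>\<^sub>v K ?xk ?dk ?xk' ?ck (V.act x d ?p1 ?q1 v) (W.act x' c' ?p1 ?q1 w)"
    by (rule K_smult[OF V.act_bigrade[OF v *(1,2) pq(5,6)] cl(5-7)])
  also have "(?s * (V.\<Theta> k p / V.\<Theta> k q * (V.\<gamma> ?p ?xk ?xk' / V.\<gamma> ?q ?d ?c))) \<cdot>\<^sub>v
      ((V.\<theta> ?xk ?p p / V.\<theta> d q ?q * (V.\<theta> ?xk' ?p p / V.\<theta> c' q ?q)) \<cdot>\<^sub>v K ?xk ?dk ?xk' ?ck (V.act x d ?p1 ?q1 v) (W.act x' c' ?p1 ?q1 w))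
    = (V.\<Theta> (Suc k) p / V.\<Theta> (Suc k) q * (V.\<gamma> ?p1 ?xk ?xk' / V.\<gamma> ?q1 d c'))
      \<cdot>\<^sub>v K ?xk ?dk ?xk' ?ck (V.act x d ?p1 ?q1 v) (W.act x' c' ?p1 ?q1 w)"
  proof -
    have 1: "V.\<gamma> ?p ?xk ?xk' * V.\<gamma> p ?x ?x' * V.\<theta> ?xk ?p p * V.\<theta> ?xk' ?p p = \<omega> p ?p p * V.\<gamma> ?p1 ?xk ?xk'"
      using V.\<gamma>_\<theta>[OF cl(5,7) pq(3,1)] V.\<theta>_pow(2)[OF pq(1), of k] unfolding eqs(5,6) pp pk by simp
    have 2: "V.\<gamma> q d c' * V.\<gamma> ?q ?d ?c * V.\<theta> d q ?q * V.\<theta> c' q ?q = \<omega> q ?q q * V.\<gamma> ?q1 d c'"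
      using V.\<gamma>_\<theta>[OF *(2,4) pq(2,4)] V.\<theta>_pow(1)[OF pq(2), of k] unfolding q[symmetric] qk by simp
    have "?s * (V.\<Theta> k p / V.\<Theta> k q * (V.\<gamma> ?p ?xk ?xk' / V.\<gamma> ?q ?d ?c))
        * (V.\<theta> ?xk ?p p / V.\<theta> d q ?q * (V.\<theta> ?xk' ?p p / V.\<theta> c' q ?q))
      = V.\<Theta> k p / V.\<Theta> k q * ((V.\<gamma> ?p ?xk ?xk' * V.\<gamma> p ?x ?x' * V.\<theta> ?xk ?p p * V.\<theta> ?xk' ?p p)
        / (V.\<gamma> q d c' * V.\<gamma> ?q ?d ?c * V.\<theta> d q ?q * V.\<theta> c' q ?q))"
      by (simp add: mult_ac)
    also have "\<dots> = V.\<Theta> (Suc k) p / V.\<Theta> (Suc k) q * (V.\<gamma> ?p1 ?xk ?xk' / V.\<gamma> ?q1 d c')"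
      unfolding 1 2 by (simp add: V.\<Theta>_def mult.assoc)
    finally show ?thesis unfolding smult_smult_assoc by (rule arg_cong)
  qed
  finally show ?case .
qed

text \<open>
  Under the assumptions the \<open>N\<close>-th powers of the twists and of the action of \<open>(p, q)\<close> are trivial, so
  \<open>M_pow_K\<close> says that the \<open>N\<close>-th power of the double braiding fixes all vectors \<open>K x d x' c' v w\<close>.
  These span \<open>V \<otimes> W\<close>.
\<close>

theorem M_pow_eq_one:
  assumes pow: "\<And>g. g \<in> carrier G \<Longrightarrow> g [^] N = \<one>" and \<Theta>: "\<And>g. g \<in> carrier G \<Longrightarrow> V.\<Theta> N g = 1"
  shows "M ^\<^sub>m N = 1\<^sub>m (rdim V * rdim W)"
proof (rule separatesD[OF separates_vtensor[OF V.separates_bigrade W.separates_bigrade] pow_carrier_mat[OF M_carrier] one_carrier_mat])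
  fix s assume "s \<in> {s \<otimes>\<^sub>v t |s t. s \<in> (\<Union>x\<in>carrier G. \<Union> (V.bigrade x ` carrier G)) \<and> t \<in> (\<Union>x\<in>carrier G. \<Union> (W.bigrade x ` carrier G))}"
  then obtain u w x c x' c' where s: "s = u \<otimes>\<^sub>v w" and u: "u \<in> V.bigrade x c" and w: "w \<in> W.bigrade x' c'"
    and *: "x \<in> carrier G" "c \<in> carrier G" "x' \<in> carrier G" "c' \<in> carrier G" by blast
  let ?d = "c \<triangleleft> x'" let ?r = "V.shuffle x c x' c'"
  have d: "?d \<in> carrier G" "x \<otimes> x' \<in> carrier G" "?d \<otimes> c' \<in> carrier G" using * by simp_all
  have eq: "x' \<triangleright> ?d = c" using * by (simp add: V.word)
  let ?v = "?r \<cdot>\<^sub>v V.Q x c x' u"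
  have v: "?v \<in> V.bigrade x ?d" using V.Q_bigrade[OF u *(1-3)] * by simp
  have sK: "s = K x ?d x' c' ?v w"
    unfolding K_def eq V.unQ_smult[OF V.Q_bigrade[OF u *(1-3)] *(1) d(1) *(3)] V.unQ_Q[OF u *(1-3)]
    using * by (simp add: s vtensor_smult smult_smult_assoc)
  have "(V.T x ?d ^^ N) ?v = ?v" "(W.T x' c' ^^ N) w = w"
    using V.T_pow[OF v *(1) d(1), of N] W.T_pow[OF w *(3,4), of N] v w * d pow \<Theta> by simp_all
  thus "(M ^\<^sub>m N) *\<^sub>v s = 1\<^sub>m (rdim V * rdim W) *\<^sub>v s"
    using M_pow_K[OF v w *(1) d(1) *(3,4) refl refl, of N] K_carrier[OF v w *(1) d(1) *(3,4)] v w * d pow \<Theta>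
    by (simp add: sK)
qed

end

section \<open>The braiding of the representation category\<close>

context finite_cocycle3_group begin

text \<open>
  The braiding of the representation category, given by the \<open>R\<close>-matrix.
\<close>

definition braid where
  "braid V X = flip_mat (rdim V) (rdim X) * act2 D V X (qRmatrix D)"

lemma braid_carrier [simp]: "braid V X \<in> carrier_mat (rdim X * rdim V) (rdim V * rdim X)"
  unfolding braid_def by (rule mult_carrier_mat[OF flip_mat_carrier act2_carrier])

text \<open>
  Covers the \<open>R\<close>-matrix, with \<open>k g = g\<close>, and its inverse, with \<open>k g = inv g\<close>.
\<close>

lemma act2_group_like:
  assumes V: "is_rep D V" and X: "is_rep D X" and v: "v \<in> grade V a" and \<xi>: "\<xi> \<in> grade X b"
    and *: "a \<in> carrier G" "b \<in> carrier G" and k: "\<And>g. g \<in> carrier G \<Longrightarrow> k g \<in> carrier G"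
  shows "act2 D V X (\<lambda>(g, x) (h, y). if x = \<one> \<and> y = k g then r g h else 0) *\<^sub>v (v \<otimes>\<^sub>v \<xi>)
    = r a (k a \<otimes> b \<otimes> inv (k a)) \<cdot>\<^sub>v (v \<otimes>\<^sub>v \<rho> X (k a) \<xi>)"
proof -
  note c = rep_carriers[OF V] rep_carriers[OF X]
  let ?u = "\<lambda>(g, x) (h, y). if x = \<one> \<and> y = k g then r g h else 0"
  let ?F = "\<lambda>(p, q). ?u p q \<cdot>\<^sub>v ((ract V p *\<^sub>v v) \<otimes>\<^sub>v (ract X q *\<^sub>v \<xi>))"
  let ?b = "k a \<otimes> b \<otimes> inv (k a)"
  have b: "?b \<in> carrier G" using * k by simp
  have "act2 D V X ?u *\<^sub>v (v \<otimes>\<^sub>v \<xi>) = ?F ((a, \<one>), (?b, k a))"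
    unfolding act2_vtensor[OF c gradeD[OF v] gradeD[OF \<xi>]]
  proof (rule vsum_single)
    fix z assume zB: "z \<in> (carrier G \<times> carrier G) \<times> (carrier G \<times> carrier G)" and ne: "z \<noteq> ((a, \<one>), (?b, k a))"
    obtain g x h y where z: "z = ((g, x), (h, y))" by (metis prod.exhaust)
    have cl: "g \<in> carrier G" "x \<in> carrier G" "h \<in> carrier G" "y \<in> carrier G" using zB z by auto
    show "?F z = 0\<^sub>v (rdim V * rdim X)"
    proof (cases "x = \<one> \<and> y = k g")
      case True
      have "ract V (g, x) *\<^sub>v v = 0\<^sub>v (rdim V) \<or> ract X (h, y) *\<^sub>v \<xi> = 0\<^sub>v (rdim X)"
        using ract_grade[OF V v *(1) cl(1,2)] ract_grade[OF X \<xi> *(2) cl(3,4)] True ne z * by auto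
      thus ?thesis
        using z carrier_vecD[OF carriers_vec[OF c(1) cl(1,2) gradeD[OF v]]] carrier_vecD[OF carriers_vec[OF c(2) cl(3,4) gradeD[OF \<xi>]]] by auto
    next
      case False
      thus ?thesis using z carriers_vec[OF c(1) cl(1,2) gradeD[OF v]] carriers_vec[OF c(2) cl(3,4) gradeD[OF \<xi>]]
        by (auto intro!: zero_smult vtensor_carrier)
    qed
  next
    show "?F ((a, \<one>), (?b, k a)) \<in> carrier_vec (rdim V * rdim X)"
      using carriers_vec[OF c(1) *(1) one_closed gradeD[OF v]] carriers_vec[OF c(2) b k[OF *(1)] gradeD[OF \<xi>]] by auto
  qed (use * b k in auto)
  thus ?thesis using v \<rho>_eq[OF X \<xi> *(2) k[OF *(1)]] by simp
qed

lemma qRmatrix_eq: "qRmatrix D = (\<lambda>(g, x) (h, y). if x = \<one> \<and> y = g then 1 else 0)"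
  by (simp add: twisted_double_def)

lemma braid_grade:
  assumes V: "is_rep D V" and X: "is_rep D X" and v: "v \<in> grade V a" and \<xi>: "\<xi> \<in> grade X b"
    and *: "a \<in> carrier G" "b \<in> carrier G"
  shows "braid V X *\<^sub>v (v \<otimes>\<^sub>v \<xi>) = \<rho> X a \<xi> \<otimes>\<^sub>v v"
proof -
  have "braid V X *\<^sub>v (v \<otimes>\<^sub>v \<xi>) = flip_mat (rdim V) (rdim X) *\<^sub>v (act2 D V X (qRmatrix D) *\<^sub>v (v \<otimes>\<^sub>v \<xi>))"
    unfolding braid_def by (rule assoc_mult_mat_vec[OF flip_mat_carrier act2_carrier]) (use v \<xi> in simp)
  also have "act2 D V X (qRmatrix D) *\<^sub>v (v \<otimes>\<^sub>v \<xi>) = v \<otimes>\<^sub>v \<rho> X a \<xi>"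
    using act2_group_like[OF V X v \<xi> *, of "\<lambda>g. g" "\<lambda>g h. 1"] unfolding qRmatrix_eq by simp
  finally show ?thesis using v \<xi> by (simp add: flip_mat_vtensor)
qed

lemma grade_tensor_eqI:
  assumes X: "is_rep D X" and Y: "is_rep D Y" and A: "A \<in> carrier_mat r (rdim X * rdim Y)" and B: "B \<in> carrier_mat r (rdim X * rdim Y)"
    and eq: "\<And>a b u w. a \<in> carrier G \<Longrightarrow> b \<in> carrier G \<Longrightarrow> u \<in> grade X a \<Longrightarrow> w \<in> grade Y b \<Longrightarrow>
       A *\<^sub>v (u \<otimes>\<^sub>v w) = B *\<^sub>v (u \<otimes>\<^sub>v w)"
  shows "A = B"
  by (rule separatesD[OF separates_grade_tensor[OF X Y] A B]) (use eq in blast)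

lemma \<gamma>_\<theta>_braid:
  assumes "y \<in> carrier G" "a \<in> carrier G" "b \<in> carrier G"
  shows "\<gamma> y (y \<triangleright> a) (y \<triangleright> b) * \<theta> (y \<triangleright> (a \<triangleright> b)) (y \<triangleright> a) y
    = \<gamma> y (y \<triangleright> (a \<triangleright> b)) (y \<triangleright> a) * \<theta> (y \<triangleright> (a \<triangleright> b)) y a"
  using assms by (simp add: dpr_gamma_def dpr_theta_def word field_simps)

lemma braid_hom:
  assumes V: "is_rep D V" and X: "is_rep D X"
  shows "braid V X \<in> rep_hom D (rep_tensor D V X) (rep_tensor D X V)"
  unfolding rep_hom_def
proof (intro CollectI conjI ballI)
  show "braid V X \<in> carrier_mat (rdim (rep_tensor D X V)) (rdim (rep_tensor D V X))" by simp
  fix p assume "p \<in> qbasis D"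
  then obtain g y where p: "p = (g, y)" "g \<in> carrier G" "y \<in> carrier G" by auto
  let ?T = "rep_tensor D V X" and ?T' = "rep_tensor D X V"
  have T: "ract ?T p \<in> carrier_mat (rdim V * rdim X) (rdim V * rdim X)"
    and T': "ract ?T' p \<in> carrier_mat (rdim X * rdim V) (rdim X * rdim V)"
    using carriersD[OF carriers_tensor] p by (metis rdim_tensor)+
  show "braid V X * ract ?T p = ract ?T' p * braid V X"
  proof (rule grade_tensor_eqI[OF V X mult_carrier_mat[OF braid_carrier T] mult_carrier_mat[OF T' braid_carrier]])
    fix a b v \<xi> assume ab: "a \<in> carrier G" "b \<in> carrier G" and v: "v \<in> grade V a" and \<xi>: "\<xi> \<in> grade X b"
    let ?B = "a \<triangleright> b" let ?g = "y \<triangleright> (a \<otimes> b)"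
    have z: "v \<otimes>\<^sub>v \<xi> \<in> carrier_vec (rdim V * rdim X)" using v \<xi> by simp
    have B: "?B \<in> carrier G" "?B \<otimes> a = a \<otimes> b" using ab by (simp_all add: word)
    note v1 = \<rho>_grade[OF V v ab(1) p(3)] and \<xi>1 = \<rho>_grade[OF X \<xi> ab(2) p(3)] and \<xi>2 = \<rho>_grade[OF X \<xi> ab(2,1)]
    note c = gradeD[OF v1] gradeD[OF \<xi>1]
    have yy: "y \<triangleright> a \<otimes> y = y \<otimes> a" "(y \<otimes> a) \<triangleright> b = y \<triangleright> ?B"
      using ab p by (simp_all add: word)
    have "braid V X *\<^sub>v (ract ?T p *\<^sub>v (v \<otimes>\<^sub>v \<xi>)) = ract ?T' p *\<^sub>v (braid V X *\<^sub>v (v \<otimes>\<^sub>v \<xi>))"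
    proof (cases "g = ?g")
      case True
      have "braid V X *\<^sub>v (ract ?T p *\<^sub>v (v \<otimes>\<^sub>v \<xi>))
        = braid V X *\<^sub>v (\<gamma> y (y \<triangleright> a) (y \<triangleright> b) \<cdot>\<^sub>v (\<rho> V y v \<otimes>\<^sub>v \<rho> X y \<xi>))"
        using ract_tensor_grade[OF V X v \<xi> ab p(2,3)] True p by simp
      also have "\<dots> = \<gamma> y (y \<triangleright> a) (y \<triangleright> b) \<cdot>\<^sub>v (\<rho> X (y \<triangleright> a) (\<rho> X y \<xi>) \<otimes>\<^sub>v \<rho> V y v)"
        using mult_mat_vec[OF braid_carrier vtensor_carrier[OF c]] braid_grade[OF V X v1 \<xi>1] ab p by simp
      also have "\<dots> = (\<gamma> y (y \<triangleright> a) (y \<triangleright> b) * \<theta> (y \<triangleright> ?B) (y \<triangleright> a) y) \<cdot>\<^sub>v (\<rho> X (y \<otimes> a) \<xi> \<otimes>\<^sub>v \<rho> V y v)"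
        using \<rho>_\<rho>[OF X \<xi> ab(2) _ p(3), of "y \<triangleright> a"] ab p unfolding yy by (simp add: vtensor_smult smult_smult_assoc)
      also have "\<dots> = \<gamma> y (y \<triangleright> ?B) (y \<triangleright> a) \<cdot>\<^sub>v (\<rho> X y (\<rho> X a \<xi>) \<otimes>\<^sub>v \<rho> V y v)"
        unfolding \<gamma>_\<theta>_braid[OF p(3) ab]
        using \<rho>_\<rho>[OF X \<xi> ab(2) p(3) ab(1)] unfolding yy by (simp add: vtensor_smult smult_smult_assoc)
      also have "\<dots> = ract ?T' p *\<^sub>v (\<rho> X a \<xi> \<otimes>\<^sub>v v)"
        using ract_tensor_grade[OF X V \<xi>2 v B(1) ab(1) p(2,3)] True p unfolding B(2) by simp
      finally show ?thesis unfolding braid_grade[OF V X v \<xi> ab] .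
    next
      case False
      have "ract ?T p *\<^sub>v (v \<otimes>\<^sub>v \<xi>) = 0\<^sub>v (rdim V * rdim X)"
        using ract_tensor_grade[OF V X v \<xi> ab p(2,3)] False p by simp
      moreover have "ract ?T' p *\<^sub>v (\<rho> X a \<xi> \<otimes>\<^sub>v v) = 0\<^sub>v (rdim X * rdim V)"
        using ract_tensor_grade[OF X V \<xi>2 v B(1) ab(1) p(2,3)] False p unfolding B(2) by simp
      ultimately show ?thesis unfolding braid_grade[OF V X v \<xi> ab] using mult_mat_vec_zero[OF braid_carrier, of V X] by simp
    qed
    thus "braid V X * ract ?T p *\<^sub>v (v \<otimes>\<^sub>v \<xi>) = ract ?T' p * braid V X *\<^sub>v (v \<otimes>\<^sub>v \<xi>)"
      unfolding assoc_mult_mat_vec[OF braid_carrier T z] assoc_mult_mat_vec[OF T' braid_carrier z] .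
  qed
qed

text \<open>
  The inverse of the \<open>R\<close>-matrix lets \<open>inv g\<close> act; the scalar corrects for the product of the actions
  of \<open>g\<close> and \<open>inv g\<close>.
\<close>

lemma braid_invertible:
  assumes V: "is_rep D V" and X: "is_rep D X"
  shows "invertible_mat (braid V X)"
proof -
  define B where "B = act2 D V X (\<lambda>(g, x) (h, y). if x = \<one> \<and> y = inv g then inverse (\<theta> (g \<triangleright> h) g (inv g)) else 0)
    * flip_mat (rdim X) (rdim V)"
  have B: "B \<in> carrier_mat (rdim V * rdim X) (rdim X * rdim V)"
    unfolding B_def by (rule mult_carrier_mat[OF act2_carrier flip_mat_carrier])
  have 1: "braid V X * B = 1\<^sub>m (rdim X * rdim V)"
  proof (rule grade_tensor_eqI[OF X V mult_carrier_mat[OF braid_carrier B] one_carrier_mat])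
    fix b a \<xi> v assume ab: "b \<in> carrier G" "a \<in> carrier G" and \<xi>: "\<xi> \<in> grade X b" and v: "v \<in> grade V a"
    let ?r = "inverse (\<theta> b a (inv a))"
    note \<xi>1 = \<rho>_grade[OF X \<xi> ab(1) inv_closed[OF ab(2)]]
    have eq: "a \<triangleright> (inv a \<otimes> b \<otimes> inv (inv a)) = b" using ab by (simp add: word)
    have "B *\<^sub>v (\<xi> \<otimes>\<^sub>v v) = act2 D V X (\<lambda>(g, x) (h, y). if x = \<one> \<and> y = inv g then inverse (\<theta> (g \<triangleright> h) g (inv g)) else 0)
       *\<^sub>v (flip_mat (rdim X) (rdim V) *\<^sub>v (\<xi> \<otimes>\<^sub>v v))"
      unfolding B_def by (rule assoc_mult_mat_vec[OF act2_carrier flip_mat_carrier]) (use \<xi> v in simp)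
    also have "flip_mat (rdim X) (rdim V) *\<^sub>v (\<xi> \<otimes>\<^sub>v v) = v \<otimes>\<^sub>v \<xi>"
      using \<xi> v by (simp add: flip_mat_vtensor)
    also have "act2 D V X (\<lambda>(g, x) (h, y). if x = \<one> \<and> y = inv g then inverse (\<theta> (g \<triangleright> h) g (inv g)) else 0) *\<^sub>v (v \<otimes>\<^sub>v \<xi>)
      = ?r \<cdot>\<^sub>v (v \<otimes>\<^sub>v \<rho> X (inv a) \<xi>)"
      using act2_group_like[OF V X v \<xi> ab(2,1), of "\<lambda>g. inv g" "\<lambda>g h. inverse (\<theta> (g \<triangleright> h) g (inv g))"] unfolding eq by simp
    finally have "braid V X *\<^sub>v (B *\<^sub>v (\<xi> \<otimes>\<^sub>v v)) = ?r \<cdot>\<^sub>v (\<rho> X a (\<rho> X (inv a) \<xi>) \<otimes>\<^sub>v v)"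
      using mult_mat_vec[OF braid_carrier vtensor_carrier[OF gradeD[OF v] gradeD[OF \<xi>1]]] braid_grade[OF V X v \<xi>1] ab by simp
    also have "\<dots> = \<xi> \<otimes>\<^sub>v v"
      using \<rho>_\<rho>[OF X \<xi> ab(1,2), of "inv a"] X \<xi> ab by (simp add: vtensor_smult smult_smult_assoc)
    finally show "braid V X * B *\<^sub>v (\<xi> \<otimes>\<^sub>v v) = 1\<^sub>m (rdim X * rdim V) *\<^sub>v (\<xi> \<otimes>\<^sub>v v)"
      using assoc_mult_mat_vec[OF braid_carrier B, of "\<xi> \<otimes>\<^sub>v v"] \<xi> v by simp
  qed
  have "B * braid V X = 1\<^sub>m (rdim X * rdim V)"
    by (rule mat_mult_left_right_inverse[OF _ _ 1]) (use B braid_carrier[of V X] in \<open>simp_all add: mult.commute\<close>)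
  thus ?thesis using 1 B braid_carrier[of V X]
    by (auto simp: invertible_mat_def inverts_mat_def mult.commute intro!: exI[of _ B])
qed

lemma hom_grade:
  assumes X: "is_rep D X" and Y: "is_rep D Y" and f: "f \<in> rep_hom D X Y" and \<xi>: "\<xi> \<in> grade X b"
    and *: "b \<in> carrier G" "x \<in> carrier G"
  shows "f *\<^sub>v \<xi> \<in> grade Y b" "f *\<^sub>v \<rho> X x \<xi> = \<rho> Y x (f *\<^sub>v \<xi>)"
proof -
  have fc: "f \<in> carrier_mat (rdim Y) (rdim X)" using f by (simp add: rep_hom_def)
  have eq: "f *\<^sub>v (ract X (g, y) *\<^sub>v \<xi>) = ract Y (g, y) *\<^sub>v (f *\<^sub>v \<xi>)" if "g \<in> carrier G" "y \<in> carrier G" for g y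
  proof -
    have "f * ract X (g, y) = ract Y (g, y) * f" using f that by (auto simp: rep_hom_def)
    thus ?thesis
      using assoc_mult_mat_vec[OF fc carriersD[OF rep_carriers[OF X] that] gradeD[OF \<xi>]]
        assoc_mult_mat_vec[OF carriersD[OF rep_carriers[OF Y] that] fc gradeD[OF \<xi>]] by simp
  qed
  show 1: "f *\<^sub>v \<xi> \<in> grade Y b"
    using eq[of b \<one>] fc \<xi> * by (intro gradeI) (auto intro: mult_mat_vec_carrier)
  show "f *\<^sub>v \<rho> X x \<xi> = \<rho> Y x (f *\<^sub>v \<xi>)"
    unfolding \<rho>_eq[OF X \<xi> *] \<rho>_eq[OF Y 1 *] using eq * by simp
qed

lemma braid_natural:
  assumes V: "is_rep D V" and X: "is_rep D X" and Y: "is_rep D Y" and f: "f \<in> rep_hom D X Y"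
  shows "braid V Y * kron (1\<^sub>m (rdim V)) f = kron f (1\<^sub>m (rdim V)) * braid V X"
proof -
  have fc: "f \<in> carrier_mat (rdim Y) (rdim X)" using f by (simp add: rep_hom_def)
  note k1 = kron_carrier[OF one_carrier_mat[of "rdim V"] fc] and k2 = kron_carrier[OF fc one_carrier_mat[of "rdim V"]]
  show ?thesis
  proof (rule grade_tensor_eqI[OF V X mult_carrier_mat[OF braid_carrier k1] mult_carrier_mat[OF k2 braid_carrier]])
    fix a b v \<xi> assume ab: "a \<in> carrier G" "b \<in> carrier G" and v: "v \<in> grade V a" and \<xi>: "\<xi> \<in> grade X b"
    have z: "v \<otimes>\<^sub>v \<xi> \<in> carrier_vec (rdim V * rdim X)" using v \<xi> by simp
    note h = hom_grade[OF X Y f \<xi> ab(2,1)]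
    have "braid V Y *\<^sub>v (kron (1\<^sub>m (rdim V)) f *\<^sub>v (v \<otimes>\<^sub>v \<xi>)) = kron f (1\<^sub>m (rdim V)) *\<^sub>v (braid V X *\<^sub>v (v \<otimes>\<^sub>v \<xi>))"
      using kron_mult_vtensor[OF one_carrier_mat fc gradeD[OF v] gradeD[OF \<xi>]] braid_grade[OF V X v \<xi> ab] braid_grade[OF V Y v h(1) ab]
        kron_mult_vtensor[OF fc one_carrier_mat \<rho>_carrier[OF gradeD[OF \<xi>], of a] gradeD[OF v]] h(2) v by simp
    thus "braid V Y * kron (1\<^sub>m (rdim V)) f *\<^sub>v (v \<otimes>\<^sub>v \<xi>) = kron f (1\<^sub>m (rdim V)) * braid V X *\<^sub>v (v \<otimes>\<^sub>v \<xi>)"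
      unfolding assoc_mult_mat_vec[OF braid_carrier k1 z] assoc_mult_mat_vec[OF k2 braid_carrier z] .
  qed
qed

lemma braid_hexagon:
  assumes V: "is_rep D V" and X: "is_rep D X" and Y: "is_rep D Y"
  shows "rep_assoc D X Y V * braid V (rep_tensor D X Y) * rep_assoc D V X Y =
      kron (1\<^sub>m (rdim X)) (braid V Y) * rep_assoc D X V Y * kron (braid V X) (1\<^sub>m (rdim Y))" (is "?L = ?R")
proof -
  let ?T = "rep_tensor D X Y"
  have c1: "braid V ?T \<in> carrier_mat (rdim X * rdim Y * rdim V) (rdim V * rdim X * rdim Y)"
    using braid_carrier[of V ?T] by (simp add: mult.assoc)
  have c2: "kron (1\<^sub>m (rdim X)) (braid V Y) \<in> carrier_mat (rdim X * rdim Y * rdim V) (rdim X * rdim V * rdim Y)"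
    using kron_carrier[OF one_carrier_mat[of "rdim X"] braid_carrier[of V Y]] by (simp add: mult.assoc)
  have c3: "kron (braid V X) (1\<^sub>m (rdim Y)) \<in> carrier_mat (rdim X * rdim V * rdim Y) (rdim V * rdim X * rdim Y)"
    using kron_carrier[OF braid_carrier[of V X] one_carrier_mat[of "rdim Y"]] by simp
  note a1 = rep_assoc_carrier[of D X Y V] and a2 = rep_assoc_carrier[of D V X Y] and a3 = rep_assoc_carrier[of D X V Y]
  show ?thesis
  proof (rule separatesD[OF separates_vtensor[OF separates_grade_tensor[OF V X] separates_grade[OF Y]]
        mult_carrier_mat[OF mult_carrier_mat[OF a1 c1] a2] mult_carrier_mat[OF mult_carrier_mat[OF c2 a3] c3]])
    fix s assume "s \<in> {s \<otimes>\<^sub>v t |s t. s \<in> {u \<otimes>\<^sub>v w |u w. u \<in> \<Union> (grade V ` carrier G) \<and> w \<in> \<Union> (grade X ` carrier G)} \<and> t \<in> \<Union> (grade Y ` carrier G)}"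
    then obtain v \<xi> \<eta> a b c where s: "s = v \<otimes>\<^sub>v \<xi> \<otimes>\<^sub>v \<eta>" and v: "v \<in> grade V a" and \<xi>: "\<xi> \<in> grade X b" and \<eta>: "\<eta> \<in> grade Y c"
      and *: "a \<in> carrier G" "b \<in> carrier G" "c \<in> carrier G" by blast
    have z: "s \<in> carrier_vec (rdim V * rdim X * rdim Y)" using v \<xi> \<eta> s by simp
    let ?B = "a \<triangleright> b" and ?C = "a \<triangleright> c"
    note \<xi>1 = \<rho>_grade[OF X \<xi> *(2,1)] and \<eta>1 = \<rho>_grade[OF Y \<eta> *(3,1)]
    have cl: "?B \<in> carrier G" "?C \<in> carrier G" using * by simp_all
    let ?z = "\<rho> X a \<xi> \<otimes>\<^sub>v \<rho> Y a \<eta> \<otimes>\<^sub>v v" let ?y = "\<rho> X a \<xi> \<otimes>\<^sub>v v \<otimes>\<^sub>v \<eta>"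
    have zc: "?z \<in> carrier_vec (rdim X * rdim Y * rdim V)" and yc: "?y \<in> carrier_vec (rdim X * rdim V * rdim Y)" using v \<xi> \<eta> by simp_all
    have "?L *\<^sub>v s = rep_assoc D X Y V *\<^sub>v (braid V ?T *\<^sub>v (rep_assoc D V X Y *\<^sub>v s))"
      unfolding assoc_mult_mat_vec[OF mult_carrier_mat[OF a1 c1] a2 z] by (rule assoc_mult_mat_vec[OF a1 c1 mult_mat_vec_carrier[OF a2 z]])
    also have "\<dots> = inverse (\<omega> a b c) \<cdot>\<^sub>v (rep_assoc D X Y V *\<^sub>v (braid V ?T *\<^sub>v s))"
      unfolding s rep_assoc_grade[OF V X Y v \<xi> \<eta> *] mult_mat_vec[OF c1 z[unfolded s]]
      by (rule mult_mat_vec[OF a1 mult_mat_vec_carrier[OF c1 z[unfolded s]]])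
    also have "braid V ?T *\<^sub>v s = \<gamma> a ?B ?C \<cdot>\<^sub>v ?z"
      unfolding s vtensor_assoc[of v] braid_grade[OF V is_rep_tensor[OF X Y] v vtensor_grade[OF X Y \<xi> \<eta> *(2,3)] *(1) m_closed[OF *(2,3)]]
        \<rho>_tensor[OF X Y \<xi> \<eta> *(2,3,1)] by (simp add: vtensor_smult)
    also have "rep_assoc D X Y V *\<^sub>v (\<gamma> a ?B ?C \<cdot>\<^sub>v ?z) = (\<gamma> a ?B ?C * inverse (\<omega> ?B ?C a)) \<cdot>\<^sub>v ?z"
      unfolding mult_mat_vec[OF a1 zc] rep_assoc_grade[OF X Y V \<xi>1 \<eta>1 v cl *(1)] smult_smult_assoc ..
    also have "inverse (\<omega> a b c) \<cdot>\<^sub>v \<dots> = inverse (\<omega> ?B a c) \<cdot>\<^sub>v ?z"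
      unfolding smult_smult_assoc using * by (simp add: dpr_gamma_def word field_simps)
    finally have L: "?L *\<^sub>v s = inverse (\<omega> ?B a c) \<cdot>\<^sub>v ?z" .
    have "?R *\<^sub>v s = kron (1\<^sub>m (rdim X)) (braid V Y) *\<^sub>v (rep_assoc D X V Y *\<^sub>v (kron (braid V X) (1\<^sub>m (rdim Y)) *\<^sub>v s))"
      unfolding assoc_mult_mat_vec[OF mult_carrier_mat[OF c2 a3] c3 z] by (rule assoc_mult_mat_vec[OF c2 a3 mult_mat_vec_carrier[OF c3 z]])
    also have "kron (braid V X) (1\<^sub>m (rdim Y)) *\<^sub>v s = ?y"
      unfolding s using kron_mult_vtensor[OF braid_carrier[of V X] one_carrier_mat vtensor_carrier[OF gradeD[OF v] gradeD[OF \<xi>]] gradeD[OF \<eta>]]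
        braid_grade[OF V X v \<xi> *(1,2)] \<eta> by simp
    also have "rep_assoc D X V Y *\<^sub>v ?y = inverse (\<omega> ?B a c) \<cdot>\<^sub>v ?y"
      by (rule rep_assoc_grade[OF X V Y \<xi>1 v \<eta> cl(1) *(1,3)])
    also have "kron (1\<^sub>m (rdim X)) (braid V Y) *\<^sub>v (inverse (\<omega> ?B a c) \<cdot>\<^sub>v ?y) = inverse (\<omega> ?B a c) \<cdot>\<^sub>v (kron (1\<^sub>m (rdim X)) (braid V Y) *\<^sub>v ?y)"
      by (rule mult_mat_vec[OF c2 yc])
    also have "kron (1\<^sub>m (rdim X)) (braid V Y) *\<^sub>v ?y = ?z"
      unfolding vtensor_assoc using kron_mult_vtensor[OF one_carrier_mat braid_carrier[of V Y] gradeD[OF \<xi>1] vtensor_carrier[OF gradeD[OF v] gradeD[OF \<eta>]]]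
        braid_grade[OF V Y v \<eta> *(1,3)] \<xi>1 by simp
    finally show "?L *\<^sub>v s = ?R *\<^sub>v s" unfolding L ..
  qed
qed

lemma braid_center:
  assumes V: "is_rep D V"
  shows "(V, braid V) \<in> rep_center D"
  using V braid_hom[OF V] braid_invertible[OF V] braid_natural[OF V] braid_hexagon[OF V]
  unfolding rep_center_def half_braiding_def by blast

end

section \<open>The exponent\<close>

context finite_cocycle3_group begin

definition kills_center where
  "kills_center N \<longleftrightarrow> (\<forall>U\<in>rep_center D. \<forall>V\<in>rep_center D.
      (center_braiding V U * center_braiding U V) ^\<^sub>m N = 1\<^sub>m (rdim (fst U) * rdim (fst V)))"

lemma center_objectI: "(V, e) \<in> rep_center D \<Longrightarrow> center_object G \<omega> V e"
  by unfold_locales (auto simp: rep_center_def)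

lemma kills_centerI:
  assumes "\<And>g. g \<in> carrier G \<Longrightarrow> g [^] N = \<one>" and "\<And>g. g \<in> carrier G \<Longrightarrow> \<Theta> N g = 1"
  shows "kills_center N"
  unfolding kills_center_def
proof (intro ballI)
  fix U V assume UV: "U \<in> rep_center D" "V \<in> rep_center D"
  obtain U1 e V1 f where eq: "U = (U1, e)" "V = (V1, f)" by (metis prod.exhaust)
  interpret U: center_object G \<omega> U1 e using center_objectI UV(1) eq by simp
  interpret V: center_object G \<omega> V1 f using center_objectI UV(2) eq by simp
  interpret center_pair G \<omega> U1 e V1 f by unfold_locales
  show "(center_braiding V U * center_braiding U V) ^\<^sub>m N = 1\<^sub>m (rdim (fst U) * rdim (fst V))"
    using M_pow_eq_one[OF assms] by (simp add: center_braiding_def eq)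
qed

lemma exp_eq_Least: "quasi_hopf_exp D = (LEAST N. 1 \<le> N \<and> kills_center N)"
  by (simp add: quasi_hopf_exp_def kills_center_def)

lemma double_braiding_carrier:
  assumes "U \<in> rep_center D" "V \<in> rep_center D"
  shows "center_braiding V U * center_braiding U V
    \<in> carrier_mat (rdim (fst U) * rdim (fst V)) (rdim (fst U) * rdim (fst V))"
proof -
  obtain U1 e V1 f where eq: "U = (U1, e)" "V = (V1, f)" by (metis prod.exhaust)
  interpret U: center_object G \<omega> U1 e using center_objectI assms(1) eq by simp
  interpret V: center_object G \<omega> V1 f using center_objectI assms(2) eq by simp
  interpret center_pair G \<omega> U1 e V1 f by unfold_locales
  show ?thesis using M_carrier by (simp add: center_braiding_def eq)
qed

lemma kills_center_dvd:
  assumes L: "kills_center L" and dvd: "L dvd N"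
  shows "kills_center N"
proof -
  obtain k where N: "N = k * L" using dvd by (metis dvdE mult.commute)
  show ?thesis unfolding kills_center_def N
    using L double_braiding_carrier by (auto simp: kills_center_def intro!: pow_mat_mult_one)
qed

text \<open>
  The exponents that kill all double braidings are closed under division with remainder, so that
  the least positive one divides all of them.
\<close>

lemma kills_center_mod:
  assumes L: "kills_center L" and N: "kills_center N"
  shows "kills_center (N mod L)"
  unfolding kills_center_def
proof (intro ballI)
  fix U V assume UV: "U \<in> rep_center D" "V \<in> rep_center D"
  let ?M = "center_braiding V U * center_braiding U V" and ?d = "rdim (fst U) * rdim (fst V)"
  note M = double_braiding_carrier[OF UV]
  have "?M ^\<^sub>m (N div L * L) = 1\<^sub>m ?d"
    by (rule pow_mat_mult_one[OF M]) (use L UV in \<open>auto simp: kills_center_def\<close>)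
  hence "?M ^\<^sub>m (N div L * L + N mod L) = ?M ^\<^sub>m (N mod L)"
    unfolding pow_mat_add[OF M] using left_mult_one_mat[OF pow_carrier_mat[OF M, of "N mod L"]] by simp
  thus "?M ^\<^sub>m (N mod L) = 1\<^sub>m ?d" using N UV by (auto simp: kills_center_def)
qed

lemma exp_dvd_iff:
  assumes N0: "1 \<le> N0" "kills_center N0"
  shows "quasi_hopf_exp D dvd N \<longleftrightarrow> kills_center N"
proof -
  let ?L = "quasi_hopf_exp D"
  have L: "1 \<le> ?L" "kills_center ?L"
    using LeastI[of "\<lambda>N. 1 \<le> N \<and> kills_center N" N0] N0 unfolding exp_eq_Least by auto
  have min: "?L \<le> k" if "1 \<le> k" "kills_center k" for k
    using Least_le[of "\<lambda>N. 1 \<le> N \<and> kills_center N" k] that unfolding exp_eq_Least by auto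
  show ?thesis
  proof
    assume "kills_center N"
    hence "kills_center (N mod ?L)" by (rule kills_center_mod[OF L(2)])
    moreover have "N mod ?L < ?L" using L(1) by simp
    ultimately have "N mod ?L = 0" using min[of "N mod ?L"] by (cases "N mod ?L = 0") auto
    thus "?L dvd N" by auto
  next
    assume "?L dvd N"
    thus "kills_center N" by (rule kills_center_dvd[OF L(2)])
  qed
qed

text \<open>
  An element that acts repeatedly on its own degree picks up the factors of \<open>\<Theta>\<close>.
\<close>

lemma \<rho>_pow:
  assumes V: "is_rep D V" and v: "v \<in> grade V g" and g: "g \<in> carrier G"
  shows "((\<lambda>v. \<rho> V g v) ^^ k) v = \<Theta> k g \<cdot>\<^sub>v \<rho> V (g [^] k) v"
proof (induction k)
  case 0 show ?case using assms by (simp add: \<Theta>_def)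
next
  case (Suc k)
  have comm: "g \<otimes> g [^] k = g [^] Suc k" using nat_pow_comm[of g 1 k] g by simp
  have eq: "g \<otimes> g [^] k \<otimes> g \<otimes> inv (g \<otimes> g [^] k) = g"
  proof -
    have "g [^] Suc k \<otimes> g = g \<otimes> g [^] Suc k"
      using nat_pow_comm[of g "Suc k" 1] g by (simp del: nat_pow_Suc)
    thus ?thesis unfolding comm using g nat_pow_closed[OF g, of "Suc k"] by (simp add: m_assoc del: nat_pow_Suc)
  qed
  have "\<rho> V g (\<rho> V (g [^] k) v) = \<omega> g (g [^] k) g \<cdot>\<^sub>v \<rho> V (g [^] Suc k) v"
    using \<rho>_\<rho>[OF V v g g, of "g [^] k"] \<theta>_pow(1)[OF g] g unfolding eq unfolding comm by simp
  thus ?case using Suc v by (simp add: \<rho>_smult smult_smult_assoc \<Theta>_def)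
qed

text \<open>
  In the regular representation, with the braiding as half-braiding, take a nonzero vector \<open>v\<close> of
  degree \<open>g\<close>. The double braiding acts on \<open>v \<otimes> v\<close> by \<open>g\<close> on both factors, so its \<open>N\<close>-th power acts
  by \<open>\<Theta> N g\<close> on each of them.
\<close>

lemma kills_center_\<Theta>:
  assumes N: "kills_center N" and g: "g \<in> carrier G" "g [^] N = \<one>"
  shows "\<Theta> N g ^ 2 = 1"
proof -
  let ?V = regular and ?v = "basis_vec (g, \<one>)"
  let ?c = "braid regular regular" let ?T = "\<lambda>v. \<rho> ?V g v" let ?d = "reg_dim * reg_dim"
  note R = is_rep_regular
  have c: "?c \<in> carrier_mat ?d ?d" using braid_carrier[of regular regular] by simp
  have cc: "?c * ?c \<in> carrier_mat ?d ?d" using c by simp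
  have v: "?v \<in> grade ?V g" using g by simp
  have T: "(?T ^^ k) ?v \<in> grade ?V g" for k
  proof (induction k)
    case (Suc k)
    thus ?case using \<rho>_grade[OF R Suc g(1) g(1)] g by (simp add: m_assoc)
  qed (use v in simp)
  have step: "?c * ?c *\<^sub>v (u \<otimes>\<^sub>v w) = ?T u \<otimes>\<^sub>v ?T w" if u: "u \<in> grade ?V g" and w: "w \<in> grade ?V g" for u w
  proof -
    have Tw: "?T w \<in> grade ?V g" using \<rho>_grade[OF R w g(1) g(1)] g by (simp add: m_assoc)
    have "?c * ?c *\<^sub>v (u \<otimes>\<^sub>v w) = ?c *\<^sub>v (?c *\<^sub>v (u \<otimes>\<^sub>v w))"
      by (rule assoc_mult_mat_vec[OF c c]) (use gradeD[OF u] gradeD[OF w] in simp)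
    thus ?thesis using braid_grade[OF R R u w g(1) g(1)] braid_grade[OF R R Tw u g(1) g(1)] by simp
  qed
  have "((?c * ?c) ^\<^sub>m k) *\<^sub>v (u \<otimes>\<^sub>v w) = (?T ^^ k) u \<otimes>\<^sub>v (?T ^^ k) w"
    if u: "u \<in> grade ?V g" and w: "w \<in> grade ?V g" for k u w
    using that
  proof (induction k arbitrary: u w)
    case 0 thus ?case using c gradeD[OF 0(1)] gradeD[OF 0(2)] by simp
  next
    case (Suc k)
    have Tu: "?T u \<in> grade ?V g" "?T w \<in> grade ?V g"
      using \<rho>_grade[OF R Suc(2) g(1) g(1)] \<rho>_grade[OF R Suc(3) g(1) g(1)] g by (simp_all add: m_assoc)
    have "((?c * ?c) ^\<^sub>m Suc k) *\<^sub>v (u \<otimes>\<^sub>v w) = ((?c * ?c) ^\<^sub>m k) *\<^sub>v ((?c * ?c) *\<^sub>v (u \<otimes>\<^sub>v w))"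
      using assoc_mult_mat_vec[OF pow_carrier_mat[OF cc] cc, of "u \<otimes>\<^sub>v w" k] gradeD[OF Suc(2)] gradeD[OF Suc(3)] by simp
    thus ?case unfolding step[OF Suc(2,3)] Suc(1)[OF Tu] by (simp add: funpow_swap1)
  qed
  from this[OF v v, of N] have "((?c * ?c) ^\<^sub>m N) *\<^sub>v (?v \<otimes>\<^sub>v ?v) = (\<Theta> N g ^ 2) \<cdot>\<^sub>v (?v \<otimes>\<^sub>v ?v)"
    unfolding \<rho>_pow[OF R v g(1)] g(2)
    using \<rho>_one[OF R v g(1)] by (simp add: vtensor_smult smult_smult_assoc power2_eq_square)
  moreover have "(?c * ?c) ^\<^sub>m N = 1\<^sub>m ?d"
    using N braid_center[OF R] unfolding kills_center_def center_braiding_def by fastforce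
  ultimately have "?v \<otimes>\<^sub>v ?v = (\<Theta> N g ^ 2) \<cdot>\<^sub>v (?v \<otimes>\<^sub>v ?v)" by simp
  hence "coef reg_dim (g, \<one>) (?v \<otimes>\<^sub>v ?v) = coef reg_dim (g, \<one>) ((\<Theta> N g ^ 2) \<cdot>\<^sub>v (?v \<otimes>\<^sub>v ?v))" by simp
  hence "?v = (\<Theta> N g ^ 2) \<cdot>\<^sub>v ?v" using g by (simp add: coef_smult)
  hence "?v $ basis_index (g, \<one>) = ((\<Theta> N g ^ 2) \<cdot>\<^sub>v ?v) $ basis_index (g, \<one>)" by simp
  thus ?thesis using g by (simp add: basis_vec_def)
qed

end

theorem theorem5p12:
  fixes G :: "('g, 'm) monoid_scheme"
    and \<omega> :: "'g \<Rightarrow> 'g \<Rightarrow> 'g \<Rightarrow> 'k::{alg_closed_field, field_char_0}"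
  assumes "group G"
    and "finite (carrier G)"
    and "cocycle3 G \<omega>"
    and "normalized3 G \<omega>"
  shows "((\<forall>g\<in>carrier G. class_order (cyclic_sub G g) \<omega> dvd cyclic_index G g) \<longrightarrow>
            quasi_hopf_exp (twisted_double G \<omega>) dvd Coset.order G) \<and>
         (odd (Coset.order G) \<longrightarrow>
           ((\<forall>g\<in>carrier G. class_order (cyclic_sub G g) \<omega> dvd cyclic_index G g) \<longleftrightarrow>
            quasi_hopf_exp (twisted_double G \<omega>) dvd Coset.order G))"
proof -
  interpret group G by fact
  interpret finite_cocycle3_group G \<omega> by unfold_locales fact+
  let ?n = "Coset.order G"
  have pow: "g [^]\<^bsub>G\<^esub> ?n = \<one>\<^bsub>G\<^esub>" if "g \<in> carrier G" for g using pow_order_eq_1[OF that] .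
  have n: "1 \<le> ?n" using order_gt_0_iff_finite by (simp add: Suc_le_eq)
  have index: "?n = cyclic_index G g * ord g" if "g \<in> carrier G" for g
    using lagrange[OF generate_is_subgroup[of "{g}"]] generate_pow_card[OF that] that by (simp add: cyclic_index_def)
  have \<Theta>n: "\<Theta> ?n g = \<Theta> (ord g) g ^ cyclic_index G g" if "g \<in> carrier G" for g
    unfolding index[OF that] by (rule \<Theta>_period[OF that])
  have local: "class_order (cyclic_sub G g) \<omega> dvd cyclic_index G g \<longleftrightarrow> \<Theta> ?n g = 1" if "g \<in> carrier G" for g
    unfolding class_order_cyclic_sub_dvd_iff[OF that finite_carrier] \<Theta>n[OF that] ..
  \<comment> \<open>This makes the set over which the exponent is the minimum nonempty.\<close>
  have "kills_center (?n * ?n)"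
  proof (rule kills_centerI)
    fix g assume g: "g \<in> carrier G"
    show "g [^]\<^bsub>G\<^esub> (?n * ?n) = \<one>\<^bsub>G\<^esub>" using pow[OF g] g by (simp flip: nat_pow_pow)
    have "?n * ?n = (?n * cyclic_index G g) * ord g" using index[OF g] by simp
    hence "\<Theta> (?n * ?n) g = \<Theta> (ord g) g ^ (?n * cyclic_index G g)" using \<Theta>_period[OF g] by metis
    also have "?n * cyclic_index G g = ord g * (cyclic_index G g * cyclic_index G g)" using index[OF g] by simp
    finally show "\<Theta> (?n * ?n) g = 1" by (simp add: power_mult \<Theta>_ord_pow[OF g finite_carrier])
  qed
  hence exp: "quasi_hopf_exp D dvd N \<longleftrightarrow> kills_center N" for N
    using exp_dvd_iff[of "?n * ?n"] n by simp
  have 1: "quasi_hopf_exp D dvd ?n" if "\<forall>g\<in>carrier G. class_order (cyclic_sub G g) \<omega> dvd cyclic_index G g"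
    unfolding exp by (rule kills_centerI) (use pow local that in auto)
  have 2: "class_order (cyclic_sub G g) \<omega> dvd cyclic_index G g"
    if odd: "odd ?n" and dvd: "quasi_hopf_exp D dvd ?n" and g: "g \<in> carrier G" for g
  proof -
    have "\<Theta> ?n g ^ 2 = 1" using kills_center_\<Theta>[OF _ g pow[OF g]] dvd exp by simp
    moreover have "\<Theta> ?n g ^ ord g = 1"
      unfolding \<Theta>n[OF g] using \<Theta>_ord_pow[OF g finite_carrier] by (metis power_mult mult.commute power_one)
    \<comment> \<open>An element of odd order whose square is trivial is itself trivial.\<close>
    moreover obtain j where "ord g = Suc (2 * j)"
      using odd index[OF g] by (metis even_mult_iff oddE Suc_eq_plus1)
    ultimately have "\<Theta> ?n g = 1" by (simp add: power_mult)
    thus ?thesis using local[OF g] by simp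
  qed
  show ?thesis using 1 2 by blast
qed

end
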